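(* Let $(P_\lambda)_{\lambda\in[0,1]}$ be a family of bond percolation models on $\mathbb{Z}^2$ such that: (i) (monotonicity) for every increasing event $A$, the map $\lambda\mapsto P_\lambda(A)$ is non-decreasing; (ii) for every $\lambda$, $P_\lambda$ is invariant under the symmetries of $\mathbb{Z}^2$ and ergodic with respect to shifts; (iii) for every $\lambda$, $P_\lambda$ satisfies the FKG inequality: $P_\lambda(A\cap B)\ge P_\lambda(A)P_\lambda(B)$ for all increasing events $A,B$; (iv) there exists a non-increasing sequence $(r_n)$ of non-negative reals with $\sum_{n\ge1} r_n/n<\infty$ such that, for every $n\ge 1$, every $\lambda\in[0,1]$, and all events $A$ and $B$ with supports in $[-3n,3n]^2$ and $\mathbb{Z}^2\setminus[-4n,4n]^2$, respectively, $\mathrm{Cov}_\lambda(\mathbf 1_A,\mathbf 1_B)\le r_n$; (v) for every finitely-supported event $A$, the map $\lambda\mapsto P_\lambda(A)$ is continuous; (vi) for every finitely-supported non-trivial increasing event $A$, $\lim_{\lambda\to0}P_\lambda(A)=0$ and $\lim_{\lambda\to1}P_\lambda(A)=1$. Let $\theta(\lambda)=P_\lambda(0\leftrightarrow\infty)$ and $\lambda_c=\inf\{\lambda:\theta(\lambda)>0\}$. Then the critical threshold is non-trivial, i.e. $\lambda_c\in(0,1)$, and $\theta(\lambda_c)=0$.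
   Context: A bond percolation model on $\mathbb{Z}^2$ is a probability measure on configurations $\omega\in\{0,1\}^{E}$ (with the product $\sigma$-algebra), where $E$ is the set of nearest-neighbour edges of $\mathbb{Z}^2$; an edge $e$ is open if $\omega_e=1$. An event is increasing if its indicator is non-decreasing in $\omega$ for the coordinatewise order. An event has support in $S\subseteq\mathbb{Z}^2$ if it depends only on the states of edges with both endpoints in $S$; it is finitely-supported if it depends on finitely many edges; it is non-trivial if it is neither empty nor the whole configuration space. Symmetries of $\mathbb{Z}^2$ are translations, rotations by multiples of $\pi/2$, and reflections preserving $\mathbb{Z}^2$; ergodic with respect to shifts means every event invariant under all translations of $\mathbb{Z}^2$ has probability $0$ or $1$. $\mathrm{Cov}_\lambda$ is covariance under $P_\lambda$. $\{0\leftrightarrow\infty\}$ is the event that the origin lies in an infinite connected component of open edges. *)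

theory Defs
  imports "HOL-Probability.Probability"
begin

type_synonym vertex = "int \<times> int"
type_synonym edge = "vertex set"
type_synonym config = "edge \<Rightarrow> bool"

definition adjacent :: "vertex \<Rightarrow> vertex \<Rightarrow> bool" where
  "adjacent x y \<longleftrightarrow> \<bar>fst x - fst y\<bar> + \<bar>snd x - snd y\<bar> = 1"

definition lattice_edges :: "edge set" where
  "lattice_edges = {{x, y} |x y. adjacent x y}"

text \<open>Configurations are functions on edges, with \<open>True\<close> meaning open; as usual for \<open>PiM\<close> they
  take the value \<open>undefined\<close> off the index set \<open>lattice_edges\<close>.\<close>

definition config_space :: "config measure" where
  "config_space = (\<Pi>\<^sub>M e\<in>lattice_edges. count_space (UNIV :: bool set))"

definition bond_percolation :: "config measure \<Rightarrow> bool" where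
  "bond_percolation M \<longleftrightarrow> prob_space M \<and> sets M = sets config_space"

definition increasing_event :: "config set \<Rightarrow> bool" where
  "increasing_event A \<longleftrightarrow> A \<in> sets config_space \<and>
     (\<forall>\<omega>\<in>A. \<forall>\<omega>'\<in>space config_space.
        (\<forall>e\<in>lattice_edges. \<omega> e \<le> \<omega>' e) \<longrightarrow> \<omega>' \<in> A)"

definition depends_on :: "config set \<Rightarrow> edge set \<Rightarrow> bool" where
  "depends_on A F \<longleftrightarrow>
     (\<forall>\<omega>\<in>space config_space. \<forall>\<omega>'\<in>space config_space.
        (\<forall>e\<in>F. \<omega> e = \<omega>' e) \<longrightarrow> (\<omega> \<in> A \<longleftrightarrow> \<omega>' \<in> A))"

definition edges_within :: "vertex set \<Rightarrow> edge set" where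
  "edges_within S = {e \<in> lattice_edges. e \<subseteq> S}"

definition event_supported_in :: "config set \<Rightarrow> vertex set \<Rightarrow> bool" where
  "event_supported_in A S \<longleftrightarrow> A \<in> sets config_space \<and> depends_on A (edges_within S)"

definition finitely_supported_event :: "config set \<Rightarrow> bool" where
  "finitely_supported_event A \<longleftrightarrow> A \<in> sets config_space \<and>
     (\<exists>F. finite F \<and> F \<subseteq> lattice_edges \<and> depends_on A F)"

definition nontrivial_event :: "config set \<Rightarrow> bool" where
  "nontrivial_event A \<longleftrightarrow> A \<noteq> {} \<and> A \<noteq> space config_space"

definition lattice_box :: "int \<Rightarrow> vertex set" where
  "lattice_box n = {-n..n} \<times> {-n..n}"

definition translation :: "vertex \<Rightarrow> vertex \<Rightarrow> vertex" where
  "translation v x = x + v"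

text \<open>The group generated by the translations, the quarter turn about the origin and one axis
  reflection; it contains every rotation by a multiple of a right angle and every reflection that
  preserves the lattice, whatever their centre or axis.\<close>

inductive_set lattice_symmetries :: "(vertex \<Rightarrow> vertex) set" where
  translation: "translation v \<in> lattice_symmetries"
| rotation: "(\<lambda>(a, b). (-b, a)) \<in> lattice_symmetries"
| reflection: "(\<lambda>(a, b). (a, -b)) \<in> lattice_symmetries"
| compose: "g \<in> lattice_symmetries \<Longrightarrow> h \<in> lattice_symmetries \<Longrightarrow> g \<circ> h \<in> lattice_symmetries"

definition pullback :: "(vertex \<Rightarrow> vertex) \<Rightarrow> config \<Rightarrow> config" where
  "pullback g \<omega> = (\<lambda>e\<in>lattice_edges. \<omega> (g ` e))"

definition symmetry_invariant :: "config measure \<Rightarrow> bool" where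
  "symmetry_invariant M \<longleftrightarrow> (\<forall>g\<in>lattice_symmetries. distr M M (pullback g) = M)"

definition shift_ergodic :: "config measure \<Rightarrow> bool" where
  "shift_ergodic M \<longleftrightarrow>
     (\<forall>A\<in>sets M. (\<forall>v. pullback (translation v) -` A \<inter> space M = A) \<longrightarrow>
        measure M A = 0 \<or> measure M A = 1)"

definition satisfies_FKG :: "config measure \<Rightarrow> bool" where
  "satisfies_FKG M \<longleftrightarrow>
     (\<forall>A B. increasing_event A \<longrightarrow> increasing_event B \<longrightarrow>
        measure M (A \<inter> B) \<ge> measure M A * measure M B)"

definition covariance :: "'a measure \<Rightarrow> ('a \<Rightarrow> real) \<Rightarrow> ('a \<Rightarrow> real) \<Rightarrow> real" where
  "covariance M X Y =
     integral\<^sup>L M (\<lambda>\<omega>. (X \<omega> - integral\<^sup>L M X) * (Y \<omega> - integral\<^sup>L M Y))"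

definition cluster :: "config \<Rightarrow> vertex \<Rightarrow> vertex set" where
  "cluster \<omega> x = {y. (x, y) \<in> {(u, v). adjacent u v \<and> \<omega> {u, v}}\<^sup>*}"

definition connected_to_infinity :: "config set" where
  "connected_to_infinity = {\<omega> \<in> space config_space. infinite (cluster \<omega> (0, 0))}"

definition percolation_density :: "(real \<Rightarrow> config measure) \<Rightarrow> real \<Rightarrow> real" where
  "percolation_density P l = measure (P l) connected_to_infinity"

text \<open>The infimum is taken in the parameter space \<open>[0,1]\<close>, so the infimum of the empty set is \<open>1\<close>
  (\<open>Inf {}\<close> is unspecified on \<open>real\<close>).\<close>

definition critical_parameter :: "(real \<Rightarrow> config measure) \<Rightarrow> real" where
  "critical_parameter P =
     (let S = {l \<in> {0..1}. percolation_density P l > 0} in if S = {} then 1 else Inf S)"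

text \<open>Since \<open>measure\<close> and \<open>distr\<close> take junk values on non-measurable arguments, we record that the
  arguments used above are measurable.\<close>

lemma symmetry_edge:
  assumes "g \<in> lattice_symmetries" "e \<in> lattice_edges"
  shows "g ` e \<in> lattice_edges"
proof -
  have adj: "adjacent (g x) (g y)" if "adjacent x y" for x y
    using assms(1) that
    by (induction arbitrary: x y rule: lattice_symmetries.induct)
       (auto simp: adjacent_def translation_def split: prod.splits)
  obtain x y where "e = {x, y}" "adjacent x y"
    using assms(2) by (auto simp: lattice_edges_def)
  then have "g ` e = {g x, g y}" "adjacent (g x) (g y)"
    using adj by auto
  then show ?thesis
    unfolding lattice_edges_def by blast
qed

lemma measurable_edge [measurable]:
  "e \<in> lattice_edges \<Longrightarrow> (\<lambda>\<omega>. \<omega> e) \<in> config_space \<rightarrow>\<^sub>M count_space UNIV"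
  unfolding config_space_def by measurable

lemma measurable_pullback:
  assumes "g \<in> lattice_symmetries"
  shows "pullback g \<in> config_space \<rightarrow>\<^sub>M config_space"
proof -
  have "(\<lambda>\<omega>. \<lambda>e\<in>lattice_edges. \<omega> (g ` e)) \<in>
      config_space \<rightarrow>\<^sub>M (\<Pi>\<^sub>M e\<in>lattice_edges. count_space UNIV)"
    by (intro measurable_restrict measurable_edge symmetry_edge assms)
  then show ?thesis
    by (simp only: pullback_def[abs_def] config_space_def[symmetric])
qed

lemma connected_to_infinity_event: "connected_to_infinity \<in> sets config_space"
proof -
  define R :: "config \<Rightarrow> (vertex \<times> vertex) set"
    where "R \<omega> = {(u, v). adjacent u v \<and> \<omega> {u, v}}" for \<omega>
  have R: "Measurable.pred config_space (\<lambda>\<omega>. (u, v) \<in> R \<omega>)" for u v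
  proof (cases "adjacent u v")
    case True
    then have "{u, v} \<in> lattice_edges" unfolding lattice_edges_def by blast
    from measurable_edge[OF this] show ?thesis using True by (simp add: R_def)
  qed (simp add: R_def)
  have pow: "Measurable.pred config_space (\<lambda>\<omega>. (x, y) \<in> R \<omega> ^^ n)" for n x y
  proof (induction n arbitrary: y)
    case (Suc n)
    have "(\<lambda>\<omega>. (x, y) \<in> R \<omega> ^^ Suc n) =
        (\<lambda>\<omega>. \<exists>z. (x, z) \<in> R \<omega> ^^ n \<and> (z, y) \<in> R \<omega>)"
      by (simp add: relcomp_unfold)
    then show ?case using Suc R by simp
  qed simp
  have cl: "Measurable.pred config_space (\<lambda>\<omega>. y \<in> cluster \<omega> x)" for x y
  proof -
    have "(\<lambda>\<omega>. y \<in> cluster \<omega> x) = (\<lambda>\<omega>. \<exists>n. (x, y) \<in> R \<omega> ^^ n)"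
      by (auto simp: cluster_def R_def rtrancl_power)
    then show ?thesis using pow by simp
  qed
  have inf: "infinite S \<longleftrightarrow> (\<forall>xs. \<exists>y. y \<in> S \<and> y \<notin> set xs)" for S :: "vertex set"
  proof -
    have "finite S \<longleftrightarrow> (\<exists>xs. S \<subseteq> set xs)"
      using finite_list[of S] finite_subset[of S] by (metis List.finite_set order_refl)
    then show ?thesis by (simp add: subset_iff)
  qed
  have "Measurable.pred config_space (\<lambda>\<omega>. infinite (cluster \<omega> (0, 0)))"
    unfolding inf using cl by measurable
  then show ?thesis
    unfolding connected_to_infinity_def by measurable
qed

end

theory Submission
  imports Defs
begin

text \<open>Let \<open>\<theta> > 0\<close>. If the dual model had hard-way crossings of rectangles with probability bounded below at
  infinitely many scales, dual circuits would surround every box by mixing. Hence, by a Russo-Seymour-Welsh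
  argument that uses only FKG and the symmetries, the primal model has such crossings at infinitely many
  scales, so dual boxes are not connected to distance; with ergodicity this makes square crossings likely, and
  the same argument, run with probabilities close to 1, makes a hard-way crossing as likely as
  desired at some large scale. Conversely, the decorrelation estimate gives
  \<open>\<beta> (3 n) \<le> C ((\<beta> n)^2 + r n)\<close> for the failure probability \<open>\<beta>\<close> of hard-way crossings, so if \<open>\<beta>\<close> is small at one
  large scale then crossings at all scales \<open>3 ^ j n\<close> occur together and form an infinite cluster. Thus \<open>\<theta> > 0\<close> is
  equivalent to a finite-volume condition, which is open in the parameter by continuity; in particular
  \<open>\<theta>\<close> vanishes at the critical parameter. The same recursion for annulus crossings
  gives \<open>\<theta> = 0\<close> near \<open>0\<close>.\<close>

section \<open>Planar crossings\<close>

text \<open>Without independence, a crossing cannot be explored and then reflected, so crossings are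
  trapped instead. An arch is a cluster that touches both vertical sides of a box above and below a
  gap of half-width \<open>g\<close>; a path that ends in the gap must hit it. If hard-way crossings
  are unlikely, crossings of the square of twice the size rarely end in a window of size
  \<open>g\<close>, so they reach heights beyond \<open>4 * (g + 1)\<close> and produce a new arch:
  the gap grows by the factor 4 while the scale grows by 2, which cannot go on. In
  \<open>hard_crossing_self_or_dual\<close>, square crossings are only known to be likely for the
  model or for its dual, and which of the two may change with the scale;
  \<open>arch_or_dual_arm\<close> carries the induction across such a change. In the
  renormalisation, monotonicity of \<open>r\<close> turns convergence of the sum of
  \<open>r n / n\<close> into small sums of \<open>r\<close> along geometric scales, an error that a
  quadratic recursion absorbs.\<close>

definition openrel :: "config \<Rightarrow> vertex set \<Rightarrow> (vertex \<times> vertex) set" where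
  "openrel \<omega> S = {(u, v). u \<in> S \<and> v \<in> S \<and> adjacent u v \<and> \<omega> {u, v}}"

text \<open>For \<open>x\<close> outside \<open>S\<close> this is \<open>{x}\<close>, which is why
  statements placing the cluster inside \<open>S\<close> assume \<open>x \<in> S\<close>.\<close>

definition clus :: "config \<Rightarrow> vertex set \<Rightarrow> vertex \<Rightarrow> vertex set" where
  "clus \<omega> S x = {u. (x, u) \<in> (openrel \<omega> S)\<^sup>*}"

definition rect :: "int \<Rightarrow> int \<Rightarrow> int \<Rightarrow> int \<Rightarrow> vertex set" where
  "rect a b c d = {a..b} \<times> {c..d}"

definition lattice_connected :: "vertex set \<Rightarrow> bool" where
  "lattice_connected C \<longleftrightarrow> (\<forall>u\<in>C. \<forall>v\<in>C. (u, v) \<in> {(s, t). adjacent s t \<and> s \<in> C \<and> t \<in> C}\<^sup>*)"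

lemma rect_iff [simp]: "(x, y) \<in> rect a b c d \<longleftrightarrow> a \<le> x \<and> x \<le> b \<and> c \<le> y \<and> y \<le> d"
  by (auto simp: rect_def)

lemma rect_iff': "p \<in> rect a b c d \<longleftrightarrow> a \<le> fst p \<and> fst p \<le> b \<and> c \<le> snd p \<and> snd p \<le> d"
  by (cases p) auto

lemma finite_rect [simp]: "finite (rect a b c d)"
  by (simp add: rect_def)

lemma adjacent_sym: "adjacent u v \<Longrightarrow> adjacent v u"
  by (auto simp: adjacent_def)

lemma adjacent_edge: "adjacent u v \<Longrightarrow> {u, v} \<in> lattice_edges"
  unfolding lattice_edges_def by blast

lemma sym_openrel: "sym (openrel \<omega> S)"
  by (auto simp: openrel_def sym_def adjacent_sym insert_commute)

lemma clus_refl [simp]: "x \<in> clus \<omega> S x"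
  by (simp add: clus_def)

lemma clus_sub: "x \<in> S \<Longrightarrow> clus \<omega> S x \<subseteq> S"
proof
  fix u assume "x \<in> S" "u \<in> clus \<omega> S x"
  then have "(x, u) \<in> (openrel \<omega> S)\<^sup>*" by (simp add: clus_def)
  then show "u \<in> S" using \<open>x \<in> S\<close> by (induction) (auto simp: openrel_def)
qed

lemma clus_sym: "u \<in> clus \<omega> S x \<longleftrightarrow> x \<in> clus \<omega> S u"
  unfolding clus_def mem_Collect_eq
  by (metis sym_openrel sym_rtrancl symD)

lemma clus_trans: "u \<in> clus \<omega> S x \<Longrightarrow> v \<in> clus \<omega> S u \<Longrightarrow> v \<in> clus \<omega> S x"
  unfolding clus_def by (auto intro: rtrancl_trans)

lemma clus_eq: "u \<in> clus \<omega> S x \<Longrightarrow> clus \<omega> S u = clus \<omega> S x"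
  using clus_trans clus_sym by blast

lemma clus_mono:
  assumes "S \<subseteq> T" shows "clus \<omega> S x \<subseteq> clus \<omega> T x"
proof -
  have "openrel \<omega> S \<subseteq> openrel \<omega> T" using assms by (auto simp: openrel_def)
  from rtrancl_mono[OF this] show ?thesis by (auto simp: clus_def)
qed

lemma clus_mono_config:
  assumes "\<And>e. e \<in> lattice_edges \<Longrightarrow> \<omega> e \<Longrightarrow> \<omega>' e"
  shows "clus \<omega> S x \<subseteq> clus \<omega>' S x"
proof -
  have "openrel \<omega> S \<subseteq> openrel \<omega>' S" using assms adjacent_edge by (auto simp: openrel_def)
  from rtrancl_mono[OF this] show ?thesis by (auto simp: clus_def)
qed

lemma clus_step: "u \<in> clus \<omega> S x \<Longrightarrow> (u, v) \<in> openrel \<omega> S \<Longrightarrow> v \<in> clus \<omega> S x"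
  unfolding clus_def by (auto intro: rtrancl.rtrancl_into_rtrancl)

lemma clus_path:
  assumes "u \<in> clus \<omega> S x"
  shows "(x, u) \<in> {(s, t). (s, t) \<in> openrel \<omega> S \<and> s \<in> clus \<omega> S x \<and> t \<in> clus \<omega> S x}\<^sup>*"
proof -
  have "(x, u) \<in> (openrel \<omega> S)\<^sup>*" using assms by (simp add: clus_def)
  then show ?thesis
  proof (induction)
    case (step y z)
    then have "y \<in> clus \<omega> S x" by (simp add: clus_def)
    with step.hyps have "(y, z) \<in> {(s, t). (s, t) \<in> openrel \<omega> S \<and> s \<in> clus \<omega> S x \<and> t \<in> clus \<omega> S x}"
      using clus_step by blast
    then show ?case using step.IH by (meson rtrancl.rtrancl_into_rtrancl)
  qed simp
qed

lemma lattice_connectedI: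
  assumes "\<And>u. u \<in> C \<Longrightarrow> (x, u) \<in> {(s, t). adjacent s t \<and> s \<in> C \<and> t \<in> C}\<^sup>*"
  shows "lattice_connected C"
proof -
  have "sym ({(s, t). adjacent s t \<and> s \<in> C \<and> t \<in> C}\<^sup>*)"
    by (rule sym_rtrancl) (auto simp: sym_def adjacent_sym)
  then show ?thesis
    unfolding lattice_connected_def using assms by (meson rtrancl_trans symD)
qed

lemma lattice_connected_clus: "lattice_connected (clus \<omega> S x)"
proof (rule lattice_connectedI)
  fix u assume "u \<in> clus \<omega> S x"
  from clus_path[OF this]
  show "(x, u) \<in> {(s, t). adjacent s t \<and> s \<in> clus \<omega> S x \<and> t \<in> clus \<omega> S x}\<^sup>*"
    by (rule rtrancl_mono[THEN subsetD, rotated]) (auto simp: openrel_def)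
qed

lemma lattice_connected_Un:
  assumes "lattice_connected A" "lattice_connected B" "a \<in> A" "b \<in> B" "a = b \<or> adjacent a b"
  shows "lattice_connected (A \<union> B)"
proof (rule lattice_connectedI)
  let ?R = "\<lambda>C. {(s, t). adjacent s t \<and> s \<in> C \<and> t \<in> C}"
  have mA: "(?R A)\<^sup>* \<subseteq> (?R (A \<union> B))\<^sup>*" and mB: "(?R B)\<^sup>* \<subseteq> (?R (A \<union> B))\<^sup>*"
    by (intro rtrancl_mono; auto)+
  have ab: "(a, b) \<in> (?R (A \<union> B))\<^sup>*"
    using assms by auto
  fix u assume "u \<in> A \<union> B"
  then show "(a, u) \<in> (?R (A \<union> B))\<^sup>*"
  proof
    assume "u \<in> A" then show ?thesis using assms(1,3) mA unfolding lattice_connected_def by blast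
  next
    assume "u \<in> B"
    then have "(b, u) \<in> (?R (A \<union> B))\<^sup>*" using assms(2,4) mB unfolding lattice_connected_def by blast
    with ab show ?thesis by (rule rtrancl_trans)
  qed
qed

lemma lattice_connected_singleton: "lattice_connected {v}"
  by (simp add: lattice_connected_def)

lemma lattice_connected_insert:
  assumes "lattice_connected A" "a \<in> A" "adjacent a v"
  shows "lattice_connected (insert v A)"
  using lattice_connected_Un[OF assms(1) lattice_connected_singleton[of v] assms(2), of v] assms(3) by simp

lemma lattice_connected_column: "lattice_connected ({x} \<times> {c..d::int})"
proof (cases "c \<le> d")
  case True
  let ?C = "{x} \<times> {c..d}"
  have "(( x, c), (x, y)) \<in> {(s, t). adjacent s t \<and> s \<in> ?C \<and> t \<in> ?C}\<^sup>*" if "c \<le> y" "y \<le> d" for y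
    using that
  proof (induction y rule: int_ge_induct)
    case (step i)
    then have "((x, i), (x, i + 1)) \<in> {(s, t). adjacent s t \<and> s \<in> ?C \<and> t \<in> ?C}"
      by (auto simp: adjacent_def)
    with step show ?case by (meson order.trans rtrancl.rtrancl_into_rtrancl zle_add1_eq_le
          less_add_one less_imp_le)
  qed simp
  then show ?thesis by (intro lattice_connectedI[of _ "(x, c)"]) auto
qed (simp add: lattice_connected_def)

section \<open>Crossing parity of a path and a walk shifted by half a unit\<close>

lemma rtrancl_walk:
  assumes "(u, v) \<in> R\<^sup>*" "u \<in> C" "R \<subseteq> C \<times> C"
  shows "\<exists>q. q \<noteq> [] \<and> hd q = u \<and> last q = v \<and> successively (\<lambda>s t. (s, t) \<in> R) q \<and> set q \<subseteq> C"
  using assms(1)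
proof (induction rule: converse_rtrancl_induct)
  case base
  have "v \<in> C" using assms by (metis SigmaD2 rtranclE subsetD)
  then show ?case by (intro exI[of _ "[v]"]) auto
next
  case (step y z)
  then obtain q where q: "q \<noteq> []" "hd q = z" "last q = v"
    "successively (\<lambda>s t. (s, t) \<in> R) q" "set q \<subseteq> C" by blast
  then show ?case using step(1) assms(3)
    by (intro exI[of _ "y # q"]) (cases q; auto)
qed

fun count_steps :: "('a \<Rightarrow> 'a \<Rightarrow> bool) \<Rightarrow> 'a list \<Rightarrow> nat" where
  "count_steps P (u # v # r) = (if P u v then 1 else 0) + count_steps P (v # r)"
| "count_steps P _ = 0"

lemma count_steps_cong:
  "successively (\<lambda>u v. P u v = Q u v) q \<Longrightarrow> count_steps P q = count_steps Q q"
  by (induction q rule: induct_list012) auto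

lemma count_steps_disj:
  "successively (\<lambda>u v. (P u v \<longleftrightarrow> Q u v \<noteq> R u v) \<and> \<not> (Q u v \<and> R u v)) q \<Longrightarrow>
   count_steps P q = count_steps Q q + count_steps R q"
  by (induction q rule: induct_list012) auto

lemma count_steps_parity:
  "q \<noteq> [] \<Longrightarrow> even (count_steps (\<lambda>u v. (u \<in> Z) \<noteq> (v \<in> Z)) q) \<longleftrightarrow> (hd q \<in> Z \<longleftrightarrow> last q \<in> Z)"
  by (induction q rule: induct_list012) auto

text \<open>A vertex \<open>(i, j)\<close> of the walk is read as the point
  \<open>(i + 1/2, j + 1/2)\<close>. A step between the rows \<open>y - 1\<close> and
  \<open>y\<close> then crosses the height \<open>y\<close>, and \<open>fst u < x\<close> puts it to
  the left of \<open>(x, y)\<close>.\<close>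

definition vstep :: "int \<Rightarrow> int \<Rightarrow> vertex \<Rightarrow> vertex \<Rightarrow> bool" where
  "vstep x y u v \<longleftrightarrow> fst u < x \<and> fst v < x \<and>
     (snd u = y - 1 \<and> snd v = y \<or> snd u = y \<and> snd v = y - 1)"

text \<open>The edge is read as shifted by \<open>(1/2, 1/2)\<close>. The maximal coordinates are
  those of its right or upper endpoint, and the unshifted edge that it crosses starts at the vertex
  with these coordinates.\<close>

definition dedge :: "edge \<Rightarrow> edge" where
  "dedge e = (let i = Max (fst ` e); j = Max (snd ` e) in
     if card (snd ` e) = 1 then {(i, j), (i, j + 1)} else {(i, j), (i + 1, j)})"

lemma dedge_h [simp]: "dedge {(i, j), (i + 1, j)} = {(i + 1, j), (i + 1, j + 1)}"
  "dedge {(i + 1, j), (i, j)} = {(i + 1, j), (i + 1, j + 1)}"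
  and dedge_v [simp]: "dedge {(i, j), (i, j + 1)} = {(i, j + 1), (i + 1, j + 1)}"
  "dedge {(i, j + 1), (i, j)} = {(i, j + 1), (i + 1, j + 1)}"
  by (auto simp: dedge_def Let_def)

lemma adjacent_cases:
  assumes "adjacent u v"
  obtains (right) i j where "u = (i, j)" "v = (i + 1, j)"
  | (left) i j where "u = (i + 1, j)" "v = (i, j)"
  | (up) i j where "u = (i, j)" "v = (i, j + 1)"
  | (down) i j where "u = (i, j + 1)" "v = (i, j)"
proof -
  obtain a b c d where uv: "u = (a, b)" "v = (c, d)" by (cases u, cases v) auto
  have "\<bar>a - c\<bar> + \<bar>b - d\<bar> = 1" using assms uv by (simp add: adjacent_def)
  then have "(c = a + 1 \<and> d = b) \<or> (a = c + 1 \<and> d = b) \<or> (a = c \<and> d = b + 1) \<or> (a = c \<and> b = d + 1)"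
    by arith
  then show thesis using that uv by blast
qed

text \<open>This turns disjointness of two vertex sets of the same lattice into absence of crossings
  after a half-unit shift.\<close>

lemma dedge_meets: "adjacent s t \<Longrightarrow> s \<in> dedge {s, t} \<or> t \<in> dedge {s, t}"
  by (erule adjacent_cases) auto

definition crossfree :: "vertex list \<Rightarrow> vertex \<Rightarrow> vertex \<Rightarrow> bool" where
  "crossfree q u v \<longleftrightarrow> successively (\<lambda>s t. dedge {s, t} \<noteq> {u, v}) q"

lemma crossfree_sym: "crossfree q u v = crossfree q v u"
  by (simp add: crossfree_def insert_commute)

lemma successively_conj:
  "successively P q \<Longrightarrow> successively Q q \<Longrightarrow> successively (\<lambda>u v. P u v \<and> Q u v) q"
  by (induction q rule: induct_list012) auto

text \<open>Lengthening the ray by one unit adds only the steps between \<open>(x, y - 1)\<close>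
  and \<open>(x, y)\<close>, and these are the steps that cross the edge
  \<open>{(x, y), (x + 1, y)}\<close>.\<close>

lemma count_steps_parity_right:
  assumes "successively adjacent q" "crossfree q (x, y) (x + 1, y)"
  shows "count_steps (vstep (x + 1) y) q = count_steps (vstep x y) q"
proof (rule count_steps_cong)
  have "successively (\<lambda>s t. adjacent s t \<and> dedge {s, t} \<noteq> {(x, y), (x + 1, y)}) q"
    using assms successively_conj unfolding crossfree_def by blast
  then show "successively (\<lambda>s t. vstep (x + 1) y s t = vstep x y s t) q"
  proof (rule successively_mono, goal_cases)
    case (1 s t)
    then have *: "adjacent s t" "dedge {s, t} \<noteq> {(x, y), (x + 1, y)}" by auto
    from *(1) show ?case
    proof (cases rule: adjacent_cases)
      case (up i j)
      with * have "\<not> (i = x \<and> j = y - 1)" by auto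
      then show ?thesis using up by (auto simp: vstep_def)
    next
      case (down i j)
      with * have "\<not> (i = x \<and> j = y - 1)" by auto
      then show ?thesis using down by (auto simp: vstep_def)
    qed (auto simp: vstep_def)
  qed
qed

text \<open>The steps across the two rays together are those that enter or leave the half-line
  \<open>{..<x} \<times> {y}\<close> vertically. The only other entrance, between
  \<open>(x - 1, y)\<close> and \<open>(x, y)\<close>, crosses the excluded edge, and the walk
  starts and ends outside, so the total is even.\<close>

lemma count_steps_parity_up:
  assumes "successively adjacent q" "crossfree q (x, y) (x, y + 1)" "q \<noteq> []"
    "hd q \<notin> {..<x} \<times> {y}" "last q \<notin> {..<x} \<times> {y}"
  shows "even (count_steps (vstep x y) q) \<longleftrightarrow> even (count_steps (vstep x (y + 1)) q)"
proof -
  let ?Z = "{..<x} \<times> {y}"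
  have "count_steps (\<lambda>u v. (u \<in> ?Z) \<noteq> (v \<in> ?Z)) q = count_steps (vstep x y) q + count_steps (vstep x (y + 1)) q"
  proof (rule count_steps_disj)
    have "successively (\<lambda>s t. adjacent s t \<and> dedge {s, t} \<noteq> {(x, y), (x, y + 1)}) q"
      using assms successively_conj unfolding crossfree_def by blast
    then show "successively (\<lambda>u v. ((u \<in> ?Z) \<noteq> (v \<in> ?Z)) = (vstep x y u v \<noteq> vstep x (y + 1) u v) \<and>
        \<not> (vstep x y u v \<and> vstep x (y + 1) u v)) q"
    proof (rule successively_mono, goal_cases)
      case (1 s t)
      then have *: "adjacent s t" "dedge {s, t} \<noteq> {(x, y), (x, y + 1)}" by auto
      from *(1) show ?case
      proof (cases rule: adjacent_cases)
        case (right i j)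
        with * have "\<not> (i = x - 1 \<and> j = y)" by auto
        then show ?thesis using right by (auto simp: vstep_def)
      next
        case (left i j)
        with * have "\<not> (i = x - 1 \<and> j = y)" by auto
        then show ?thesis using left by (auto simp: vstep_def)
      qed (auto simp: vstep_def)
    qed
  qed
  with count_steps_parity[OF assms(3), of ?Z] assms(4,5) show ?thesis by auto
qed

text \<open>The invariant is the parity of the number of steps of \<open>q\<close> that cross the horizontal ray going
  left from a vertex of the path, with \<open>q\<close> shifted by half a unit in both directions.\<close>

lemma path_walk_cross:
  assumes q: "successively adjacent q" "q \<noteq> []" "snd (hd q) < c" "d \<le> snd (last q)"
    and cols: "\<forall>s\<in>set q. a \<le> fst s \<and> fst s < b"
    and R: "\<And>u v. (u, v) \<in> R \<Longrightarrow> adjacent u v \<and> crossfree q u v \<and>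
        c \<le> snd u \<and> snd u \<le> d \<and> c \<le> snd v \<and> snd v \<le> d"
    and uv: "(u, v) \<in> R\<^sup>*" "fst u \<le> a" "b \<le> fst v"
  shows False
proof -
  have ab: "a < b" using cols q(2) by (cases q) force+
  have inv: "even (count_steps (vstep (fst s) (snd s)) q) \<longleftrightarrow> even (count_steps (vstep (fst t) (snd t)) q)"
    if "(s, t) \<in> R" for s t
  proof -
    note r = R[OF that]
    then have "adjacent s t" by simp
    then show ?thesis
    proof (cases rule: adjacent_cases)
      case (right i j)
      then show ?thesis using count_steps_parity_right[OF q(1), of i j] r by simp
    next
      case (left i j)
      then show ?thesis using count_steps_parity_right[OF q(1), of i j] r by (simp add: crossfree_sym)
    next
      case (up i j)
      then show ?thesis using count_steps_parity_up[OF q(1), of i j] r q by force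
    next
      case (down i j)
      then show ?thesis using count_steps_parity_up[OF q(1), of i j] r q by (force simp: crossfree_sym)
    qed
  qed
  have "even (count_steps (vstep (fst u) (snd u)) q) \<longleftrightarrow> even (count_steps (vstep (fst v) (snd v)) q)"
    using uv(1) by (induction) (use inv in auto)
  moreover have "count_steps (vstep (fst u) (snd u)) q' = 0" if "\<forall>s\<in>set q'. a \<le> fst s" for q'
    using that uv(2) by (induction q' rule: induct_list012) (auto simp: vstep_def)
  ultimately have ev: "even (count_steps (vstep (fst v) (snd v)) q)" using cols by auto
  have "u \<noteq> v" using uv ab by auto
  then obtain w where "(w, v) \<in> R" using uv(1) by (metis rtranclE)
  from R[OF this] have vr: "c \<le> snd v" "snd v \<le> d" by auto
  \<comment> \<open>All of \<open>q\<close> lies to the left of \<open>v\<close>, so the ray from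
    \<open>v\<close> catches every passage of \<open>q\<close> through the height of
    \<open>v\<close>; their number is odd because \<open>q\<close> starts below \<open>c\<close> and
    ends at height at least \<open>d\<close>. The ray from \<open>u\<close> catches none.\<close>
  let ?Z = "{s. snd s < snd v}"
  have "successively (\<lambda>s t. ((s \<in> ?Z) \<noteq> (t \<in> ?Z)) = vstep (fst v) (snd v) s t) q'"
    if "successively adjacent q'" "\<forall>s\<in>set q'. fst s < b" for q'
    using that
  proof (induction q' rule: induct_list012)
    case (3 s t r)
    then have "adjacent s t" "fst s < b" "fst t < b" by auto
    then have "((s \<in> ?Z) \<noteq> (t \<in> ?Z)) = vstep (fst v) (snd v) s t"
      using uv(3) by (auto elim!: adjacent_cases simp: vstep_def)
    with 3 show ?case by auto
  qed auto
  from count_steps_cong[OF this[OF q(1)]] cols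
  have "count_steps (\<lambda>s t. (s \<in> ?Z) \<noteq> (t \<in> ?Z)) q = count_steps (vstep (fst v) (snd v)) q" by auto
  with ev count_steps_parity[OF q(2), of ?Z] q vr show False by auto
qed

text \<open>Both sets live on the same lattice, yet a walk in \<open>B\<close> is treated as shifted
  by half a unit. If the sets were disjoint, the shifted walk would cross no edge of
  \<open>A\<close> by \<open>dedge_meets\<close>, which the parity argument excludes.\<close>

lemma HV_cross:
  assumes A: "lattice_connected A" "A \<subseteq> rect a b c d" "(a, ya) \<in> A" "(b, yb) \<in> A"
    and B: "lattice_connected B" "\<And>s. s \<in> B \<Longrightarrow> a \<le> fst s \<and> fst s \<le> b"
      "(x0, y0) \<in> B" "y0 \<le> c" "(x1, y1) \<in> B" "d \<le> y1"
  shows "A \<inter> B \<noteq> {}"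
proof
  assume disj: "A \<inter> B = {}"
  have "((x0, y0), (x1, y1)) \<in> {(s, t). adjacent s t \<and> s \<in> B \<and> t \<in> B}\<^sup>*"
    using B unfolding lattice_connected_def by blast
  from rtrancl_walk[OF this, of B] B(3) obtain q where q: "q \<noteq> []" "hd q = (x0, y0)" "last q = (x1, y1)"
    "successively (\<lambda>s t. (s, t) \<in> {(s, t). adjacent s t \<and> s \<in> B \<and> t \<in> B}) q" "set q \<subseteq> B" by blast
  \<comment> \<open>The half-unit shift moves the walk up and to the right; one step below its start
    and, in \<open>A'\<close>, one vertex to the right of \<open>A\<close> compensate for
    this.\<close>
  define q' where "q' = (x0, y0 - 1) # q"
  have q': "successively adjacent q'" "q' \<noteq> []" "snd (hd q') < c" "d \<le> snd (last q')"
    using q B(4,6) unfolding q'_def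
    by (auto simp: successively_Cons adjacent_def elim!: successively_mono)
  have cols: "\<forall>s\<in>set q'. a \<le> fst s \<and> fst s < b + 1"
    using q(5) B(2) B(2)[OF B(3)] by (auto simp: q'_def)
  define A' where "A' = insert (b + 1, yb) A"
  have disj': "set q' \<inter> A' = {}"
  proof -
    have "(b + 1, yb) \<notin> set q'" using cols by auto
    moreover have "(x0, y0 - 1) \<notin> A"
    proof
      assume "(x0, y0 - 1) \<in> A"
      then have "(x0, y0 - 1) \<in> rect a b c d" using A(2) by blast
      then show False using B(4) by simp
    qed
    ultimately show ?thesis using disj q(5) unfolding A'_def q'_def by auto
  qed
  have "lattice_connected A'" unfolding A'_def
    by (rule lattice_connected_insert[OF A(1,4)]) (simp add: adjacent_def)
  then have path: "((a, ya), (b + 1, yb)) \<in> {(s, t). adjacent s t \<and> s \<in> A' \<and> t \<in> A'}\<^sup>*"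
    using A(3) unfolding lattice_connected_def A'_def by blast
  have rows: "c \<le> snd s \<and> snd s \<le> d" if "s \<in> A'" for s
  proof -
    have "c \<le> snd t \<and> snd t \<le> d" if "t \<in> A" for t
      using that A(2) rect_iff' by blast
    with that A(4) show ?thesis unfolding A'_def by (metis insert_iff snd_conv)
  qed
  have cf: "crossfree q' s t" if "adjacent s t" "s \<in> A'" "t \<in> A'" for s t
  proof -
    have "successively (\<lambda>u v. dedge {u, v} \<noteq> {s, t}) r"
      if "successively adjacent r" "set r \<inter> {s, t} = {}" for r
      using that
    proof (induction r rule: induct_list012)
      case (3 u v r)
      then have "u \<in> dedge {u, v} \<or> v \<in> dedge {u, v}" using dedge_meets by auto
      with 3 show ?case by auto
    qed auto
    moreover have "set q' \<inter> {s, t} = {}" using disj' that by auto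
    ultimately show ?thesis using q'(1) unfolding crossfree_def by blast
  qed
  show False
    by (rule path_walk_cross[OF q' cols _ path]) (use cf rows in auto)
qed

text \<open>Column segments just outside the strip prolong \<open>B\<close> above all of
  \<open>A\<close> on the left and below all of \<open>A\<close> on the right, which makes it a
  vertical crossing of the widened rectangle. Each end of \<open>A\<close> gets one extra vertex so
  that it still reaches the sides.\<close>

lemma strip_cross:
  assumes A: "lattice_connected A" "\<And>s. s \<in> A \<Longrightarrow> a \<le> fst s \<and> fst s \<le> b" "(a, a0) \<in> A" "(b, a1) \<in> A" "finite A"
    and B: "lattice_connected B" "\<And>s. s \<in> B \<Longrightarrow> a \<le> fst s \<and> fst s \<le> b" "(a, b0) \<in> B" "(b, b1) \<in> B"
    and le: "a0 \<le> b0" "b1 \<le> a1"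
  shows "A \<inter> B \<noteq> {}"
proof (cases "a0 = b0 \<or> b1 = a1")
  case True then show ?thesis using A B by auto
next
  case False
  with le have lt: "a0 < b0" "b1 < a1" by auto
  define c where "c = Min (snd ` A \<union> {b1})"
  define d where "d = Max (snd ` A \<union> {b0})"
  have cd: "c \<le> snd s \<and> snd s \<le> d" if "s \<in> A" for s
    using that A(5) by (auto simp: c_def d_def)
  have cb: "c \<le> b1" "b0 \<le> d" using A(5) by (auto simp: c_def d_def)
  have ab: "a \<le> b" using A(2)[OF A(3)] by simp
  define A' where "A' = insert (a - 1, a0) (insert (b + 1, a1) A)"
  define B' where "B' = (B \<union> {a - 1} \<times> {b0..d}) \<union> {b + 1} \<times> {c..b1}"
  have "lattice_connected A'" unfolding A'_def
    by (intro lattice_connected_insert[of _ "(a, a0)"] lattice_connected_insert[of _ "(b, a1)"])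
       (use A in \<open>auto simp: adjacent_def\<close>)
  moreover have "lattice_connected B'" unfolding B'_def
    by (intro lattice_connected_Un[where a = "(b, b1)" and b = "(b + 1, b1)"]
        lattice_connected_Un[where a = "(a, b0)" and b = "(a - 1, b0)"] lattice_connected_column)
       (use B cb in \<open>auto simp: adjacent_def\<close>)
  moreover note ab
  moreover have "A' \<subseteq> rect (a - 1) (b + 1) c d"
  proof
    fix s assume "s \<in> A'"
    then consider "s \<in> A" | "s = (a - 1, a0)" | "s = (b + 1, a1)" by (auto simp: A'_def)
    then show "s \<in> rect (a - 1) (b + 1) c d"
      using A(2)[of s] cd[of s] cd[OF A(3)] cd[OF A(4)] ab by cases (auto simp: rect_iff')
  qed
  moreover have "(b + 1, c) \<in> B'" "(a - 1, d) \<in> B'" using cb by (auto simp: B'_def)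
  moreover have "a - 1 \<le> fst s \<and> fst s \<le> b + 1" if "s \<in> B'" for s
  proof -
    from that consider "s \<in> B" | "fst s = a - 1" | "fst s = b + 1" by (auto simp: B'_def)
    then show ?thesis using B(2)[of s] ab by cases auto
  qed
  ultimately have "A' \<inter> B' \<noteq> {}"
    by (intro HV_cross[of A' "a - 1" "b + 1" c d a0 a1 B' "b + 1" c "a - 1" d]) (auto simp: A'_def)
  then obtain s where s: "s \<in> A'" "s \<in> B'" by auto
  have "s \<noteq> (a - 1, a0)" using s(2) B(2)[of s] lt ab by (auto simp: B'_def)
  moreover have "s \<noteq> (b + 1, a1)" using s(2) B(2)[of s] lt ab by (auto simp: B'_def)
  ultimately have sA: "s \<in> A" using s(1) by (auto simp: A'_def)
  then have "a \<le> fst s" "fst s \<le> b" using A(2) by auto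
  then have "s \<in> B" using s(2) by (auto simp: B'_def)
  with sA show ?thesis by auto
qed

text \<open>The two points of \<open>B\<close> on the right side enclose the end of
  \<open>A\<close>. Column segments one step further right, up from \<open>b1\<close> and down from
  \<open>b0\<close>, complete \<open>B\<close> to a vertical crossing, and \<open>A\<close> is
  prolonged into the gap between them.\<close>

lemma gap_cross:
  assumes A: "lattice_connected A" "\<And>s. s \<in> A \<Longrightarrow> a \<le> fst s \<and> fst s \<le> b" "(a, a0) \<in> A" "(b, a1) \<in> A" "finite A"
    and B: "lattice_connected B" "\<And>s. s \<in> B \<Longrightarrow> a \<le> fst s \<and> fst s \<le> b" "(b, b0) \<in> B" "(b, b1) \<in> B"
    and le: "b0 \<le> a1" "a1 \<le> b1"
  shows "A \<inter> B \<noteq> {}"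
proof (cases "a1 = b0 \<or> b1 = a1")
  case True then show ?thesis using A B by auto
next
  case False
  with le have lt: "b0 < a1" "a1 < b1" by auto
  define c where "c = Min (snd ` A \<union> {b0})"
  define d where "d = Max (snd ` A \<union> {b1})"
  have cd: "c \<le> snd s \<and> snd s \<le> d" if "s \<in> A" for s
    using that A(5) by (auto simp: c_def d_def)
  have cb: "c \<le> b0" "b1 \<le> d" using A(5) by (auto simp: c_def d_def)
  have ab: "a \<le> b" using A(2)[OF A(3)] by simp
  define A' where "A' = insert (b + 1, a1) A"
  define B' where "B' = (B \<union> {b + 1} \<times> {b1..d}) \<union> {b + 1} \<times> {c..b0}"
  have "lattice_connected A'" unfolding A'_def
    by (intro lattice_connected_insert[of _ "(b, a1)"]) (use A in \<open>auto simp: adjacent_def\<close>)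
  moreover have "lattice_connected B'" unfolding B'_def
    by (intro lattice_connected_Un[where a = "(b, b0)" and b = "(b + 1, b0)"]
        lattice_connected_Un[where a = "(b, b1)" and b = "(b + 1, b1)"] lattice_connected_column)
       (use B cb in \<open>auto simp: adjacent_def\<close>)
  moreover note ab
  moreover have "A' \<subseteq> rect a (b + 1) c d"
  proof
    fix s assume "s \<in> A'"
    then consider "s \<in> A" | "s = (b + 1, a1)" by (auto simp: A'_def)
    then show "s \<in> rect a (b + 1) c d"
      using A(2)[of s] cd[of s] cd[OF A(4)] ab by cases (auto simp: rect_iff')
  qed
  moreover have "(b + 1, c) \<in> B'" "(b + 1, d) \<in> B'" using cb by (auto simp: B'_def)
  moreover have "a \<le> fst s \<and> fst s \<le> b + 1" if "s \<in> B'" for s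
  proof -
    from that consider "s \<in> B" | "fst s = b + 1" by (auto simp: B'_def)
    then show ?thesis using B(2)[of s] ab by cases auto
  qed
  ultimately have "A' \<inter> B' \<noteq> {}"
    by (intro HV_cross[of A' a "b + 1" c d a0 a1 B' "b + 1" c "b + 1" d])
       (use A in \<open>auto simp: A'_def\<close>)
  then obtain s where s: "s \<in> A'" "s \<in> B'" by auto
  have "s \<noteq> (b + 1, a1)" using s(2) B(2)[of s] lt ab by (auto simp: B'_def)
  then have sA: "s \<in> A" using s(1) by (auto simp: A'_def)
  then have "a \<le> fst s" "fst s \<le> b" using A(2) by auto
  then have "s \<in> B" using s(2) by (auto simp: B'_def)
  with sA show ?thesis by auto
qed

section \<open>Duality\<close>

text \<open>Vertex \<open>(i, j)\<close> of the dual lattice stands for the face centre \<open>(i + 1/2, j + 1/2)\<close>, and \<open>dedge e\<close> is the primal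
  edge crossed by the dual edge \<open>e\<close>.\<close>

definition dual_config :: "config \<Rightarrow> config" where
  "dual_config \<omega> = (\<lambda>e\<in>lattice_edges. \<not> \<omega> (dedge e))"

lemma dual_config_adjacent: "adjacent u v \<Longrightarrow> dual_config \<omega> {u, v} \<longleftrightarrow> \<not> \<omega> (dedge {u, v})"
  by (simp add: dual_config_def adjacent_edge)

lemma hedge_in: "{(i, j), (i + 1, j)} \<in> lattice_edges" "{(i + 1, j), (i, j)} \<in> lattice_edges"
  and vedge_in: "{(i, j), (i, j + 1)} \<in> lattice_edges" "{(i, j + 1), (i, j)} \<in> lattice_edges"
  by (auto intro!: adjacent_edge simp: adjacent_def)

lemma lattice_edge_cases:
  assumes "e \<in> lattice_edges"
  obtains (h) i j where "e = {(i, j), (i + 1, j)}" | (v) i j where "e = {(i, j), (i, j + 1)}"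
proof -
  obtain x y where e: "e = {x, y}" "adjacent x y" using assms by (auto simp: lattice_edges_def)
  from e(2) show thesis by (cases rule: adjacent_cases) (use e(1) that in \<open>auto simp: insert_commute\<close>)
qed

lemma dedge_in [simp]: "e \<in> lattice_edges \<Longrightarrow> dedge e \<in> lattice_edges"
  by (erule lattice_edge_cases) (simp_all add: hedge_in vedge_in)

text \<open>A dual edge is open only if the primal edge it crosses is closed, so the dual path is
  \<open>crossfree\<close> for every open primal edge and the parity argument applies.\<close>

lemma dual_cross_excl:
  assumes p: "(x1, y1) \<in> clus \<omega> (rect a' b' c d) z" "(x2, y2) \<in> clus \<omega> (rect a' b' c d) z"
      "x1 \<le> a" "b \<le> x2"
    and q: "(s1, t1) \<in> clus (dual_config \<omega>) S w" "(s2, t2) \<in> clus (dual_config \<omega>) S w" "w \<in> S"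
      "t1 < c" "d \<le> t2"
    and S: "\<And>s. s \<in> S \<Longrightarrow> a \<le> fst s \<and> fst s < b"
  shows False
proof -
  have "(s2, t2) \<in> clus (dual_config \<omega>) S (s1, t1)" using q by (metis clus_eq)
  then have "((s1, t1), (s2, t2)) \<in> (openrel (dual_config \<omega>) S)\<^sup>*" by (simp add: clus_def)
  moreover have "(s1, t1) \<in> S" using q clus_sub by blast
  ultimately obtain l where l: "l \<noteq> []" "hd l = (s1, t1)" "last l = (s2, t2)"
    "successively (\<lambda>s t. (s, t) \<in> openrel (dual_config \<omega>) S) l" "set l \<subseteq> S"
    using rtrancl_walk[of "(s1, t1)" "(s2, t2)" "openrel (dual_config \<omega>) S" S]
    by (auto simp: openrel_def)
  have adj: "successively adjacent l"
    using l(4) by (rule successively_mono) (auto simp: openrel_def)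
  have cf: "crossfree l u v" if "\<omega> {u, v}" for u v
    unfolding crossfree_def using l(4)
    by (rule successively_mono) (use that in \<open>auto simp: openrel_def dual_config_adjacent\<close>)
  have "(x2, y2) \<in> clus \<omega> (rect a' b' c d) (x1, y1)" using p by (metis clus_eq)
  then have path: "((x1, y1), (x2, y2)) \<in> (openrel \<omega> (rect a' b' c d))\<^sup>*" by (simp add: clus_def)
  show False
  proof (rule path_walk_cross[OF adj l(1) _ _ _ _ path])
    show "snd (hd l) < c" "d \<le> snd (last l)" using l q by auto
    show "\<forall>s\<in>set l. a \<le> fst s \<and> fst s < b" using l(5) S by auto
    show "fst (x1, y1) \<le> a" "b \<le> fst (x2, y2)" using p by auto
    fix u v assume "(u, v) \<in> openrel \<omega> (rect a' b' c d)"
    then show "adjacent u v \<and> crossfree l u v \<and> c \<le> snd u \<and> snd u \<le> d \<and> c \<le> snd v \<and> snd v \<le> d"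
      using cf by (auto simp: openrel_def rect_iff')
  qed
qed

lemma card_Collect_Suc:
  fixes c y :: int
  assumes "c \<le> y"
  shows "card {t \<in> {c..<y + 1}. P t} = card {t \<in> {c..<y}. P t} + (if P y then 1 else 0)"
proof -
  define A where "A = {t \<in> {c..<y}. P t}"
  have "finite A" unfolding A_def by (rule finite_subset[of _ "{c..<y}"]) auto
  moreover have "y \<notin> A" by (simp add: A_def)
  moreover have "{t \<in> {c..<y + 1}. P t} = (if P y then insert y A else A)"
    using assms by (auto simp: A_def) (metis order_le_less)
  ultimately show ?thesis unfolding A_def[symmetric] by simp
qed

text \<open>Parity argument: let \<open>C\<close> be the union of the clusters of the bottom row and \<open>K\<close> the union of
  the dual clusters of the outer left faces.  The number of edges of a column that leave \<open>C\<close> and are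
  crossed by a dual edge with an endpoint in \<open>K\<close> has the same parity for all columns; it is odd on the left.\<close>

lemma dual_crossing_of_no_crossing:
  fixes a b c d :: int
  assumes ab: "a \<le> b" and cd: "c \<le> d"
    and no: "\<And>x x'. a \<le> x \<Longrightarrow> x \<le> b \<Longrightarrow> (x', d) \<notin> clus \<omega> (rect a b c d) (x, c)"
  defines "S' \<equiv> rect (a - 1) b c (d - 1)"
  shows "\<exists>y y'. c \<le> y \<and> y < d \<and> (b, y') \<in> clus (dual_config \<omega>) S' (a - 1, y)"
proof (rule ccontr)
  assume contr: "\<not> ?thesis"
  define D where "D = rect a b c d"
  define C where "C = {v. \<exists>x. a \<le> x \<and> x \<le> b \<and> v \<in> clus \<omega> D (x, c)}"
  define K where "K = {s. \<exists>y. c \<le> y \<and> y < d \<and> s \<in> clus (dual_config \<omega>) S' (a - 1, y)}"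
  have Kb: "(b, y) \<notin> K" for y using contr by (auto simp: K_def)
  have bot: "(x, c) \<in> C" if "a \<le> x" "x \<le> b" for x
    using that by (auto simp: C_def intro!: exI[of _ x])
  have top: "(x, d) \<notin> C" for x using no by (auto simp: C_def D_def)
  have Cstep: "v \<in> C" if "u \<in> C" "adjacent u v" "\<omega> {u, v}" "u \<in> D" "v \<in> D" for u v
  proof -
    obtain x where x: "a \<le> x" "x \<le> b" "u \<in> clus \<omega> D (x, c)" using \<open>u \<in> C\<close> by (auto simp: C_def)
    have "v \<in> clus \<omega> D (x, c)" using clus_step[OF x(3)] that by (simp add: openrel_def)
    then show ?thesis using x by (auto simp: C_def)
  qed
  have C2: "u \<in> C \<longleftrightarrow> v \<in> C" if "adjacent u v" "\<omega> {u, v}" "u \<in> D" "v \<in> D" for u v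
    using Cstep[of u v] Cstep[of v u] that by (auto simp: adjacent_sym insert_commute)
  have Kstep: "t \<in> K" if "s \<in> K" "adjacent s t" "\<not> \<omega> (dedge {s, t})" "s \<in> S'" "t \<in> S'" for s t
  proof -
    obtain y where y: "c \<le> y" "y < d" "s \<in> clus (dual_config \<omega>) S' (a - 1, y)"
      using \<open>s \<in> K\<close> by (auto simp: K_def)
    have "t \<in> clus (dual_config \<omega>) S' (a - 1, y)"
      using clus_step[OF y(3)] that by (simp add: openrel_def dual_config_adjacent)
    then show ?thesis using y by (auto simp: K_def)
  qed
  have K2: "s \<in> K \<longleftrightarrow> t \<in> K" if "adjacent s t" "\<not> \<omega> (dedge {s, t})" "s \<in> S'" "t \<in> S'" for s t
    using Kstep[of s t] Kstep[of t s] that by (auto simp: adjacent_sym insert_commute)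
  define dv where "dv x y \<longleftrightarrow> ((x, y) \<in> C) \<noteq> ((x, y + 1) \<in> C)" for x y
  define dh where "dh x y \<longleftrightarrow> ((x, y) \<in> C) \<noteq> ((x + 1, y) \<in> C)" for x y
  have dvK: "(x - 1, y) \<in> K \<longleftrightarrow> (x, y) \<in> K" if "dv x y" "a \<le> x" "x \<le> b" "c \<le> y" "y < d" for x y
  proof (rule K2)
    have "\<not> \<omega> {(x, y), (x, y + 1)}"
      using C2[of "(x, y)" "(x, y + 1)"] that by (auto simp: dv_def D_def adjacent_def)
    then show "\<not> \<omega> (dedge {(x - 1, y), (x, y)})" using dedge_h(1)[of "x - 1" y] by simp
  qed (use that in \<open>auto simp: S'_def adjacent_def\<close>)
  have dhK: "(x, y - 1) \<in> K \<longleftrightarrow> (x, y) \<in> K" if "dh x y" "a \<le> x" "x < b" "c < y" "y < d" for x y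
  proof (rule K2)
    have "\<not> \<omega> {(x, y), (x + 1, y)}"
      using C2[of "(x, y)" "(x + 1, y)"] that by (auto simp: dh_def D_def adjacent_def)
    then show "\<not> \<omega> (dedge {(x, y - 1), (x, y)})" using dedge_v(1)[of x "y - 1"] by simp
  qed (use that in \<open>auto simp: S'_def adjacent_def\<close>)
  define r where "r x = card {y \<in> {c..<d}. dv x y \<and> (x - 1, y) \<in> K}" for x
  \<comment> \<open>All outer left faces belong to \<open>K\<close>, so in column \<open>a\<close>
    every edge leaving \<open>C\<close> counts; the column starts in \<open>C\<close> and ends
    outside.\<close>
  have "odd (card {t \<in> {c..<y}. dv a t \<and> (a - 1, t) \<in> K}) \<longleftrightarrow> (a, y) \<notin> C" if "c \<le> y" "y \<le> d" for y
    using that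
  proof (induction y rule: int_ge_induct)
    case base show ?case using bot ab by simp
  next
    case (step y)
    have "(a - 1, y) \<in> K" using step(1,3) by (auto simp: K_def)
    then show ?case using step unfolding card_Collect_Suc[OF step(1)] by (auto simp: dv_def)
  qed
  from this[of d] have ra: "odd (r a)" using cd top by (simp add: r_def)
  have rs: "even (r x) \<longleftrightarrow> even (r (x + 1))" if x: "a \<le> x" "x < b" for x
  proof -
    have rx: "r x = card {y \<in> {c..<d}. dv x y \<and> (x, y) \<in> K}"
      unfolding r_def using dvK[of x] x by (intro arg_cong[where f = card]) auto
    have "even (card {t \<in> {c..<y}. dv x t \<and> (x, t) \<in> K} +
        card {t \<in> {c..<y}. dv (x + 1) t \<and> (x, t) \<in> K}) \<longleftrightarrow> \<not> (dh x y \<and> (x, y - 1) \<in> K)"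
      if "c \<le> y" "y \<le> d" for y
      using that
    proof (induction y rule: int_ge_induct)
      case base show ?case using bot x by (simp add: dh_def)
    next
      case (step y)
      have "dh x y \<Longrightarrow> (x, y - 1) \<in> K \<longleftrightarrow> (x, y) \<in> K"
        using dhK[of x y] x step bot[of x] bot[of "x + 1"] by (cases "y = c") (auto simp: dh_def)
      \<comment> \<open>Around a unit face, membership in \<open>C\<close> changes an even number of
        times.\<close>
      moreover have "dv x y \<longleftrightarrow> (dh x y \<noteq> (dh x (y + 1) \<noteq> dv (x + 1) y))"
        by (auto simp: dv_def dh_def)
      ultimately show ?case using step unfolding card_Collect_Suc[OF step(1)] by auto
    qed
    from this[of d] cd have "even (r x + r (x + 1))"
      unfolding rx using top by (simp add: dh_def r_def)
    then show ?thesis by simp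
  qed
  have "even (r x) \<longleftrightarrow> even (r a)" if "a \<le> x" "x \<le> b" for x
    using that by (induction x rule: int_ge_induct) (use rs in auto)
  then have "odd (r b)" using ab ra by simp
  moreover have "r b = 0"
  proof -
    have "{y \<in> {c..<d}. dv b y \<and> (b - 1, y) \<in> K} = {}" using dvK[of b] ab Kb by auto
    then show ?thesis unfolding r_def by (metis card.empty)
  qed
  ultimately show False by simp
qed

section \<open>Connection events: monotonicity, support and symmetry\<close>

declare split_paired_All [simp del] split_paired_Ex [simp del]

text \<open>Crossings, arms, arches and connections to distance are all instances, so measurability,
  monotonicity, finite support and transport by symmetries are shown only once. A single cluster has
  to meet all the sets, which is more than pairwise connections between them.\<close>

definition cluster_meets :: "vertex set \<Rightarrow> vertex set set \<Rightarrow> config set" where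
  "cluster_meets S \<U> = {\<omega> \<in> space config_space. \<exists>x\<in>S. \<forall>U\<in>\<U>. \<exists>u\<in>U. u \<in> clus \<omega> S x}"

lemma cluster_meetsI:
  assumes "\<omega> \<in> space config_space" "x \<in> S" "\<And>U. U \<in> \<U> \<Longrightarrow> \<exists>u\<in>U. u \<in> clus \<omega> S x"
  shows "\<omega> \<in> cluster_meets S \<U>"
proof -
  have "\<exists>x\<in>S. \<forall>U\<in>\<U>. \<exists>u\<in>U. u \<in> clus \<omega> S x"
    by (rule bexI[OF _ assms(2)], rule ballI, rule assms(3))
  with assms(1) show ?thesis by (simp add: cluster_meets_def)
qed

lemma cluster_meetsE:
  assumes "\<omega> \<in> cluster_meets S \<U>"
  obtains x where "x \<in> S" "\<forall>U\<in>\<U>. \<exists>u\<in>U. u \<in> clus \<omega> S x"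
proof -
  from assms have "\<exists>x\<in>S. \<forall>U\<in>\<U>. \<exists>u\<in>U. u \<in> clus \<omega> S x" by (simp add: cluster_meets_def)
  then show thesis by (rule bexE) (rule that)
qed

lemma cluster_meets_sub_space: "cluster_meets S \<U> \<subseteq> space config_space"
  by (auto simp: cluster_meets_def)

lemma pred_clus: "Measurable.pred config_space (\<lambda>\<omega>. u \<in> clus \<omega> S x)"
proof -
  have R: "Measurable.pred config_space (\<lambda>\<omega>. (u, v) \<in> openrel \<omega> S)" for u v
  proof (cases "adjacent u v")
    case True
    from measurable_edge[OF adjacent_edge[OF this]] show ?thesis by (simp add: openrel_def)
  qed (simp add: openrel_def)
  have pow: "Measurable.pred config_space (\<lambda>\<omega>. (x, y) \<in> openrel \<omega> S ^^ n)" for n y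
  proof (induction n arbitrary: y)
    case (Suc n)
    have "(\<lambda>\<omega>. (x, y) \<in> openrel \<omega> S ^^ Suc n) =
        (\<lambda>\<omega>. \<exists>z. (x, z) \<in> openrel \<omega> S ^^ n \<and> (z, y) \<in> openrel \<omega> S)"
      by (simp add: relcomp_unfold)
    then show ?case using Suc R by simp
  qed simp
  have "(\<lambda>\<omega>. u \<in> clus \<omega> S x) = (\<lambda>\<omega>. \<exists>n. (x, u) \<in> openrel \<omega> S ^^ n)"
    by (auto simp: clus_def rtrancl_power)
  then show ?thesis using pow by simp
qed

lemma sets_cluster_meets:
  assumes "finite \<U>" shows "cluster_meets S \<U> \<in> sets config_space"
proof -
  have "Measurable.pred config_space (\<lambda>\<omega>. \<exists>x. x \<in> S \<and> (\<forall>U\<in>\<U>. \<exists>u. u \<in> U \<and> u \<in> clus \<omega> S x))"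
    using pred_clus assms by (intro pred_intros_countable pred_intros_logic pred_intros_finite) auto
  moreover have "cluster_meets S \<U> = {\<omega> \<in> space config_space. \<exists>x. x \<in> S \<and> (\<forall>U\<in>\<U>. \<exists>u. u \<in> U \<and> u \<in> clus \<omega> S x)}"
    by (simp add: cluster_meets_def Bex_def)
  ultimately show ?thesis by simp
qed

lemma increasing_cluster_meets:
  assumes "finite \<U>" shows "increasing_event (cluster_meets S \<U>)"
  unfolding increasing_event_def
proof (intro conjI ballI impI)
  show "cluster_meets S \<U> \<in> sets config_space" by (rule sets_cluster_meets[OF assms])
  fix \<omega> \<omega>' assume a: "\<omega> \<in> cluster_meets S \<U>" "\<omega>' \<in> space config_space" "\<forall>e\<in>lattice_edges. \<omega> e \<le> \<omega>' e"
  have sub: "clus \<omega> S x \<subseteq> clus \<omega>' S x" for x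
  proof (rule clus_mono_config)
    fix e assume e: "e \<in> lattice_edges" "\<omega> e"
    have "\<omega> e \<le> \<omega>' e" by (rule bspec[OF a(3) e(1)])
    with e(2) show "\<omega>' e" by simp
  qed
  obtain x where x: "x \<in> S" "\<forall>U\<in>\<U>. \<exists>u\<in>U. u \<in> clus \<omega> S x" by (rule cluster_meetsE[OF a(1)])
  show "\<omega>' \<in> cluster_meets S \<U>" using a(2) x(1)
  proof (rule cluster_meetsI)
    fix U assume "U \<in> \<U>"
    from bspec[OF x(2) this] obtain u where "u \<in> U" "u \<in> clus \<omega> S x" by auto
    then show "\<exists>u\<in>U. u \<in> clus \<omega>' S x" using sub[of x] by auto
  qed
qed

lemma clus_cong:
  assumes "\<And>e. e \<in> edges_within S \<Longrightarrow> \<omega> e = \<omega>' e"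
  shows "clus \<omega> S x = clus \<omega>' S x"
proof -
  have "\<omega> {u, v} = \<omega>' {u, v}" if "u \<in> S" "v \<in> S" "adjacent u v" for u v
    using assms[of "{u, v}"] that adjacent_edge by (simp add: edges_within_def)
  then have "openrel \<omega> S = openrel \<omega>' S" by (auto simp: openrel_def)
  then show ?thesis by (simp add: clus_def)
qed

lemma supported_cluster_meets:
  assumes "finite \<U>" shows "event_supported_in (cluster_meets S \<U>) S"
  unfolding event_supported_in_def depends_on_def
proof (intro conjI ballI impI)
  show "cluster_meets S \<U> \<in> sets config_space" by (rule sets_cluster_meets[OF assms])
  fix \<omega> \<omega>' assume a: "\<omega> \<in> space config_space" "\<omega>' \<in> space config_space"
    "\<forall>e\<in>edges_within S. \<omega> e = \<omega>' e"
  then have "clus \<omega> S x = clus \<omega>' S x" for x by (intro clus_cong) auto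
  then show "(\<omega> \<in> cluster_meets S \<U>) = (\<omega>' \<in> cluster_meets S \<U>)" using a(1,2) by (simp add: cluster_meets_def)
qed

lemma supportedI:
  assumes "A \<in> sets config_space"
    "\<And>\<omega> \<omega>'. \<omega> \<in> space config_space \<Longrightarrow> \<omega>' \<in> space config_space \<Longrightarrow>
      (\<And>e. e \<in> edges_within S \<Longrightarrow> \<omega> e = \<omega>' e) \<Longrightarrow> (\<omega> \<in> A) = (\<omega>' \<in> A)"
  shows "event_supported_in A S"
  unfolding event_supported_in_def depends_on_def
proof (intro conjI ballI impI)
  fix \<omega> \<omega>' assume "\<omega> \<in> space config_space" "\<omega>' \<in> space config_space"
    "\<forall>e\<in>edges_within S. \<omega> e = \<omega>' e"
  then show "(\<omega> \<in> A) = (\<omega>' \<in> A)" by (intro assms(2)) auto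
qed (rule assms(1))

lemma supportedD:
  assumes "event_supported_in A S" "\<omega> \<in> space config_space" "\<omega>' \<in> space config_space"
    "\<And>e. e \<in> edges_within S \<Longrightarrow> \<omega> e = \<omega>' e"
  shows "(\<omega> \<in> A) = (\<omega>' \<in> A)"
proof -
  have dep: "depends_on A (edges_within S)"
    using assms(1) unfolding event_supported_in_def by (rule conjunct2)
  have eq: "\<forall>e\<in>edges_within S. \<omega> e = \<omega>' e" by (rule ballI) (rule assms(4))
  show ?thesis
    by (rule dep[unfolded depends_on_def, THEN bspec, OF assms(2), THEN bspec, OF assms(3), THEN mp, OF eq])
qed

lemma supported_sets: "event_supported_in A S \<Longrightarrow> A \<in> sets config_space"
  by (simp add: event_supported_in_def)

lemma supported_mono:
  assumes "event_supported_in A S" "S \<subseteq> T" shows "event_supported_in A T"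
proof (rule supportedI)
  show "A \<in> sets config_space" by (rule supported_sets[OF assms(1)])
  fix \<omega> \<omega>' assume a: "\<omega> \<in> space config_space" "\<omega>' \<in> space config_space"
    "\<And>e. e \<in> edges_within T \<Longrightarrow> \<omega> e = \<omega>' e"
  have sub: "e \<in> edges_within T" if "e \<in> edges_within S" for e
    using that assms(2) by (auto simp: edges_within_def)
  show "(\<omega> \<in> A) = (\<omega>' \<in> A)" by (rule supportedD[OF assms(1) a(1,2)]) (rule a(3)[OF sub])
qed

lemma supported_compl:
  assumes "event_supported_in A S" shows "event_supported_in (space config_space - A) S"
proof (rule supportedI)
  show "space config_space - A \<in> sets config_space" using assms supported_sets by auto
  fix \<omega> \<omega>' assume a: "\<omega> \<in> space config_space" "\<omega>' \<in> space config_space"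
    "\<And>e. e \<in> edges_within S \<Longrightarrow> \<omega> e = \<omega>' e"
  from supportedD[OF assms a] a(1,2)
  show "(\<omega> \<in> space config_space - A) = (\<omega>' \<in> space config_space - A)" by simp
qed

lemma finitely_supported_cluster_meets:
  assumes "finite \<U>" "finite S" shows "finitely_supported_event (cluster_meets S \<U>)"
proof -
  have "edges_within S \<subseteq> Pow S" by (auto simp: edges_within_def)
  then have "finite (edges_within S)" using assms(2) finite_subset by auto
  moreover have "edges_within S \<subseteq> lattice_edges" by (auto simp: edges_within_def)
  moreover have "depends_on (cluster_meets S \<U>) (edges_within S)" "cluster_meets S \<U> \<in> sets config_space"
    using supported_cluster_meets[OF assms(1), of S] unfolding event_supported_in_def by simp_all
  ultimately show ?thesis unfolding finitely_supported_event_def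
    by (intro conjI exI[of _ "edges_within S"])
qed

lemma cluster_meets_mono:
  assumes "S \<subseteq> T" "\<And>V. V \<in> \<V> \<Longrightarrow> \<exists>U\<in>\<U>. U \<subseteq> V"
  shows "cluster_meets S \<U> \<subseteq> cluster_meets T \<V>"
proof
  fix \<omega> assume w: "\<omega> \<in> cluster_meets S \<U>"
  obtain x where x: "x \<in> S" "\<forall>U\<in>\<U>. \<exists>u\<in>U. u \<in> clus \<omega> S x" by (rule cluster_meetsE[OF w])
  show "\<omega> \<in> cluster_meets T \<V>"
  proof (rule cluster_meetsI)
    show "\<omega> \<in> space config_space" using w cluster_meets_sub_space by auto
    show "x \<in> T" using x(1) assms(1) by auto
    fix V assume "V \<in> \<V>"
    then obtain U where U: "U \<in> \<U>" "U \<subseteq> V" using assms(2) by auto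
    obtain u where "u \<in> U" "u \<in> clus \<omega> S x" using bspec[OF x(2) U(1)] by auto
    then show "\<exists>u\<in>V. u \<in> clus \<omega> T x" using U(2) clus_mono[OF assms(1), of \<omega> x] by auto
  qed
qed

definition negx :: "vertex \<Rightarrow> vertex" where "negx p = (- fst p, snd p)"

text \<open>Injectivity and equivalence of adjacency are all that the transport of clusters uses,
  and unlike membership in \<open>lattice_symmetries\<close> they are checked directly for the
  coordinate swap and the reflection.\<close>

definition lattice_auto :: "(vertex \<Rightarrow> vertex) \<Rightarrow> bool" where
  "lattice_auto g \<longleftrightarrow> inj g \<and> (\<forall>u v. adjacent (g u) (g v) = adjacent u v)"

lemma auto_translation: "lattice_auto (translation v)"
  unfolding lattice_auto_def translation_def adjacent_def inj_def by simp

lemma auto_swap: "lattice_auto prod.swap"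
  unfolding lattice_auto_def adjacent_def by (simp add: add.commute)

lemma auto_negx: "lattice_auto negx"
proof -
  have "\<bar>- a + b\<bar> = \<bar>a - b\<bar>" for a b :: int by arith
  moreover have "inj negx" by (rule injI) (simp add: negx_def prod_eq_iff)
  ultimately show ?thesis unfolding lattice_auto_def adjacent_def by (simp add: negx_def)
qed

lemma openrel_pullback:
  assumes "lattice_auto g"
  shows "(u, v) \<in> openrel (pullback g \<omega>) S \<longleftrightarrow> (g u, g v) \<in> openrel \<omega> (g ` S)"
proof -
  have "adjacent (g u) (g v) = adjacent u v" "g u \<in> g ` S \<longleftrightarrow> u \<in> S" "g v \<in> g ` S \<longleftrightarrow> v \<in> S"
    using assms by (auto simp: lattice_auto_def inj_image_mem_iff)
  then show ?thesis using adjacent_edge[of u v] by (auto simp: openrel_def pullback_def)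
qed

lemma clus_pullback:
  assumes "lattice_auto g"
  shows "clus \<omega> (g ` S) (g x) = g ` clus (pullback g \<omega>) S x"
proof (intro equalityI subsetI)
  fix w assume "w \<in> clus \<omega> (g ` S) (g x)"
  then have "(g x, w) \<in> (openrel \<omega> (g ` S))\<^sup>*" by (simp add: clus_def)
  then show "w \<in> g ` clus (pullback g \<omega>) S x"
  proof induction
    case (step y z)
    then obtain u where u: "y = g u" "u \<in> clus (pullback g \<omega>) S x" by auto
    obtain v where v: "z = g v" using step(2) by (auto simp: openrel_def)
    have "(u, v) \<in> openrel (pullback g \<omega>) S" using step(2) u v openrel_pullback[OF assms] by auto
    then show ?case using u v clus_step by blast
  qed simp
next
  fix w assume "w \<in> g ` clus (pullback g \<omega>) S x"
  then obtain u where u: "w = g u" "(x, u) \<in> (openrel (pullback g \<omega>) S)\<^sup>*" by (auto simp: clus_def)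
  from u(2) have "(g x, g u) \<in> (openrel \<omega> (g ` S))\<^sup>*"
  proof induction
    case (step y z)
    then show ?case using openrel_pullback[OF assms] by (meson rtrancl.rtrancl_into_rtrancl)
  qed simp
  then show "w \<in> clus \<omega> (g ` S) (g x)" by (simp add: clus_def u(1))
qed

lemma space_config: "\<omega> \<in> space config_space \<longleftrightarrow> (\<forall>e. e \<notin> lattice_edges \<longrightarrow> \<omega> e = undefined)"
  by (auto simp: config_space_def space_PiM PiE_def extensional_def)

lemma pullback_space [simp]: "pullback g \<omega> \<in> space config_space"
  by (simp add: space_config pullback_def)

lemma dual_config_space [simp]: "dual_config \<omega> \<in> space config_space"
  by (simp add: space_config dual_config_def)

lemma pullback_cluster_meets:
  assumes "lattice_auto g" "\<omega> \<in> space config_space"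
  shows "pullback g \<omega> \<in> cluster_meets S \<U> \<longleftrightarrow> \<omega> \<in> cluster_meets (g ` S) ((`) g ` \<U>)"
proof -
  have inj: "inj g" using assms by (simp add: lattice_auto_def)
  have "(\<exists>u\<in>g ` U. u \<in> clus \<omega> (g ` S) (g x)) \<longleftrightarrow> (\<exists>u\<in>U. u \<in> clus (pullback g \<omega>) S x)" for x U
    unfolding clus_pullback[OF assms(1)] by (simp add: inj_image_mem_iff[OF inj])
  then show ?thesis using assms(2) by (simp add: cluster_meets_def)
qed

lemma pullback_vimage_cluster_meets:
  assumes "lattice_auto g"
  shows "pullback g -` cluster_meets S \<U> \<inter> space config_space = cluster_meets (g ` S) ((`) g ` \<U>)"
proof (rule set_eqI)
  fix \<omega>
  show "\<omega> \<in> pullback g -` cluster_meets S \<U> \<inter> space config_space \<longleftrightarrow> \<omega> \<in> cluster_meets (g ` S) ((`) g ` \<U>)"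
    using pullback_cluster_meets[OF assms, of \<omega> S \<U>] subsetD[OF cluster_meets_sub_space, of \<omega> "g ` S" "(`) g ` \<U>"] by auto
qed

lemma translation_rect: "translation (s, t) ` rect a b c d = rect (a + s) (b + s) (c + t) (d + t)"
proof (intro equalityI subsetI)
  fix p assume "p \<in> rect (a + s) (b + s) (c + t) (d + t)"
  then show "p \<in> translation (s, t) ` rect a b c d"
    by (intro image_eqI[of _ _ "(fst p - s, snd p - t)"]) (auto simp: rect_iff' translation_def)
qed (auto simp: rect_iff' translation_def)

lemma swap_rect: "prod.swap ` rect a b c d = rect c d a b"
  by (auto simp: rect_def)

lemma negx_rect: "negx ` rect a b c d = rect (- b) (- a) c d"
proof (intro equalityI subsetI)
  fix p assume "p \<in> rect (- b) (- a) c d"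
  then show "p \<in> negx ` rect a b c d"
    by (intro image_eqI[of _ _ "(- fst p, snd p)"]) (auto simp: rect_iff' negx_def)
qed (auto simp: rect_iff' negx_def)

lemma measurable_pullback':
  assumes "lattice_auto g" shows "pullback g \<in> config_space \<rightarrow>\<^sub>M config_space"
proof -
  have "g ` e \<in> lattice_edges" if "e \<in> lattice_edges" for e
  proof -
    obtain x y where "e = {x, y}" "adjacent x y" using \<open>e \<in> lattice_edges\<close> by (auto simp: lattice_edges_def)
    then have "g ` e = {g x, g y}" "adjacent (g x) (g y)" using assms by (auto simp: lattice_auto_def)
    then show ?thesis using adjacent_edge by metis
  qed
  then have "(\<lambda>\<omega>. \<lambda>e\<in>lattice_edges. \<omega> (g ` e)) \<in>
      config_space \<rightarrow>\<^sub>M (\<Pi>\<^sub>M e\<in>lattice_edges. count_space UNIV)"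
    by (intro measurable_restrict measurable_edge)
  then show ?thesis
    by (simp only: pullback_def[abs_def] config_space_def[symmetric])
qed

lemma measurable_dual_config: "dual_config \<in> config_space \<rightarrow>\<^sub>M config_space"
proof -
  have "(\<lambda>\<omega>. \<lambda>e\<in>lattice_edges. \<not> \<omega> (dedge e)) \<in>
      config_space \<rightarrow>\<^sub>M (\<Pi>\<^sub>M e\<in>lattice_edges. count_space UNIV)"
    using measurable_edge by (intro measurable_restrict pred_intros_logic) (simp add: pred_def)
  then show ?thesis
    by (simp only: dual_config_def[abs_def] config_space_def[symmetric])
qed

text \<open>The qualitative \<open>mixing\<close> assumption, unlike the rate in the theorem, is
  inherited by the dual measure, whose events have slightly larger supports.\<close>

locale perc = prob_space M for M :: "config measure" +
  assumes sets_M: "sets M = sets config_space"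
    and inv_translation: "A \<in> sets config_space \<Longrightarrow>
      prob (pullback (translation v) -` A \<inter> space config_space) = prob A"
    and inv_swap: "A \<in> sets config_space \<Longrightarrow>
      prob (pullback prod.swap -` A \<inter> space config_space) = prob A"
    and inv_negx: "A \<in> sets config_space \<Longrightarrow>
      prob (pullback negx -` A \<inter> space config_space) = prob A"
    and FKG: "increasing_event A \<Longrightarrow> increasing_event B \<Longrightarrow> prob A * prob B \<le> prob (A \<inter> B)"
    and mixing: "0 < \<epsilon> \<Longrightarrow> \<exists>N. \<forall>A B. event_supported_in A (lattice_box n) \<longrightarrow>
      event_supported_in B (UNIV - lattice_box N) \<longrightarrow> prob (A \<inter> B) \<le> prob A * prob B + \<epsilon>"
begin

lemma space_M: "space M = space config_space"
  using sets_M by (rule sets_eq_imp_space_eq)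

lemma events_eq: "events = sets config_space" by (rule sets_M)

lemma cluster_meets_translation:
  assumes "finite \<U>"
  shows "prob (cluster_meets (translation v ` S) ((`) (translation v) ` \<U>)) = prob (cluster_meets S \<U>)"
  using inv_translation[OF sets_cluster_meets[OF assms]] pullback_vimage_cluster_meets[OF auto_translation] by simp

lemma cluster_meets_swap:
  assumes "finite \<U>"
  shows "prob (cluster_meets (prod.swap ` S) ((`) prod.swap ` \<U>)) = prob (cluster_meets S \<U>)"
  using inv_swap[OF sets_cluster_meets[OF assms]] pullback_vimage_cluster_meets[OF auto_swap] by simp

lemma cluster_meets_negx:
  assumes "finite \<U>"
  shows "prob (cluster_meets (negx ` S) ((`) negx ` \<U>)) = prob (cluster_meets S \<U>)"
  using inv_negx[OF sets_cluster_meets[OF assms]] pullback_vimage_cluster_meets[OF auto_negx] by simp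

end

section \<open>The dual model and what it inherits\<close>

definition dual :: "config measure \<Rightarrow> config measure" where
  "dual M = distr M config_space dual_config"

definition dual_preimage :: "config set \<Rightarrow> config set" where
  "dual_preimage A = dual_config -` A \<inter> space config_space"

lemma dual_preimage_iff: "\<omega> \<in> dual_preimage A \<longleftrightarrow> \<omega> \<in> space config_space \<and> dual_config \<omega> \<in> A"
  by (auto simp: dual_preimage_def)

lemma sets_dual_preimage: "A \<in> sets config_space \<Longrightarrow> dual_preimage A \<in> sets config_space"
  unfolding dual_preimage_def using measurable_dual_config by (rule measurable_sets)

lemma dedge_translation:
  assumes "e \<in> lattice_edges" shows "dedge (translation v ` e) = translation v ` dedge e"
proof -
  obtain s t where v: "v = (s, t)" by (cases v)
  from assms show ?thesis
  proof (cases rule: lattice_edge_cases)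
    case (h i j)
    have "translation v ` e = {(i + s, j + t), (i + s + 1, j + t)}"
      by (simp add: h translation_def v algebra_simps)
    then have "dedge (translation v ` e) = {(i + s + 1, j + t), (i + s + 1, j + t + 1)}"
      by (simp only: dedge_h)
    then show ?thesis unfolding h dedge_h by (simp add: translation_def v algebra_simps)
  next
    case vert: (v i j)
    have "translation v ` e = {(i + s, j + t), (i + s, j + t + 1)}"
      by (simp add: vert translation_def v algebra_simps)
    then have "dedge (translation v ` e) = {(i + s, j + t + 1), (i + s + 1, j + t + 1)}"
      by (simp only: dedge_v)
    then show ?thesis unfolding vert dedge_v by (simp add: translation_def v algebra_simps)
  qed
qed

lemma dedge_swap: "e \<in> lattice_edges \<Longrightarrow> dedge (prod.swap ` e) = prod.swap ` dedge e"
  by (erule lattice_edge_cases) (simp_all)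

text \<open>The reflection does not respect the half-unit shift: the dual label \<open>- i\<close>
  stands for the abscissa \<open>- i + 1/2\<close>, which is \<open>1 - (i + 1/2)\<close>. Hence the
  primal map is the reflection followed by a unit translation.\<close>

lemma dedge_negx:
  assumes "e \<in> lattice_edges"
  shows "dedge (negx ` e) = (translation (1, 0) \<circ> negx) ` dedge e"
  using assms
proof (cases rule: lattice_edge_cases)
  case (h i j)
  have "negx ` e = {(- i - 1, j), (- i - 1 + 1, j)}" by (auto simp: h negx_def)
  then have "dedge (negx ` e) = {(- i, j), (- i, j + 1)}" by (simp only: dedge_h) simp
  then show ?thesis unfolding h by (simp add: negx_def translation_def)
next
  case (v i j)
  have "negx ` e = {(- i, j), (- i, j + 1)}" by (auto simp: v negx_def)
  then have "dedge (negx ` e) = {(- i, j + 1), (- i + 1, j + 1)}" by (simp only: dedge_v)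
  then show ?thesis unfolding v by (auto simp: negx_def translation_def)
qed

text \<open>Two half-unit shifts add up to a lattice translation, so the bidual configuration is a
  translate of the original one.\<close>

lemma dedge_dedge:
  assumes "e \<in> lattice_edges" shows "dedge (dedge e) = translation (1, 1) ` e"
  using assms by (cases rule: lattice_edge_cases) (auto simp: translation_def)

lemma auto_edge:
  assumes "lattice_auto g" "e \<in> lattice_edges" shows "g ` e \<in> lattice_edges"
proof -
  obtain x y where "e = {x, y}" "adjacent x y" using assms(2) by (auto simp: lattice_edges_def)
  then have "g ` e = {g x, g y}" "adjacent (g x) (g y)" using assms by (auto simp: lattice_auto_def)
  then show ?thesis using adjacent_edge by metis
qed

lemma pullback_dual_config:
  assumes "lattice_auto g" "lattice_auto h" "\<And>e. e \<in> lattice_edges \<Longrightarrow> dedge (g ` e) = h ` dedge e"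
  shows "pullback g (dual_config \<omega>) = dual_config (pullback h \<omega>)"
proof
  fix e show "pullback g (dual_config \<omega>) e = dual_config (pullback h \<omega>) e"
  proof (cases "e \<in> lattice_edges")
    case True
    then show ?thesis using assms(3)[OF True] auto_edge[OF assms(1) True]
      by (simp add: pullback_def dual_config_def)
  qed (simp add: pullback_def dual_config_def)
qed

lemma dual_config_dual_config:
  assumes "\<omega> \<in> space config_space" shows "dual_config (dual_config \<omega>) = pullback (translation (1, 1)) \<omega>"
proof
  fix e show "dual_config (dual_config \<omega>) e = pullback (translation (1, 1)) \<omega> e"
    using dedge_dedge[of e] by (cases "e \<in> lattice_edges") (simp_all add: pullback_def dual_config_def)
qed

lemma pullback_comp:
  assumes "lattice_auto h" shows "pullback h (pullback g \<omega>) = pullback (g \<circ> h) \<omega>"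
proof
  fix e show "pullback h (pullback g \<omega>) e = pullback (g \<circ> h) \<omega> e"
    using auto_edge[OF assms, of e] by (cases "e \<in> lattice_edges") (simp_all add: pullback_def image_comp)
qed

lemma auto_comp: "lattice_auto g \<Longrightarrow> lattice_auto h \<Longrightarrow> lattice_auto (g \<circ> h)"
  by (simp add: lattice_auto_def inj_compose)

lemma dual_preimage_pullback:
  assumes "lattice_auto g" "lattice_auto h" "\<And>e. e \<in> lattice_edges \<Longrightarrow> dedge (g ` e) = h ` dedge e"
  shows "dual_preimage (pullback g -` A \<inter> space config_space) = pullback h -` dual_preimage A \<inter> space config_space"
proof (rule set_eqI)
  fix \<omega>
  show "\<omega> \<in> dual_preimage (pullback g -` A \<inter> space config_space) \<longleftrightarrow> \<omega> \<in> pullback h -` dual_preimage A \<inter> space config_space"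
    using pullback_dual_config[OF assms, of \<omega>] by (simp add: dual_preimage_iff conj_commute)
qed

lemma dual_preimage_decreasing:
  assumes "increasing_event A" shows "increasing_event (space config_space - dual_preimage A)"
  unfolding increasing_event_def
proof (intro conjI ballI impI)
  have A: "A \<in> sets config_space" using assms by (simp add: increasing_event_def)
  show "space config_space - dual_preimage A \<in> sets config_space" using sets_dual_preimage[OF A] by auto
  fix \<omega> \<omega>' assume a: "\<omega> \<in> space config_space - dual_preimage A" "\<omega>' \<in> space config_space"
    "\<forall>e\<in>lattice_edges. \<omega> e \<le> \<omega>' e"
  have "\<omega>' \<notin> dual_preimage A"
  proof
    assume "\<omega>' \<in> dual_preimage A"
    then have d: "dual_config \<omega>' \<in> A" by (simp add: dual_preimage_iff)
    have le: "\<forall>e\<in>lattice_edges. dual_config \<omega>' e \<le> dual_config \<omega> e"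
    proof
      fix e :: edge assume e: "e \<in> lattice_edges"
      have "\<omega> (dedge e) \<le> \<omega>' (dedge e)" by (rule bspec[OF a(3) dedge_in[OF e]])
      then show "dual_config \<omega>' e \<le> dual_config \<omega> e" using e by (auto simp: dual_config_def)
    qed
    have "dual_config \<omega> \<in> A"
      using assms[unfolded increasing_event_def, THEN conjunct2, THEN bspec, OF d, THEN bspec,
          OF dual_config_space, THEN mp, OF le] .
    with a(1) show False by (simp add: dual_preimage_iff)
  qed
  with a(2) show "\<omega>' \<in> space config_space - dual_preimage A" by simp
qed

lemma dual_preimage_supported:
  assumes "event_supported_in A S" "\<And>e. e \<in> edges_within S \<Longrightarrow> dedge e \<subseteq> T"
  shows "event_supported_in (dual_preimage A) T"
proof (rule supportedI)
  show "dual_preimage A \<in> sets config_space" by (rule sets_dual_preimage[OF supported_sets[OF assms(1)]])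
  fix \<omega> \<omega>' assume a: "\<omega> \<in> space config_space" "\<omega>' \<in> space config_space"
    "\<And>e. e \<in> edges_within T \<Longrightarrow> \<omega> e = \<omega>' e"
  have "(dual_config \<omega> \<in> A) = (dual_config \<omega>' \<in> A)"
  proof (rule supportedD[OF assms(1)])
    fix e assume e: "e \<in> edges_within S"
    then have l: "e \<in> lattice_edges" by (simp add: edges_within_def)
    then have "\<omega> (dedge e) = \<omega>' (dedge e)" using assms(2)[OF e] by (intro a(3)) (simp add: edges_within_def)
    then show "dual_config \<omega> e = dual_config \<omega>' e" using l by (simp add: dual_config_def)
  qed simp_all
  then show "(\<omega> \<in> dual_preimage A) = (\<omega>' \<in> dual_preimage A)" using a(1,2) by (simp add: dual_preimage_iff)
qed

lemma dedge_lattice_box: "e \<in> edges_within (lattice_box n) \<Longrightarrow> dedge e \<subseteq> lattice_box (n + 1)"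
  unfolding edges_within_def lattice_box_def mem_Collect_eq
  by (elim conjE, erule lattice_edge_cases) auto

lemma dedge_lattice_box': "e \<in> edges_within (UNIV - lattice_box (n + 1)) \<Longrightarrow> dedge e \<subseteq> UNIV - lattice_box n"
  unfolding edges_within_def lattice_box_def mem_Collect_eq
  by (elim conjE, erule lattice_edge_cases) auto

context perc
begin

lemma measure_dual: "A \<in> sets config_space \<Longrightarrow> measure (dual M) A = prob (dual_preimage A)"
  unfolding dual_def dual_preimage_def
  using measurable_dual_config sets_M space_M
  by (subst measure_distr) (auto cong: measurable_cong_sets)

lemma prob_pullback_comp:
  assumes "lattice_auto g" "lattice_auto h"
    "\<And>A. A \<in> sets config_space \<Longrightarrow> prob (pullback g -` A \<inter> space config_space) = prob A"
    "\<And>A. A \<in> sets config_space \<Longrightarrow> prob (pullback h -` A \<inter> space config_space) = prob A"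
    "A \<in> sets config_space"
  shows "prob (pullback (g \<circ> h) -` A \<inter> space config_space) = prob A"
proof -
  have "pullback (g \<circ> h) -` A \<inter> space config_space =
      pullback g -` (pullback h -` A \<inter> space config_space) \<inter> space config_space"
    using pullback_comp[OF assms(2), of g] by auto
  then have "prob (pullback (g \<circ> h) -` A \<inter> space config_space) =
      prob (pullback g -` (pullback h -` A \<inter> space config_space) \<inter> space config_space)" by (rule arg_cong)
  moreover have "pullback h -` A \<inter> space config_space \<in> sets config_space"
    using measurable_pullback'[OF assms(2)] assms(5) by (rule measurable_sets)
  ultimately show ?thesis using assms(3)[of "pullback h -` A \<inter> space config_space"] assms(4,5) by metis
qed

lemma dual_inv:
  assumes "lattice_auto g" "lattice_auto h" "\<And>e. e \<in> lattice_edges \<Longrightarrow> dedge (g ` e) = h ` dedge e"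
    "\<And>A. A \<in> sets config_space \<Longrightarrow> prob (pullback h -` A \<inter> space config_space) = prob A"
    "A \<in> sets config_space"
  shows "measure (dual M) (pullback g -` A \<inter> space config_space) = measure (dual M) A"
proof -
  have "pullback g -` A \<inter> space config_space \<in> sets config_space"
    using measurable_pullback'[OF assms(1)] assms(5) by (rule measurable_sets)
  then show ?thesis using assms(4)[OF sets_dual_preimage[OF assms(5)]]
    by (simp add: measure_dual assms(5) dual_preimage_pullback[OF assms(1-3)])
qed

text \<open>By inclusion-exclusion, the inequality for two complements is equivalent to the
  inequality for the events, so FKG also holds for decreasing events.\<close>

lemma FKG_compl:
  assumes "increasing_event (space config_space - A)" "increasing_event (space config_space - B)"
    "A \<in> sets config_space" "B \<in> sets config_space"
  shows "prob A * prob B \<le> prob (A \<inter> B)"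
proof -
  have ev: "A \<in> events" "B \<in> events" using assms(3,4) sets_M by auto
  have c: "prob (space M - A) = 1 - prob A" "prob (space M - B) = 1 - prob B"
    using ev by (auto simp: prob_compl)
  have i: "prob (space M - A) * prob (space M - B) \<le> prob ((space M - A) \<inter> (space M - B))"
    using FKG[OF assms(1,2)] by (simp add: space_M)
  have e: "(space M - A) \<inter> (space M - B) = space M - (A \<union> B)" by auto
  have "prob (A \<union> B) = prob A + prob B - prob (A \<inter> B)"
    using finite_measure_Union'[OF ev] finite_measure_Diff'[OF ev(2,1)] by (simp add: Int_commute)
  then have "prob ((space M - A) \<inter> (space M - B)) = 1 - prob A - prob B + prob (A \<inter> B)"
    unfolding e using ev by (simp add: prob_compl)
  then show ?thesis using i unfolding c by (simp add: algebra_simps)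
qed

text \<open>Duality exchanges increasing and decreasing events, for which FKG has the same sign, and
  it moves the boundary of a supporting box by at most one unit, which the choice of
  \<open>N\<close> in \<open>mixing\<close> absorbs.\<close>

lemma perc_dual: "perc (dual M)"
proof -
  have dm: "dual_config \<in> M \<rightarrow>\<^sub>M config_space"
    using measurable_dual_config sets_M by (simp cong: measurable_cong_sets)
  interpret d: prob_space "dual M" unfolding dual_def using dm by (rule prob_space_distr)
  show ?thesis
  proof unfold_locales
    show "sets (dual M) = sets config_space" by (simp add: dual_def)
  next
    fix A v assume "A \<in> sets config_space"
    then show "d.prob (pullback (translation v) -` A \<inter> space config_space) = d.prob A"
      by (intro dual_inv[OF auto_translation auto_translation dedge_translation inv_translation])
  next
    fix A assume "A \<in> sets config_space"
    then show "d.prob (pullback prod.swap -` A \<inter> space config_space) = d.prob A"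
      by (intro dual_inv[OF auto_swap auto_swap dedge_swap inv_swap])
  next
    fix A assume "A \<in> sets config_space"
    then show "d.prob (pullback negx -` A \<inter> space config_space) = d.prob A"
      by (intro dual_inv[OF auto_negx auto_comp[OF auto_translation auto_negx] dedge_negx
          prob_pullback_comp[OF auto_translation auto_negx inv_translation inv_negx]])
  next
    fix A B assume a: "increasing_event A" "increasing_event B"
    then have s: "A \<in> sets config_space" "B \<in> sets config_space" by (simp_all add: increasing_event_def)
    have "dual_preimage (A \<inter> B) = dual_preimage A \<inter> dual_preimage B" by (auto simp: dual_preimage_def)
    then show "d.prob A * d.prob B \<le> d.prob (A \<inter> B)"
      using FKG_compl[OF dual_preimage_decreasing[OF a(1)] dual_preimage_decreasing[OF a(2)] sets_dual_preimage[OF s(1)] sets_dual_preimage[OF s(2)]] s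
      by (simp add: measure_dual)
  next
    fix \<epsilon> :: real and n :: int assume "0 < \<epsilon>"
    from mixing[OF this, of "n + 1"] obtain N where N: "\<forall>A B. event_supported_in A (lattice_box (n + 1)) \<longrightarrow>
        event_supported_in B (UNIV - lattice_box N) \<longrightarrow> prob (A \<inter> B) \<le> prob A * prob B + \<epsilon>" by auto
    show "\<exists>N. \<forall>A B. event_supported_in A (lattice_box n) \<longrightarrow>
        event_supported_in B (UNIV - lattice_box N) \<longrightarrow> d.prob (A \<inter> B) \<le> d.prob A * d.prob B + \<epsilon>"
    proof (intro exI[of _ "N + 1"] allI impI)
      fix A B assume a: "event_supported_in A (lattice_box n)" "event_supported_in B (UNIV - lattice_box (N + 1))"
      have s: "A \<in> sets config_space" "B \<in> sets config_space" using a supported_sets by auto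
      have "dual_preimage (A \<inter> B) = dual_preimage A \<inter> dual_preimage B" by (auto simp: dual_preimage_def)
      moreover have "prob (dual_preimage A \<inter> dual_preimage B) \<le> prob (dual_preimage A) * prob (dual_preimage B) + \<epsilon>"
        using N dual_preimage_supported[OF a(1) dedge_lattice_box] dual_preimage_supported[OF a(2) dedge_lattice_box'] by blast
      ultimately show "d.prob (A \<inter> B) \<le> d.prob A * d.prob B + \<epsilon>"
        using s by (simp add: measure_dual)
    qed
  qed
qed

text \<open>By translation invariance the bidual has the law of the model, so statements about a
  model and its dual may be used with the roles exchanged.\<close>

lemma measure_dual_dual:
  assumes "A \<in> sets config_space" shows "measure (dual (dual M)) A = prob A"
proof -
  interpret d: perc "dual M" by (rule perc_dual)
  have "dual_preimage (dual_preimage A) = pullback (translation (1, 1)) -` A \<inter> space config_space"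
  proof (rule set_eqI)
    fix \<omega> show "\<omega> \<in> dual_preimage (dual_preimage A) \<longleftrightarrow> \<omega> \<in> pullback (translation (1, 1)) -` A \<inter> space config_space"
      using dual_config_dual_config[of \<omega>] by (auto simp: dual_preimage_iff)
  qed
  then show ?thesis using assms by (simp add: d.measure_dual measure_dual sets_dual_preimage inv_translation)
qed

end

section \<open>Cutting and joining clusters\<close>

lemma first_entry:
  assumes "(u, v) \<in> R\<^sup>*" "P u" "\<not> P v"
  obtains w w' where "(u, w) \<in> {(s, t) \<in> R. P s \<and> P t}\<^sup>*" "P w" "(w, w') \<in> R" "\<not> P w'"
proof -
  have "P v \<and> (u, v) \<in> {(s, t) \<in> R. P s \<and> P t}\<^sup>* \<or>
    (\<exists>w w'. (u, w) \<in> {(s, t) \<in> R. P s \<and> P t}\<^sup>* \<and> P w \<and> (w, w') \<in> R \<and> \<not> P w')"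
    using assms(1)
  proof induction
    case (step y z)
    show ?case
    proof (cases "P y \<and> (u, y) \<in> {(s, t) \<in> R. P s \<and> P t}\<^sup>*")
      case True
      show ?thesis
      proof (cases "P z")
        case Pz: True
        then have "(y, z) \<in> {(s, t) \<in> R. P s \<and> P t}" using step(2) True by auto
        then show ?thesis using True Pz by (meson rtrancl.rtrancl_into_rtrancl)
      next
        case False
        then show ?thesis using True step(2) by blast
      qed
    next
      case False
      then show ?thesis using step.IH by blast
    qed
  qed (use assms(2) in simp)
  then show thesis using assms(3) that by blast
qed

text \<open>A path along which such a function passes a level takes that level exactly. With the
  coordinates and the sup norm this cuts crossings down to smaller rectangles and annuli.\<close>

definition lattice_lipschitz :: "(vertex \<Rightarrow> int) \<Rightarrow> bool" where
  "lattice_lipschitz f \<longleftrightarrow> (\<forall>u v. adjacent u v \<longrightarrow> \<bar>f u - f v\<bar> \<le> 1)"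

definition supn :: "vertex \<Rightarrow> int" where
  "supn p = max \<bar>fst p\<bar> \<bar>snd p\<bar>"

lemma lattice_lipschitz_fst: "lattice_lipschitz fst" and lattice_lipschitz_snd: "lattice_lipschitz snd"
  by (auto simp: lattice_lipschitz_def adjacent_def)

lemma lattice_lipschitz_supn: "lattice_lipschitz supn"
  unfolding lattice_lipschitz_def
proof (intro allI impI)
  fix u v assume "adjacent u v"
  then have 1: "\<bar>fst u - fst v\<bar> + \<bar>snd u - snd v\<bar> = 1" by (simp add: adjacent_def)
  have 2: "\<bar>\<bar>fst u\<bar> - \<bar>fst v\<bar>\<bar> \<le> \<bar>fst u - fst v\<bar>" "\<bar>\<bar>snd u\<bar> - \<bar>snd v\<bar>\<bar> \<le> \<bar>snd u - snd v\<bar>"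
    by (rule abs_triangle_ineq3)+
  have *: "\<bar>max p q - max r s\<bar> \<le> 1" if "\<bar>p - r\<bar> \<le> 1" "\<bar>q - s\<bar> \<le> 1" for p q r s :: int
    using that by (auto simp: max_def abs_le_iff)
  show "\<bar>supn u - supn v\<bar> \<le> 1" unfolding supn_def by (rule *) (use 1 2 in linarith)+
qed

lemma supn_box: "p \<in> lattice_box n \<longleftrightarrow> supn p \<le> n"
  by (cases p) (auto simp: lattice_box_def supn_def)

text \<open>The path is stopped as soon as \<open>f\<close> reaches \<open>b\<close>; before that
  all its vertices satisfy \<open>f < b\<close>.\<close>

lemma clus_shrink_up:
  assumes "v \<in> clus \<omega> S u" "u \<in> S" "lattice_lipschitz f" "f u \<le> b" "b \<le> f v"
  obtains v' where "f v' = b" "v' \<in> clus \<omega> (S \<inter> {w. f w \<le> b}) u"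
proof (cases "f u = b")
  case True
  then show ?thesis using that[of u] by simp
next
  case False
  have "(u, v) \<in> (openrel \<omega> S)\<^sup>*" using assms(1) by (simp add: clus_def)
  then obtain w w' where w: "(u, w) \<in> {(s, t) \<in> openrel \<omega> S. f s < b \<and> f t < b}\<^sup>*" "f w < b"
    "(w, w') \<in> openrel \<omega> S" "\<not> f w' < b"
    by (rule first_entry[where P = "\<lambda>w. f w < b"]) (use False assms in auto)
  have "{(s, t) \<in> openrel \<omega> S. f s < b \<and> f t < b} \<subseteq> openrel \<omega> (S \<inter> {w. f w \<le> b})"
    by (auto simp: openrel_def)
  from rtrancl_mono[OF this] w(1) have "w \<in> clus \<omega> (S \<inter> {w. f w \<le> b}) u" by (auto simp: clus_def)
  moreover have ad: "adjacent w w'" using w(3) by (simp add: openrel_def)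
  have "\<bar>f w - f w'\<bar> \<le> 1" using assms(3) ad unfolding lattice_lipschitz_def by metis
  then have fw: "f w' = b" using w(2,4) by linarith
  then have "(w, w') \<in> openrel \<omega> (S \<inter> {w. f w \<le> b})" using w by (simp add: openrel_def)
  ultimately have "w' \<in> clus \<omega> (S \<inter> {w. f w \<le> b}) u" by (rule clus_step)
  with fw show ?thesis by (rule that)
qed

lemma clus_shrink_down:
  assumes "v \<in> clus \<omega> S u" "u \<in> S" "lattice_lipschitz f" "f u \<ge> b" "b \<ge> f v"
  obtains v' where "f v' = b" "v' \<in> clus \<omega> (S \<inter> {w. f w \<ge> b}) u"
proof -
  have "lattice_lipschitz (\<lambda>w. - f w)" using assms(3) by (auto simp: lattice_lipschitz_def abs_minus_commute)
  from clus_shrink_up[OF assms(1,2) this, of "- b"] assms(4,5)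
  obtain v' where "- f v' = - b" "v' \<in> clus \<omega> (S \<inter> {w. - f w \<le> - b}) u" by auto
  with that show thesis by simp
qed

lemma clus_shrink:
  assumes "v \<in> clus \<omega> S u" "u \<in> S" "lattice_lipschitz f" "f u \<le> a" "a \<le> b" "b \<le> f v"
  obtains u' v' where "u' \<in> S" "f u' = a" "f v' = b" "v' \<in> clus \<omega> (S \<inter> {w. a \<le> f w \<and> f w \<le> b}) u'"
proof -
  have v: "v \<in> S" by (rule subsetD[OF clus_sub[OF assms(2)] assms(1)])
  have "u \<in> clus \<omega> S v" using assms(1) clus_sym by auto
  from clus_shrink_down[OF this v assms(3), of a] assms
  obtain u' where u': "f u' = a" "u' \<in> clus \<omega> (S \<inter> {w. f w \<ge> a}) v" by auto
  have vS: "v \<in> S \<inter> {w. f w \<ge> a}" using v assms by auto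
  from clus_sub[OF this] u' have u'S: "u' \<in> S \<inter> {w. f w \<ge> a}" by auto
  have "v \<in> clus \<omega> (S \<inter> {w. f w \<ge> a}) u'" using u' clus_sym by auto
  from clus_shrink_up[OF this u'S assms(3), of b] u' assms
  obtain v' where v': "f v' = b" "v' \<in> clus \<omega> (S \<inter> {w. a \<le> f w} \<inter> {w. f w \<le> b}) u'" by auto
  have "S \<inter> {w. a \<le> f w} \<inter> {w. f w \<le> b} = S \<inter> {w. a \<le> f w \<and> f w \<le> b}" by auto
  with v' u' u'S that show thesis by auto
qed

lemma clus_meet:
  assumes "clus \<omega> S x \<inter> clus \<omega> T y \<noteq> {}" "S \<subseteq> R" "T \<subseteq> R"
  shows "clus \<omega> T y \<subseteq> clus \<omega> R x"
proof -
  obtain u where u: "u \<in> clus \<omega> S x" "u \<in> clus \<omega> T y" using assms by auto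
  have "u \<in> clus \<omega> R x" "u \<in> clus \<omega> R y" using u clus_mono assms by blast+
  then have "clus \<omega> R x = clus \<omega> R y" using clus_eq by blast
  then show ?thesis using clus_mono[OF assms(3)] by auto
qed

lemma clus_chain:
  assumes "\<And>i. i < k \<Longrightarrow> clus \<omega> (S i) (x i) \<inter> clus \<omega> (S (Suc i)) (x (Suc i)) \<noteq> {}"
    "\<And>i. i \<le> k \<Longrightarrow> S i \<subseteq> R"
  shows "i \<le> k \<Longrightarrow> clus \<omega> (S i) (x i) \<subseteq> clus \<omega> R (x 0)"
proof (induction i)
  case 0
  then show ?case using clus_mono[OF assms(2)] by auto
next
  case (Suc i)
  then obtain u where u: "u \<in> clus \<omega> (S i) (x i)" "u \<in> clus \<omega> (S (Suc i)) (x (Suc i))"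
    using assms(1)[of i] by auto
  have "u \<in> clus \<omega> R (x 0)" using u Suc by auto
  moreover have "u \<in> clus \<omega> R (x (Suc i))" using u(2) clus_mono[OF assms(2)[OF Suc.prems]] by blast
  ultimately have "clus \<omega> R (x 0) = clus \<omega> R (x (Suc i))" using clus_eq by blast
  then show ?case using clus_mono[OF assms(2)[OF Suc.prems]] by auto
qed

lemma lattice_connected_image:
  assumes "lattice_auto g" "lattice_connected A" shows "lattice_connected (g ` A)"
  unfolding lattice_connected_def
proof (intro ballI)
  fix u v assume "u \<in> g ` A" "v \<in> g ` A"
  then obtain p q where pq: "u = g p" "p \<in> A" "v = g q" "q \<in> A" by auto
  then have "(p, q) \<in> {(s, t). adjacent s t \<and> s \<in> A \<and> t \<in> A}\<^sup>*" using assms(2) by (simp add: lattice_connected_def)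
  then have "(g p, g q) \<in> {(s, t). adjacent s t \<and> s \<in> g ` A \<and> t \<in> g ` A}\<^sup>*"
  proof induction
    case (step y z)
    have "(g y, g z) \<in> {(s, t). adjacent s t \<and> s \<in> g ` A \<and> t \<in> g ` A}"
      using step(2) assms(1) by (auto simp: lattice_auto_def)
    with step.IH show ?case by (rule rtrancl.rtrancl_into_rtrancl)
  qed simp
  then show "(u, v) \<in> {(s, t). adjacent s t \<and> s \<in> g ` A \<and> t \<in> g ` A}\<^sup>*" by (simp add: pq)
qed

lemma lattice_connected_row: "lattice_connected ({a..b::int} \<times> {y})"
proof -
  have "{a..b} \<times> {y} = prod.swap ` ({y} \<times> {a..b})" by auto
  then show ?thesis using lattice_connected_image[OF auto_swap lattice_connected_column[of y a b]] by simp
qed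

lemma gap_cross_left:
  assumes A: "lattice_connected A" "\<And>s. s \<in> A \<Longrightarrow> a \<le> fst s \<and> fst s \<le> b" "(a, a0) \<in> A" "(b, a1) \<in> A" "finite A"
    and B: "lattice_connected B" "\<And>s. s \<in> B \<Longrightarrow> a \<le> fst s \<and> fst s \<le> b" "(a, b0) \<in> B" "(a, b1) \<in> B"
    and le: "b0 \<le> a0" "a0 \<le> b1"
  shows "A \<inter> B \<noteq> {}"
proof -
  have m: "(- x, y) \<in> negx ` C" if "(x, y) \<in> C" for x y C
    using that by (intro image_eqI[of _ _ "(x, y)"]) (simp_all add: negx_def)
  have bd: "- b \<le> fst s \<and> fst s \<le> - a" if "s \<in> negx ` C" "\<And>s. s \<in> C \<Longrightarrow> a \<le> fst s \<and> fst s \<le> b" for s C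
    using that(1) that(2) by (auto simp: negx_def)
  have "negx ` A \<inter> negx ` B \<noteq> {}"
    by (rule gap_cross[of "negx ` A" "- b" "- a" a1 a0 "negx ` B" b0 b1])
      (use A B le m bd lattice_connected_image[OF auto_negx] in auto)
  moreover have "inj negx" using auto_negx by (simp add: lattice_auto_def)
  ultimately show ?thesis by (simp add: image_Int[symmetric])
qed

text \<open>The path is prolonged by row segments outside the rectangle, which cannot meet the crossing, until it
  ends on the two vertical sides.\<close>

lemma extend_low:
  assumes B: "lattice_connected B" "\<And>s. s \<in> B \<Longrightarrow> a \<le> fst s \<and> fst s \<le> b" "p \<in> B"
    and low: "snd p \<le> c \<or> (fst p = a \<and> snd p \<le> y1) \<or> (fst p = b \<and> snd p \<le> y2)"
    and y: "c \<le> y1" "c \<le> y2"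
  obtains B' q where "lattice_connected B'" "\<And>s. s \<in> B' \<Longrightarrow> a \<le> fst s \<and> fst s \<le> b" "B \<subseteq> B'"
    "\<And>s. s \<in> B' - B \<Longrightarrow> snd s < c"
    "q \<in> B'" "(fst q = a \<and> snd q \<le> y1) \<or> (fst q = b \<and> snd q \<le> y2)"
proof (cases "(fst p = a \<and> snd p \<le> y1) \<or> (fst p = b \<and> snd p \<le> y2)")
  case True
  then show ?thesis using that[of B p] assms by auto
next
  case False
  obtain px py where p: "p = (px, py)" by force
  have py: "py \<le> c" using low False by (auto simp: p)
  have px: "a \<le> px" "px \<le> b" using B(2)[OF B(3)] by (auto simp: p)
  let ?R = "{a..px} \<times> {py - 1}"
  have "lattice_connected (B \<union> ?R)"
    by (rule lattice_connected_Un[OF B(1) lattice_connected_row B(3), of "(px, py - 1)"]) (use px in \<open>auto simp: p adjacent_def\<close>)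
  then show ?thesis
  proof (rule that)
    show "(a, py - 1) \<in> B \<union> ?R" using px by simp
    show "a \<le> fst s \<and> fst s \<le> b" if "s \<in> B \<union> ?R" for s
      using B(2)[of s] px that by (cases "s \<in> B") auto
    show "snd s < c" if "s \<in> B \<union> ?R - B" for s using that py by auto
  qed (use py y in auto)
qed

lemma extend_high:
  assumes B: "lattice_connected B" "\<And>s. s \<in> B \<Longrightarrow> a \<le> fst s \<and> fst s \<le> b" "p \<in> B"
    and high: "snd p \<ge> d \<or> (fst p = a \<and> snd p \<ge> y1) \<or> (fst p = b \<and> snd p \<ge> y2)"
    and y: "d \<ge> y1" "d \<ge> y2"
  obtains B' q where "lattice_connected B'" "\<And>s. s \<in> B' \<Longrightarrow> a \<le> fst s \<and> fst s \<le> b" "B \<subseteq> B'"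
    "\<And>s. s \<in> B' - B \<Longrightarrow> snd s > d"
    "q \<in> B'" "(fst q = a \<and> snd q \<ge> y1) \<or> (fst q = b \<and> snd q \<ge> y2)"
proof (cases "(fst p = a \<and> snd p \<ge> y1) \<or> (fst p = b \<and> snd p \<ge> y2)")
  case True
  then show ?thesis using that[of B p] assms by auto
next
  case False
  obtain px py where p: "p = (px, py)" by force
  have py: "py \<ge> d" using high False by (auto simp: p)
  have px: "a \<le> px" "px \<le> b" using B(2)[OF B(3)] by (auto simp: p)
  let ?R = "{a..px} \<times> {py + 1}"
  have "lattice_connected (B \<union> ?R)"
    by (rule lattice_connected_Un[OF B(1) lattice_connected_row B(3), of "(px, py + 1)"]) (use px in \<open>auto simp: p adjacent_def\<close>)
  then show ?thesis
  proof (rule that)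
    show "(a, py + 1) \<in> B \<union> ?R" using px by simp
    show "a \<le> fst s \<and> fst s \<le> b" if "s \<in> B \<union> ?R" for s
      using B(2)[of s] px that by (cases "s \<in> B") auto
    show "snd s > d" if "s \<in> B \<union> ?R - B" for s using that py by auto
  qed (use py y in auto)
qed

text \<open>Once both ends of \<open>B\<close> are prolonged to the vertical sides, two ends on the
  same side call for \<open>gap_cross\<close> or its mirror image and ends on opposite sides for
  \<open>strip_cross\<close>. The prolongations avoid the rows from \<open>c\<close> to
  \<open>d\<close>, so the common vertex lies in \<open>B\<close> itself.\<close>

lemma separating_path_cross:
  assumes A: "lattice_connected A" "A \<subseteq> rect a b c d" "(a, y1) \<in> A" "(b, y2) \<in> A"
    and B: "lattice_connected B" "\<And>s. s \<in> B \<Longrightarrow> a \<le> fst s \<and> fst s \<le> b"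
    and p: "p \<in> B" "snd p \<le> c \<or> (fst p = a \<and> snd p \<le> y1) \<or> (fst p = b \<and> snd p \<le> y2)"
    and q: "q \<in> B" "snd q \<ge> d \<or> (fst q = a \<and> snd q \<ge> y1) \<or> (fst q = b \<and> snd q \<ge> y2)"
  shows "A \<inter> B \<noteq> {}"
proof -
  have y: "c \<le> y1" "c \<le> y2" "y1 \<le> d" "y2 \<le> d" using A by auto
  have cA: "a \<le> fst s \<and> fst s \<le> b" "c \<le> snd s" "snd s \<le> d" if "s \<in> A" for s
    using subsetD[OF A(2) that] by (auto simp: rect_iff')
  have fA: "finite A" using A(2) finite_rect finite_subset by blast
  from extend_low[OF B p y(1,2)] obtain B1 p1 where B1: "lattice_connected B1"
    "\<And>s. s \<in> B1 \<Longrightarrow> a \<le> fst s \<and> fst s \<le> b" "B \<subseteq> B1" "\<And>s. s \<in> B1 - B \<Longrightarrow> snd s < c" "p1 \<in> B1"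
    "(fst p1 = a \<and> snd p1 \<le> y1) \<or> (fst p1 = b \<and> snd p1 \<le> y2)" by blast
  have "q \<in> B1" using q B1 by auto
  from extend_high[OF B1(1,2) this q(2) y(3,4)] obtain B2 q1 where B2: "lattice_connected B2"
    "\<And>s. s \<in> B2 \<Longrightarrow> a \<le> fst s \<and> fst s \<le> b" "B1 \<subseteq> B2" "\<And>s. s \<in> B2 - B1 \<Longrightarrow> d < snd s" "q1 \<in> B2"
    "(fst q1 = a \<and> snd q1 \<ge> y1) \<or> (fst q1 = b \<and> snd q1 \<ge> y2)" by blast
  obtain px py qx qy where pq: "p1 = (px, py)" "q1 = (qx, qy)" by (metis surj_pair)
  have m: "(px, py) \<in> B2" "(qx, qy) \<in> B2" using B1 B2 pq by auto
  have "A \<inter> B2 \<noteq> {}"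
  proof -
    consider "px = a" "qx = a" | "px = b" "qx = b" | "px = a" "qx = b" | "px = b" "qx = a"
      using B1(6) B2(6) pq by auto
    note cs = this
    have L: "px = a \<Longrightarrow> py \<le> y1 \<or> a = b" "px = b \<Longrightarrow> py \<le> y2 \<or> a = b"
      "qx = a \<Longrightarrow> y1 \<le> qy \<or> a = b" "qx = b \<Longrightarrow> y2 \<le> qy \<or> a = b" using B1(6) B2(6) pq by auto
    show ?thesis
    \<comment> \<open>With a single column the two sides coincide, and an end of \<open>B\<close>
      may be bounded by either endpoint of \<open>A\<close>.\<close>
    proof (cases "a = b")
      case True
      obtain z z' where z: "z \<in> {y1, y2}" "py \<le> z" "z' \<in> {y1, y2}" "z' \<le> qy"
        using B1(6) B2(6) pq by auto
      have p': "(b, py) \<in> B2" "(b, qy) \<in> B2" using m B1(6) B2(6) pq True by auto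
      have zA: "(a, z) \<in> A" "(b, z) \<in> A" "(a, z') \<in> A" "(b, z') \<in> A" using z A True by auto
      show ?thesis
      proof (cases "z \<le> qy")
        case ok: True
        show ?thesis by (rule gap_cross[OF A(1) cA(1) zA(1,2) fA B2(1,2) p'(1,2) z(2) ok]) auto
      next
        case False
        show ?thesis
        proof (cases "py \<le> z'")
          case ok: True
          show ?thesis by (rule gap_cross[OF A(1) cA(1) zA(3,4) fA B2(1,2) p'(1,2) ok z(4)]) auto
        next
          case False2: False
          have p'': "(a, qy) \<in> B2" "(a, py) \<in> B2" using p' True by auto
          have "z' \<le> qy" "py \<le> z" using z by auto
          show ?thesis
            by (rule strip_cross[OF A(1) cA(1) zA(3,2) fA B2(1,2) p''(1) p'(1) z(4) z(2)]) auto
        qed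
      qed
    next
      case False
      from cs show ?thesis
      proof cases
        case 1
        show ?thesis
          by (rule gap_cross_left[OF A(1) cA(1) A(3,4) fA B2(1,2) m[unfolded 1]]) (use L 1 False in auto)
      next
        case 2
        show ?thesis
          by (rule gap_cross[OF A(1) cA(1) A(3,4) fA B2(1,2) m[unfolded 2]]) (use L 2 False in auto)
      next
        case 3
        \<comment> \<open>The ends are ordered oppositely to \<open>strip_cross\<close>; the
          reflection in the horizontal axis restores the order.\<close>
        have "B2 \<inter> A \<noteq> {}"
        proof -
          have m': "(a, py) \<in> B2" "(b, qy) \<in> B2" using m 3 by auto
          have le: "py \<le> y1" "y2 \<le> qy" using L 3 False by auto
          have neg: "(x, - y) \<in> (\<lambda>(x, y). (x, - y)) ` C" if "(x, y) \<in> C" for x y :: int and C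
            using that by (intro image_eqI[of _ _ "(x, y)"]) auto
          let ?g = "\<lambda>(x, y). (x, - y) :: vertex"
          have ag: "lattice_auto ?g"
            by (auto simp: lattice_auto_def adjacent_def inj_on_def)
          have col: "a \<le> fst s \<and> fst s \<le> b" if "s \<in> ?g ` C" "\<And>s. s \<in> C \<Longrightarrow> a \<le> fst s \<and> fst s \<le> b" for s C
            using that(1) that(2) by force
          have "?g ` A \<inter> ?g ` B2 \<noteq> {}"
            by (rule strip_cross[OF lattice_connected_image[OF ag A(1)] col[OF _ cA(1)] neg[OF A(3)] neg[OF A(4)] _
                  lattice_connected_image[OF ag B2(1)] col[OF _ B2(2)] neg[OF m'(1)] neg[OF m'(2)]])
              (use le fA in auto)
          then show ?thesis by force
        qed
        then show ?thesis by auto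
      next
        case 4
        show ?thesis
          by (rule strip_cross[OF A(1) cA(1) A(3,4) fA B2(1,2) m(2)[unfolded 4] m(1)[unfolded 4]]) (use L 4 False in auto)
      qed
    qed
  qed
  then obtain s where s: "s \<in> A" "s \<in> B2" by auto
  have "s \<in> B1" using s B2(4)[of s] cA(3)[OF s(1)] by force
  then have "s \<in> B" using s B1(4)[of s] cA(2)[OF s(1)] by force
  then show ?thesis using s by auto
qed

lemma clus_monoD: "u \<in> clus \<omega> S x \<Longrightarrow> S \<subseteq> T \<Longrightarrow> u \<in> clus \<omega> T x"
  using clus_mono by blast

section \<open>Gluing crossings\<close>

definition Arm :: "int \<Rightarrow> int \<Rightarrow> int \<Rightarrow> int \<Rightarrow> int set \<Rightarrow> int set \<Rightarrow> config set" where
  "Arm a b c d I J = cluster_meets (rect a b c d) {{a} \<times> I, {b} \<times> J}"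

abbreviation hcross :: "int \<Rightarrow> int \<Rightarrow> int \<Rightarrow> int \<Rightarrow> config set" where
  "hcross a b c d \<equiv> Arm a b c d UNIV UNIV"

definition vcross :: "int \<Rightarrow> int \<Rightarrow> int \<Rightarrow> int \<Rightarrow> config set" where
  "vcross a b c d = cluster_meets (rect a b c d) {UNIV \<times> {c}, UNIV \<times> {d}}"

text \<open>A path that lands on a vertical side of the box within distance \<open>g\<close> of height \<open>t\<close> is trapped by an arch.\<close>

definition Arch :: "int \<Rightarrow> int \<Rightarrow> int \<Rightarrow> int \<Rightarrow> config set" where
  "Arch s t n g = cluster_meets (rect s (s + 2 * n) (t - 2 * n) (t + 2 * n))
     {{s} \<times> {t + g..}, {s} \<times> {..t - g}, {s + 2 * n} \<times> {t + g..}, {s + 2 * n} \<times> {..t - g}}"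

lemma increasing_Arm [simp]: "increasing_event (Arm a b c d I J)"
  and increasing_vcross [simp]: "increasing_event (vcross a b c d)"
  and increasing_Arch [simp]: "increasing_event (Arch s t n g)"
  unfolding Arm_def vcross_def Arch_def by (rule increasing_cluster_meets; simp)+

lemma increasing_sets: "increasing_event A \<Longrightarrow> A \<in> sets config_space"
  by (simp add: increasing_event_def)

lemma sets_Arm [simp]: "Arm a b c d I J \<in> sets config_space"
  and sets_vcross [simp]: "vcross a b c d \<in> sets config_space"
  and sets_Arch [simp]: "Arch s t n g \<in> sets config_space"
  by (rule increasing_sets; simp)+

lemma increasing_sub_space: "increasing_event A \<Longrightarrow> A \<subseteq> space config_space"
  using increasing_sets sets.sets_into_space by blast

lemma increasing_space: "\<omega> \<in> A \<Longrightarrow> increasing_event A \<Longrightarrow> \<omega> \<in> space config_space"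
  using increasing_sub_space by (rule subsetD)

lemma ArmI:
  assumes "\<omega> \<in> space config_space" "x \<in> rect a b c d" "(a, y) \<in> clus \<omega> (rect a b c d) x" "y \<in> I"
    "(b, z) \<in> clus \<omega> (rect a b c d) x" "z \<in> J"
  shows "\<omega> \<in> Arm a b c d I J"
  unfolding Arm_def using assms(1,2)
proof (rule cluster_meetsI)
  fix U assume "U \<in> {{a} \<times> I, {b} \<times> J}"
  then consider "U = {a} \<times> I" | "U = {b} \<times> J" by auto
  then show "\<exists>u\<in>U. u \<in> clus \<omega> (rect a b c d) x"
  proof cases
    case 1 with assms show ?thesis by (intro bexI[of _ "(a, y)"]) auto
  next
    case 2 with assms show ?thesis by (intro bexI[of _ "(b, z)"]) auto
  qed
qed

lemma bex_col: "(\<exists>u\<in>{a} \<times> I. u \<in> C) \<longleftrightarrow> (\<exists>y\<in>I. (a, y) \<in> C)"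
  and bex_row: "(\<exists>u\<in>I \<times> {a}. u \<in> C) \<longleftrightarrow> (\<exists>y\<in>I. (y, a) \<in> C)"
  by auto

lemma ArmE:
  assumes "\<omega> \<in> Arm a b c d I J"
  obtains x y z where "\<omega> \<in> space config_space" "x \<in> rect a b c d" "(a, y) \<in> clus \<omega> (rect a b c d) x" "y \<in> I"
    "(b, z) \<in> clus \<omega> (rect a b c d) x" "z \<in> J" "clus \<omega> (rect a b c d) x \<subseteq> rect a b c d"
proof -
  obtain x where x: "x \<in> rect a b c d"
    "\<forall>U\<in>{{a} \<times> I, {b} \<times> J}. \<exists>u\<in>U. u \<in> clus \<omega> (rect a b c d) x"
    using assms unfolding Arm_def by (rule cluster_meetsE)
  have "(\<exists>u\<in>{a} \<times> I. u \<in> clus \<omega> (rect a b c d) x) \<and> (\<exists>u\<in>{b} \<times> J. u \<in> clus \<omega> (rect a b c d) x)"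
    using x(2) by simp
  then obtain y z where "y \<in> I" "(a, y) \<in> clus \<omega> (rect a b c d) x" "z \<in> J" "(b, z) \<in> clus \<omega> (rect a b c d) x"
    unfolding bex_col by auto
  moreover have "\<omega> \<in> space config_space" using assms cluster_meets_sub_space by (auto simp: Arm_def)
  ultimately show thesis using that x(1) clus_sub[OF x(1)] by blast
qed

lemma vcrossE:
  assumes "\<omega> \<in> vcross a b c d"
  obtains x y z where "\<omega> \<in> space config_space" "x \<in> rect a b c d" "(y, c) \<in> clus \<omega> (rect a b c d) x"
    "(z, d) \<in> clus \<omega> (rect a b c d) x" "clus \<omega> (rect a b c d) x \<subseteq> rect a b c d"
proof -
  obtain x where x: "x \<in> rect a b c d"
    "\<forall>U\<in>{UNIV \<times> {c}, UNIV \<times> {d}}. \<exists>u\<in>U. u \<in> clus \<omega> (rect a b c d) x"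
    using assms unfolding vcross_def by (rule cluster_meetsE)
  have "(\<exists>u\<in>UNIV \<times> {c}. u \<in> clus \<omega> (rect a b c d) x) \<and> (\<exists>u\<in>UNIV \<times> {d}. u \<in> clus \<omega> (rect a b c d) x)"
    using x(2) by simp
  then obtain y z where "(y, c) \<in> clus \<omega> (rect a b c d) x" "(z, d) \<in> clus \<omega> (rect a b c d) x"
    unfolding bex_row by auto
  moreover have "\<omega> \<in> space config_space" using assms cluster_meets_sub_space by (auto simp: vcross_def)
  ultimately show thesis using that x(1) clus_sub[OF x(1)] by blast
qed

lemma ArchE:
  assumes "\<omega> \<in> Arch s t n g"
  defines "S \<equiv> rect s (s + 2 * n) (t - 2 * n) (t + 2 * n)"
  obtains x y1 y2 z1 z2 where "\<omega> \<in> space config_space" "x \<in> S"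
    "(s, y1) \<in> clus \<omega> S x" "t + g \<le> y1" "(s, y2) \<in> clus \<omega> S x" "y2 \<le> t - g"
    "(s + 2 * n, z1) \<in> clus \<omega> S x" "t + g \<le> z1" "(s + 2 * n, z2) \<in> clus \<omega> S x" "z2 \<le> t - g"
    "clus \<omega> S x \<subseteq> S"
proof -
  obtain x where x: "x \<in> S" "\<forall>U\<in>{{s} \<times> {t + g..}, {s} \<times> {..t - g},
      {s + 2 * n} \<times> {t + g..}, {s + 2 * n} \<times> {..t - g}}. \<exists>u\<in>U. u \<in> clus \<omega> S x"
    using assms(1) unfolding Arch_def S_def by (rule cluster_meetsE)
  have "(\<exists>u\<in>{s} \<times> {t + g..}. u \<in> clus \<omega> S x) \<and> (\<exists>u\<in>{s} \<times> {..t - g}. u \<in> clus \<omega> S x) \<and>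
    (\<exists>u\<in>{s + 2 * n} \<times> {t + g..}. u \<in> clus \<omega> S x) \<and> (\<exists>u\<in>{s + 2 * n} \<times> {..t - g}. u \<in> clus \<omega> S x)"
    using x(2) by simp
  then obtain y1 y2 z1 z2 where "(s, y1) \<in> clus \<omega> S x" "t + g \<le> y1" "(s, y2) \<in> clus \<omega> S x" "y2 \<le> t - g"
    "(s + 2 * n, z1) \<in> clus \<omega> S x" "t + g \<le> z1" "(s + 2 * n, z2) \<in> clus \<omega> S x" "z2 \<le> t - g"
    unfolding bex_col by auto
  moreover have "\<omega> \<in> space config_space" using assms(1) cluster_meets_sub_space by (auto simp: Arch_def)
  ultimately show thesis using that x(1) clus_sub[OF x(1)] by blast
qed

lemma ArchI:
  fixes s t n g :: int
  defines "S \<equiv> rect s (s + 2 * n) (t - 2 * n) (t + 2 * n)"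
  assumes "\<omega> \<in> space config_space" "T \<subseteq> S" "x \<in> T"
    "(s, y1) \<in> clus \<omega> T x" "t + g \<le> y1" "(s, y2) \<in> clus \<omega> T x" "y2 \<le> t - g"
    "(s + 2 * n, z1) \<in> clus \<omega> T x" "t + g \<le> z1" "(s + 2 * n, z2) \<in> clus \<omega> T x" "z2 \<le> t - g"
  shows "\<omega> \<in> Arch s t n g"
  unfolding Arch_def S_def[symmetric] using assms(2)
proof (rule cluster_meetsI)
  show "x \<in> S" using assms(3,4) by auto
  have m: "clus \<omega> T x \<subseteq> clus \<omega> S x" by (rule clus_mono[OF assms(3)])
  fix U assume "U \<in> {{s} \<times> {t + g..}, {s} \<times> {..t - g},
      {s + 2 * n} \<times> {t + g..}, {s + 2 * n} \<times> {..t - g}}"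
  then consider "U = {s} \<times> {t + g..}" | "U = {s} \<times> {..t - g}" |
    "U = {s + 2 * n} \<times> {t + g..}" | "U = {s + 2 * n} \<times> {..t - g}" by auto
  then show "\<exists>u\<in>U. u \<in> clus \<omega> S x"
  proof cases
    case 1 with assms m show ?thesis by (intro bexI[of _ "(s, y1)"]) auto
  next
    case 2 with assms m show ?thesis by (intro bexI[of _ "(s, y2)"]) auto
  next
    case 3 with assms m show ?thesis by (intro bexI[of _ "(s + 2 * n, z1)"]) auto
  next
    case 4 with assms m show ?thesis by (intro bexI[of _ "(s + 2 * n, z2)"]) auto
  qed
qed

text \<open>The vertical crossing of the square meets every horizontal one, so all four arms lie in
  its cluster.\<close>

lemma arch_from_arms:
  assumes "\<omega> \<in> Arm 0 (2 * n) (- n) n UNIV {g..}" "\<omega> \<in> Arm 0 (2 * n) (- n) n UNIV {..- g}"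
    "\<omega> \<in> Arm 0 (2 * n) (- n) n {g..} UNIV" "\<omega> \<in> Arm 0 (2 * n) (- n) n {..- g} UNIV"
    "\<omega> \<in> vcross 0 (2 * n) (- n) n"
  shows "\<omega> \<in> Arch 0 0 n g"
proof -
  let ?S = "rect 0 (2 * n) (- n) n"
  obtain x p q where x: "\<omega> \<in> space config_space" "x \<in> ?S" "(p, - n) \<in> clus \<omega> ?S x" "(q, n) \<in> clus \<omega> ?S x"
    "clus \<omega> ?S x \<subseteq> ?S" using assms(5) by (rule vcrossE)
  have *: "\<exists>y z. y \<in> I \<and> z \<in> J \<and> (0, y) \<in> clus \<omega> ?S x \<and> (2 * n, z) \<in> clus \<omega> ?S x"
    if arm: "\<omega> \<in> Arm 0 (2 * n) (- n) n I J" for I J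
  proof -
    obtain w y z where w: "w \<in> ?S" "(0, y) \<in> clus \<omega> ?S w" "y \<in> I" "(2 * n, z) \<in> clus \<omega> ?S w" "z \<in> J"
      "clus \<omega> ?S w \<subseteq> ?S" using arm by (rule ArmE)
    have col: "0 \<le> fst s \<and> fst s \<le> 2 * n" if "s \<in> clus \<omega> ?S x" for s
      using subsetD[OF x(5) that] by (simp add: rect_iff')
    have "clus \<omega> ?S w \<inter> clus \<omega> ?S x \<noteq> {}"
      by (rule HV_cross[OF lattice_connected_clus w(6) w(2,4) lattice_connected_clus col x(3) _ x(4)]) simp_all
    from clus_meet[OF this, of ?S] have "clus \<omega> ?S x \<subseteq> clus \<omega> ?S w" by simp
    then have "x \<in> clus \<omega> ?S w" by auto
    then have "clus \<omega> ?S x = clus \<omega> ?S w" by (rule clus_eq)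
    then show ?thesis using w by auto
  qed
  obtain z1 z2 y1 y2 where "z1 \<ge> g" "(2 * n, z1) \<in> clus \<omega> ?S x" "z2 \<le> - g" "(2 * n, z2) \<in> clus \<omega> ?S x"
    "y1 \<ge> g" "(0, y1) \<in> clus \<omega> ?S x" "y2 \<le> - g" "(0, y2) \<in> clus \<omega> ?S x"
    using *[OF assms(1)] *[OF assms(2)] *[OF assms(3)] *[OF assms(4)]
    unfolding atLeast_iff atMost_iff by blast
  moreover have "0 \<le> n" using x(2) by (simp add: rect_iff')
  then have "?S \<subseteq> rect 0 (0 + 2 * n) (0 - 2 * n) (0 + 2 * n)" unfolding rect_def by auto
  ultimately show ?thesis using x(1,2) by (intro ArchI[of \<omega> ?S 0 n 0 x y1 g y2 z1 z2]) simp_all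
qed

text \<open>The arms overlap in the columns from \<open>m - 2 * n\<close> to \<open>m\<close>,
  exactly the width of the arch. Each arm has an end in the gap on one side of the arch and
  therefore meets it, so the three clusters join to the length \<open>2 * m - 2 * n\<close>.\<close>

lemma arms_and_arch_crossing:
  assumes p: "\<omega> \<in> Arm 0 m c d UNIV {z - g..z + g}" and q: "\<omega> \<in> Arm (m - 2 * n) (2 * m - 2 * n) c d {z - g..z + g} UNIV"
    and arch: "\<omega> \<in> Arch (m - 2 * n) z n g" and n: "0 \<le> n" "2 * n \<le> m"
    and R: "c' \<le> c" "c' \<le> z - 2 * n" "d \<le> d'" "z + 2 * n \<le> d'"
  shows "\<omega> \<in> hcross 0 (2 * m - 2 * n) c' d'"
proof -
  let ?R = "rect 0 (2 * m - 2 * n) c' d'" and ?S = "rect 0 m c d" and ?S' = "rect (m - 2 * n) (2 * m - 2 * n) c d"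
  let ?T = "rect (m - 2 * n) (m - 2 * n + 2 * n) (z - 2 * n) (z + 2 * n)"
  obtain u y1 y2 where u: "\<omega> \<in> space config_space" "u \<in> ?S" "(0, y1) \<in> clus \<omega> ?S u" "(m, y2) \<in> clus \<omega> ?S u"
    "y2 \<in> {z - g..z + g}" "clus \<omega> ?S u \<subseteq> ?S" using p by (rule ArmE)
  obtain v z1 z2 where v: "v \<in> ?S'" "(m - 2 * n, z1) \<in> clus \<omega> ?S' v" "z1 \<in> {z - g..z + g}"
    "(2 * m - 2 * n, z2) \<in> clus \<omega> ?S' v" "clus \<omega> ?S' v \<subseteq> ?S'" using q by (rule ArmE)
  obtain w a1 a2 b1 b2 where w: "w \<in> ?T"
    "(m - 2 * n, a1) \<in> clus \<omega> ?T w" "z + g \<le> a1" "(m - 2 * n, a2) \<in> clus \<omega> ?T w" "a2 \<le> z - g"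
    "(m - 2 * n + 2 * n, b1) \<in> clus \<omega> ?T w" "z + g \<le> b1" "(m - 2 * n + 2 * n, b2) \<in> clus \<omega> ?T w" "b2 \<le> z - g"
    "clus \<omega> ?T w \<subseteq> ?T" using arch by (rule ArchE)
  have colS: "0 \<le> fst s \<and> fst s \<le> m" if "s \<in> clus \<omega> ?S u" for s using subsetD[OF u(6) that] by (simp add: rect_iff')
  have colS': "m - 2 * n \<le> fst s \<and> fst s \<le> 2 * m - 2 * n" if "s \<in> clus \<omega> ?S' v" for s
    using subsetD[OF v(5) that] by (simp add: rect_iff')
  have colT: "m - 2 * n \<le> fst s \<and> fst s \<le> m" if "s \<in> clus \<omega> ?T w" for s
    using subsetD[OF w(10) that] by (simp add: rect_iff')
  have fin: "finite (clus \<omega> ?S u)" "finite (clus \<omega> ?S' v)" using u(6) v(5) finite_rect finite_subset by blast+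
  have w': "(m, b1) \<in> clus \<omega> ?T w" "(m, b2) \<in> clus \<omega> ?T w" using w(6,8) by simp_all
  have colT1: "0 \<le> fst s \<and> fst s \<le> m" if "s \<in> clus \<omega> ?T w" for s using colT[OF that] n by linarith
  have colT2: "m - 2 * n \<le> fst s \<and> fst s \<le> 2 * m - 2 * n" if "s \<in> clus \<omega> ?T w" for s
    using colT[OF that] n by linarith
  have le: "b2 \<le> y2" "y2 \<le> b1" "a2 \<le> z1" "z1 \<le> a1" using u(5) v(3) w(3,5,7,9) by auto
  have 1: "clus \<omega> ?S u \<inter> clus \<omega> ?T w \<noteq> {}"
    by (rule gap_cross[OF lattice_connected_clus colS u(3,4) fin(1) lattice_connected_clus colT1 w'(2,1) le(1,2)])
  have 2: "clus \<omega> ?S' v \<inter> clus \<omega> ?T w \<noteq> {}"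
    by (rule gap_cross_left[OF lattice_connected_clus colS' v(2,4) fin(2) lattice_connected_clus colT2 w(4) w(2) le(3,4)])
  have sub: "?S \<subseteq> ?R" "?S' \<subseteq> ?R" "?T \<subseteq> ?R" using n R unfolding rect_def by (intro Sigma_mono; auto)+
  have 3: "clus \<omega> ?T w \<subseteq> clus \<omega> ?R u" by (rule clus_meet[OF 1 sub(1,3)])
  have "clus \<omega> ?R w = clus \<omega> ?R u"
    by (rule clus_eq) (use 3 in auto)
  moreover have "clus \<omega> ?S' v \<subseteq> clus \<omega> ?R w" by (rule clus_meet[OF _ sub(3,2)]) (use 2 in auto)
  ultimately have "(2 * m - 2 * n, z2) \<in> clus \<omega> ?R u" using v(4) by auto
  moreover have "(0, y1) \<in> clus \<omega> ?R u" by (rule clus_monoD[OF u(3) sub(1)])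
  ultimately show ?thesis using u(1,2) sub(1) by (intro ArmI[of \<omega> u]) auto
qed

text \<open>At spacing \<open>2 * g\<close>, each arch reaches on the right at least the height to
  which the next one descends there, while on the left it has a point below the next one; so
  consecutive arches cross. A larger gap needs fewer arches.\<close>

lemma arch_chain:
  assumes arch: "\<And>i. i \<le> k \<Longrightarrow> \<omega> \<in> Arch 0 (2 * g * int i) n g" and n: "0 \<le> n" "0 \<le> g" "0 \<le> h" "h \<le> 2 * g * int k"
  shows "\<omega> \<in> vcross 0 (2 * n) 0 h"
proof -
  define S where "S i = rect 0 (0 + 2 * n) (2 * g * int i - 2 * n) (2 * g * int i + 2 * n)" for i
  have "\<forall>i. \<exists>x. i \<le> k \<longrightarrow> x \<in> S i \<and> (\<exists>y1 y2 z1 z2.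
    (0, y1) \<in> clus \<omega> (S i) x \<and> 2 * g * int i + g \<le> y1 \<and> (0, y2) \<in> clus \<omega> (S i) x \<and> y2 \<le> 2 * g * int i - g \<and>
    (2 * n, z1) \<in> clus \<omega> (S i) x \<and> 2 * g * int i + g \<le> z1 \<and> (2 * n, z2) \<in> clus \<omega> (S i) x \<and> z2 \<le> 2 * g * int i - g)"
  proof
    fix i show "\<exists>x. i \<le> k \<longrightarrow> x \<in> S i \<and> (\<exists>y1 y2 z1 z2.
    (0, y1) \<in> clus \<omega> (S i) x \<and> 2 * g * int i + g \<le> y1 \<and> (0, y2) \<in> clus \<omega> (S i) x \<and> y2 \<le> 2 * g * int i - g \<and>
    (2 * n, z1) \<in> clus \<omega> (S i) x \<and> 2 * g * int i + g \<le> z1 \<and> (2 * n, z2) \<in> clus \<omega> (S i) x \<and> z2 \<le> 2 * g * int i - g)"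
    proof (cases "i \<le> k")
      case True
      show ?thesis by (rule ArchE[OF arch[OF True]]) (simp add: S_def, blast)
    qed simp
  qed
  then obtain x where x: "\<forall>i. i \<le> k \<longrightarrow> x i \<in> S i \<and> (\<exists>y1 y2 z1 z2.
    (0, y1) \<in> clus \<omega> (S i) (x i) \<and> 2 * g * int i + g \<le> y1 \<and> (0, y2) \<in> clus \<omega> (S i) (x i) \<and> y2 \<le> 2 * g * int i - g \<and>
    (2 * n, z1) \<in> clus \<omega> (S i) (x i) \<and> 2 * g * int i + g \<le> z1 \<and> (2 * n, z2) \<in> clus \<omega> (S i) (x i) \<and> z2 \<le> 2 * g * int i - g)"
    unfolding choice_iff by (rule exE)
  have sub: "clus \<omega> (S i) (x i) \<subseteq> S i" if "i \<le> k" for i using x that clus_sub by blast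
  have col: "0 \<le> fst s \<and> fst s \<le> 2 * n" if "i \<le> k" "s \<in> clus \<omega> (S i) (x i)" for i s
    using subsetD[OF sub[OF that(1)] that(2)] by (simp add: S_def rect_iff')
  define R where "R = rect 0 (2 * n) (- 2 * n) (2 * g * int k + 2 * n)"
  have SR: "S i \<subseteq> R" if "i \<le> k" for i
  proof -
    have "0 \<le> 2 * g * int i" "2 * g * int i \<le> 2 * g * int k" using that n by (auto intro!: mult_left_mono)
    then show ?thesis by (auto simp: S_def R_def rect_iff')
  qed
  have meet: "clus \<omega> (S i) (x i) \<inter> clus \<omega> (S (Suc i)) (x (Suc i)) \<noteq> {}" if i: "i < k" for i
  proof -
    from i have ik: "i \<le> k" "Suc i \<le> k" by auto
    obtain y2 z1 where 1: "(0, y2) \<in> clus \<omega> (S i) (x i)" "y2 \<le> 2 * g * int i - g"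
      "(2 * n, z1) \<in> clus \<omega> (S i) (x i)" "2 * g * int i + g \<le> z1" using x ik(1) by blast
    obtain y1 z2 where 2: "(0, y1) \<in> clus \<omega> (S (Suc i)) (x (Suc i))" "2 * g * int (Suc i) + g \<le> y1"
      "(2 * n, z2) \<in> clus \<omega> (S (Suc i)) (x (Suc i))" "z2 \<le> 2 * g * int (Suc i) - g" using x ik(2) by blast
    have f: "finite (clus \<omega> (S i) (x i))" using finite_subset[OF sub[OF ik(1)]] by (simp add: S_def)
    have "2 * g * int (Suc i) = 2 * g * int i + 2 * g" by (simp add: algebra_simps)
    then have "y2 \<le> y1" "z2 \<le> z1" using 1 2 n by linarith+
    then show ?thesis
      by (intro strip_cross[OF lattice_connected_clus col[OF ik(1)] 1(1,3) f lattice_connected_clus col[OF ik(2)] 2(1,3)])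
  qed
  have ch: "clus \<omega> (S i) (x i) \<subseteq> clus \<omega> R (x 0)" if "i \<le> k" for i
    by (rule clus_chain[of k \<omega> S x R, OF meet SR that])
  obtain y2 where y2: "(0, y2) \<in> clus \<omega> (S 0) (x 0)" "y2 \<le> 0 - g" using x by fastforce
  obtain y1 where y1: "(0, y1) \<in> clus \<omega> (S k) (x k)" "2 * g * int k + g \<le> y1" using x by blast
  have x0: "x 0 \<in> R" using x SR by blast
  have "clus \<omega> R (0, y2) = clus \<omega> R (x 0)" by (rule clus_eq) (use ch y2 in blast)
  then have c1: "(0, y1) \<in> clus \<omega> R (0, y2)" using ch y1 by blast
  have "(0, y2) \<in> R" using sub[of 0] SR[of 0] y2 by blast
  then obtain u' v' where uv: "u' \<in> R" "snd u' = 0" "snd v' = h"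
    "v' \<in> clus \<omega> (R \<inter> {w. 0 \<le> snd w \<and> snd w \<le> h}) u'"
    by (rule clus_shrink[OF c1 _ lattice_lipschitz_snd, of 0 h]) (use y1 y2 n in simp_all)
  have R': "R \<inter> {w. 0 \<le> snd w \<and> snd w \<le> h} \<subseteq> rect 0 (2 * n) 0 h" by (auto simp: R_def rect_iff')
  have v': "v' \<in> clus \<omega> (rect 0 (2 * n) 0 h) u'" using uv(4) clus_mono[OF R'] by blast
  show ?thesis unfolding vcross_def
  proof (rule cluster_meetsI)
    show "\<omega> \<in> space config_space" by (rule increasing_space[OF arch[of 0] increasing_Arch]) simp
    show "u' \<in> rect 0 (2 * n) 0 h" using uv n by (auto simp: R_def rect_iff')
    fix U :: "vertex set" assume "U \<in> {UNIV \<times> {0}, UNIV \<times> {h}}"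
    then consider "U = (UNIV :: int set) \<times> {0}" | "U = (UNIV :: int set) \<times> {h}" by auto
    then show "\<exists>u\<in>U. u \<in> clus \<omega> (rect 0 (2 * n) 0 h) u'"
    proof cases
      case 1 with uv(2) show ?thesis by (intro bexI[of _ u']) (auto simp: mem_Times_iff)
    next
      case 2 with uv(3) v' show ?thesis by (intro bexI[of _ v']) (auto simp: mem_Times_iff)
    qed
  qed
qed

text \<open>Neighbouring rectangles of size \<open>6 * n\<close> by \<open>5 * n\<close> are offset
  by \<open>n\<close> and overlap in a square of side \<open>5 * n\<close>, whose vertical crossing
  meets both horizontal ones.\<close>

lemma long_crossing_at:
  assumes H: "\<And>i. i \<le> k \<Longrightarrow> \<omega> \<in> hcross (int i * n) (int i * n + 6 * n) t (t + 5 * n)"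
    and V: "\<And>i. i \<le> k \<Longrightarrow> \<omega> \<in> vcross (int i * n) (int i * n + 5 * n) t (t + 5 * n)" and n: "0 \<le> n"
  shows "\<omega> \<in> hcross 0 ((6 + int k) * n) t (t + 5 * n)"
proof -
  define S where "S i = rect (int i * n) (int i * n + 6 * n) t (t + 5 * n)" for i
  define T where "T i = rect (int i * n) (int i * n + 5 * n) t (t + 5 * n)" for i
  define R where "R = rect 0 ((6 + int k) * n) t (t + 5 * n)"
  have "\<forall>i. \<exists>x. i \<le> k \<longrightarrow> x \<in> S i \<and> (\<exists>y z. (int i * n, y) \<in> clus \<omega> (S i) x \<and> (int i * n + 6 * n, z) \<in> clus \<omega> (S i) x)"
  proof
    fix i show "\<exists>x. i \<le> k \<longrightarrow> x \<in> S i \<and> (\<exists>y z. (int i * n, y) \<in> clus \<omega> (S i) x \<and> (int i * n + 6 * n, z) \<in> clus \<omega> (S i) x)"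
    proof (cases "i \<le> k")
      case True
      show ?thesis by (rule ArmE[OF H[OF True]]) (simp add: S_def, blast)
    qed simp
  qed
  then obtain x where x: "\<forall>i. i \<le> k \<longrightarrow> x i \<in> S i \<and> (\<exists>y z. (int i * n, y) \<in> clus \<omega> (S i) (x i) \<and>
      (int i * n + 6 * n, z) \<in> clus \<omega> (S i) (x i))"
    unfolding choice_iff by (rule exE)
  have SR: "S i \<subseteq> R" "T i \<subseteq> R" if "i \<le> k" for i
  proof -
    have "0 \<le> int i * n" "int i * n \<le> int k * n" using that n by (auto intro!: mult_right_mono)
    moreover have "(6 + int k) * n = 6 * n + int k * n" by (simp add: algebra_simps)
    ultimately show "S i \<subseteq> R" "T i \<subseteq> R"
      using n unfolding S_def T_def R_def rect_def by (intro Sigma_mono; simp)+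
  qed
  have sub: "clus \<omega> (S i) (x i) \<subseteq> S i" if "i \<le> k" for i using x that clus_sub by blast
  have next': "clus \<omega> R (x (Suc i)) = clus \<omega> R (x i)" if i: "i < k" for i
  proof -
    from i have ik: "i \<le> k" "Suc i \<le> k" by auto
    obtain v y z where v: "v \<in> T (Suc i)" "(y, t) \<in> clus \<omega> (T (Suc i)) v" "(z, t + 5 * n) \<in> clus \<omega> (T (Suc i)) v"
      "clus \<omega> (T (Suc i)) v \<subseteq> T (Suc i)" by (rule vcrossE[OF V[OF ik(2)]]) (simp add: T_def)
    have colV: "int (Suc i) * n \<le> fst s \<and> fst s \<le> int (Suc i) * n + 5 * n" if "s \<in> clus \<omega> (T (Suc i)) v" for s
      using subsetD[OF v(4) that] by (simp add: T_def rect_iff')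
    have e: "int (Suc i) * n = int i * n + n" by (simp add: algebra_simps)
    have m: "clus \<omega> (S j) (x j) \<inter> clus \<omega> (T (Suc i)) v \<noteq> {}" if j: "j = i \<or> j = Suc i" for j
    proof -
      have jk: "j \<le> k" using j ik by auto
      obtain a b where ab: "(int j * n, a) \<in> clus \<omega> (S j) (x j)" "(int j * n + 6 * n, b) \<in> clus \<omega> (S j) (x j)"
        using x jk by blast
      have sj: "clus \<omega> (S j) (x j) \<subseteq> rect (int j * n) (int j * n + 6 * n) t (t + 5 * n)" using sub[OF jk] by (simp add: S_def)
      have cj: "int j * n \<le> fst s \<and> fst s \<le> int j * n + 6 * n" if "s \<in> clus \<omega> (T (Suc i)) v" for s
        using colV[OF that] j e n by auto
      show ?thesis
        by (rule HV_cross[OF lattice_connected_clus sj ab lattice_connected_clus cj v(2) _ v(3)]) auto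
    qed
    have 1: "clus \<omega> (T (Suc i)) v \<subseteq> clus \<omega> R (x j)" if "j = i \<or> j = Suc i" for j
    proof -
      have "j \<le> k" using that ik by auto
      from clus_meet[OF m[OF that] SR(1)[OF this] SR(2)[OF ik(2)]] show ?thesis .
    qed
    have "clus \<omega> R v = clus \<omega> R (x j)" if "j = i \<or> j = Suc i" for j
      by (rule clus_eq) (use 1[OF that] in auto)
    then show ?thesis by metis
  qed
  have eq: "i \<le> k \<Longrightarrow> clus \<omega> R (x i) = clus \<omega> R (x 0)" for i
    by (induction i) (use next' in auto)
  obtain y where y: "(0, y) \<in> clus \<omega> (S 0) (x 0)" using x by fastforce
  obtain z where z: "(int k * n + 6 * n, z) \<in> clus \<omega> (S k) (x k)" using x by blast
  have y': "(0, y) \<in> clus \<omega> R (x 0)" by (rule clus_monoD[OF y SR(1)]) simp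
  have z': "((6 + int k) * n, z) \<in> clus \<omega> R (x 0)"
    using clus_monoD[OF z SR(1)] eq[of k] by (simp add: algebra_simps)
  have "x 0 \<in> R" using x SR(1)[of 0] by blast
  moreover have "\<omega> \<in> space config_space" by (rule increasing_space[OF H[of 0] increasing_Arm]) simp
  ultimately show ?thesis using y' z' unfolding R_def by (intro ArmI[of \<omega> "x 0" _ _ _ _ y _ z]) auto
qed

lemma long_crossing:
  assumes "\<And>i. i \<le> k \<Longrightarrow> \<omega> \<in> hcross (int i * n) (int i * n + 6 * n) 0 (5 * n)"
    "\<And>i. i \<le> k \<Longrightarrow> \<omega> \<in> vcross (int i * n) (int i * n + 5 * n) 0 (5 * n)" "0 \<le> n"
  shows "\<omega> \<in> hcross 0 ((6 + int k) * n) 0 (5 * n)"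
  using long_crossing_at[of k \<omega> n 0] assms by simp

section \<open>FKG for finite lists of events\<close>

lemma increasing_UNIV: "increasing_event (space config_space)"
  by (simp add: increasing_event_def)

lemma increasing_Int:
  assumes "increasing_event A" "increasing_event B" shows "increasing_event (A \<inter> B)"
  using assms unfolding increasing_event_def by blast

lemma increasing_Un:
  assumes "increasing_event A" "increasing_event B" shows "increasing_event (A \<union> B)"
  using assms unfolding increasing_event_def by blast

text \<open>Membership in the space gives the empty list an event of probability 1, as inductions
  over the list require.\<close>

definition Conj :: "config set list \<Rightarrow> config set" where
  "Conj Es = {\<omega> \<in> space config_space. \<forall>E\<in>set Es. \<omega> \<in> E}"

lemma Conj_simps: "Conj [] = space config_space" "Conj (E # Es) = E \<inter> Conj Es"
  if "E \<subseteq> space config_space"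
  using that by (auto simp: Conj_def)

lemma Conj_Nil: "Conj [] = space config_space" by (simp add: Conj_def)

lemma ConjD: "\<omega> \<in> Conj Es \<Longrightarrow> E \<in> set Es \<Longrightarrow> \<omega> \<in> E"
  by (simp add: Conj_def)

lemma sets_Conj:
  assumes "\<And>E. E \<in> set Es \<Longrightarrow> E \<in> sets config_space" shows "Conj Es \<in> sets config_space"
  using assms
proof (induction Es)
  case (Cons E Es)
  have "E \<subseteq> space config_space" using Cons.prems[of E] sets.sets_into_space by simp
  then show ?case using Cons by (simp add: Conj_simps)
qed (simp add: Conj_Nil)

lemma increasing_Conj:
  assumes "\<And>E. E \<in> set Es \<Longrightarrow> increasing_event E" shows "increasing_event (Conj Es)"
  using assms
proof (induction Es)
  case (Cons E Es)
  have "E \<subseteq> space config_space" using Cons.prems[of E] increasing_sub_space by simp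
  then show ?case using Cons by (simp add: Conj_simps increasing_Int)
qed (simp add: Conj_Nil increasing_UNIV)

lemma translation_column: "translation (s, t) ` ({x} \<times> K) = {x + s} \<times> (\<lambda>y. y + t) ` K"
proof -
  have "{x} \<times> K = Pair x ` K" for x :: int and K :: "int set" by auto
  then show ?thesis by (simp add: image_image translation_def)
qed

context perc
begin

lemma prob_mono: "A \<subseteq> B \<Longrightarrow> B \<in> sets config_space \<Longrightarrow> prob A \<le> prob B"
  by (rule finite_measure_mono) (simp_all add: events_eq)

lemma FKG_prod:
  assumes "\<And>E. E \<in> set Es \<Longrightarrow> increasing_event E"
  shows "(\<Prod>E\<leftarrow>Es. prob E) \<le> prob (Conj Es)"
  using assms
proof (induction Es)
  case Nil
  then show ?case using prob_space by (simp add: Conj_Nil space_M[symmetric])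
next
  case (Cons E Es)
  have E: "increasing_event E" using Cons.prems by simp
  have "(\<Prod>E\<leftarrow>E # Es. prob E) \<le> prob E * prob (Conj Es)"
    using Cons by (simp add: mult_left_mono)
  also have "\<dots> \<le> prob (E \<inter> Conj Es)"
    by (rule FKG[OF E increasing_Conj]) (use Cons.prems in simp)
  finally show ?case using increasing_sub_space[OF E] by (simp add: Conj_simps)
qed

lemma FKG_pow:
  assumes "\<And>E. E \<in> set Es \<Longrightarrow> increasing_event E" "\<And>E. E \<in> set Es \<Longrightarrow> c \<le> prob E" "0 \<le> c"
  shows "c ^ length Es \<le> prob (Conj Es)"
proof -
  have "c ^ length Es \<le> (\<Prod>E\<leftarrow>Es. prob E)"
    using assms(2) by (induction Es) (auto intro!: mult_mono assms(3) zero_le_power)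
  also have "\<dots> \<le> prob (Conj Es)" by (rule FKG_prod[OF assms(1)])
  finally show ?thesis .
qed

text \<open>The square-root trick: complements of increasing events are positively correlated too.
  It is used to conclude that if \<open>A\<close> is likely and covered by a few events, then one of
  these is likely.\<close>

lemma FKG_cover:
  assumes "\<And>E. E \<in> set Es \<Longrightarrow> increasing_event E" "A \<subseteq> \<Union>(set Es)"
  shows "(\<Prod>E\<leftarrow>Es. 1 - prob E) \<le> 1 - prob A"
proof -
  have "\<Union>(set Es) \<in> sets config_space \<and> (\<Prod>E\<leftarrow>Es. 1 - prob E) \<le> 1 - prob (\<Union>(set Es)) \<and>
    increasing_event (\<Union>(set Es))"
    using assms(1)
  proof (induction Es)
    case Nil
    then show ?case by (simp add: increasing_event_def)
  next
    case (Cons E Es)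
    let ?U = "\<Union>(set Es)"
    have E: "increasing_event E" and U: "?U \<in> sets config_space" "increasing_event ?U"
      "(\<Prod>E\<leftarrow>Es. 1 - prob E) \<le> 1 - prob ?U" using Cons by auto
    have ev: "E \<in> events" "?U \<in> events" using E U by (simp_all add: events_eq increasing_sets)
    have "prob E * prob ?U \<le> prob (E \<inter> ?U)" by (rule FKG[OF E U(2)])
    moreover have "prob (E \<union> ?U) = prob E + prob ?U - prob (E \<inter> ?U)"
      using finite_measure_Union'[OF ev] finite_measure_Diff'[OF ev(2,1)] by (simp add: Int_commute)
    ultimately have "(1 - prob E) * (1 - prob ?U) \<le> 1 - prob (E \<union> ?U)" by (simp add: algebra_simps)
    moreover have "(1 - prob E) * (\<Prod>E\<leftarrow>Es. 1 - prob E) \<le> (1 - prob E) * (1 - prob ?U)"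
      using U(3) by (intro mult_left_mono) simp_all
    moreover have "\<Union>(set (E # Es)) = E \<union> ?U" by simp
    ultimately show ?case using increasing_Un[OF E U(2)] increasing_sets by simp
  qed
  moreover have "prob A \<le> prob (\<Union>(set Es))" using calculation assms(2) by (intro prob_mono) auto
  ultimately show ?thesis by linarith
qed

lemma FKG_cover_pow:
  assumes "\<And>E. E \<in> set Es \<Longrightarrow> increasing_event E" "A \<subseteq> \<Union>(set Es)" "\<And>E. E \<in> set Es \<Longrightarrow> d \<le> 1 - prob E" "0 \<le> d"
  shows "d ^ length Es \<le> 1 - prob A"
proof -
  have "d ^ length Es \<le> (\<Prod>E\<leftarrow>Es. 1 - prob E)"
    using assms(3) by (induction Es) (auto intro!: mult_mono assms(4) zero_le_power)
  with FKG_cover[OF assms(1,2)] show ?thesis by linarith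
qed

lemma Arm_translate:
  "prob (Arm (a + s) (b + s) (c + t) (d + t) ((\<lambda>y. y + t) ` I) ((\<lambda>y. y + t) ` J)) = prob (Arm a b c d I J)"
proof -
  show ?thesis
    using cluster_meets_translation[of "{{a} \<times> I, {b} \<times> J}" "(s, t)" "rect a b c d"]
    by (simp add: Arm_def translation_rect translation_column)
qed

lemma Arm_shift:
  assumes "a' = a + s" "b' = b + s" "c' = c + t" "d' = d + t" "I' = (\<lambda>y. y + t) ` I" "J' = (\<lambda>y. y + t) ` J"
  shows "prob (Arm a' b' c' d' I' J') = prob (Arm a b c d I J)"
  unfolding assms by (rule Arm_translate)

lemma Arm_negx: "prob (Arm (- b) (- a) c d J I) = prob (Arm a b c d I J)"
proof -
  have "negx ` ({x} \<times> K) = {- x} \<times> K" for x K by (force simp: negx_def)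
  then show ?thesis
    using cluster_meets_negx[of "{{a} \<times> I, {b} \<times> J}" "rect a b c d"]
    by (simp add: Arm_def negx_rect insert_commute)
qed

lemma Arm_negy: "prob (Arm a b (- d) (- c) (uminus ` I) (uminus ` J)) = prob (Arm a b c d I J)"
proof -
  have 1: "prod.swap ` ({x} \<times> K) = K \<times> {x}" "prod.swap ` (K \<times> {x}) = {x} \<times> K" for x :: int and K :: "int set"
    by auto
  have 2: "negx ` (K \<times> {x}) = uminus ` K \<times> {x}" for x K by (force simp: negx_def)
  have "prob (cluster_meets (rect a b (- d) (- c)) {{a} \<times> uminus ` I, {b} \<times> uminus ` J}) =
      prob (cluster_meets (rect (- d) (- c) a b) {uminus ` I \<times> {a}, uminus ` J \<times> {b}})"
    using cluster_meets_swap[of "{uminus ` I \<times> {a}, uminus ` J \<times> {b}}" "rect (- d) (- c) a b"] by (simp add: swap_rect 1)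
  also have "\<dots> = prob (cluster_meets (rect c d a b) {I \<times> {a}, J \<times> {b}})"
    using cluster_meets_negx[of "{I \<times> {a}, J \<times> {b}}" "rect c d a b"] by (simp add: negx_rect 2)
  also have "\<dots> = prob (cluster_meets (rect a b c d) {{a} \<times> I, {b} \<times> J})"
    using cluster_meets_swap[of "{{a} \<times> I, {b} \<times> J}" "rect a b c d"] by (simp add: swap_rect 1)
  finally show ?thesis by (simp add: Arm_def)
qed

lemma vcross_hcross: "prob (vcross a b c d) = prob (hcross c d a b)"
proof -
  have "prod.swap ` ({x} \<times> (UNIV :: int set)) = UNIV \<times> {x}" for x :: int by auto
  then show ?thesis
    using cluster_meets_swap[of "{{c} \<times> UNIV, {d} \<times> UNIV}" "rect c d a b"] by (simp add: Arm_def vcross_def swap_rect)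
qed

lemma hcross_eq:
  assumes "b' - a' = b - a" "d' - c' = d - c"
  shows "prob (hcross a' b' c' d') = prob (hcross a b c d)"
proof (rule Arm_shift[where s = "a' - a" and t = "c' - c"])
  show "UNIV = (\<lambda>y. y + (c' - c)) ` UNIV" by (rule surj_plus_right[symmetric])
qed (use assms in simp_all)

lemma Arch_eq: "prob (Arch s t n g) = prob (Arch 0 0 n g)"
proof -
  have 2: "(\<lambda>y. y + t) ` {g..} = {g + t..}" "(\<lambda>y. y + t) ` {..h} = {..h + t}" for g h
    using image_add_atLeast[of t g] image_add_atMost[of t h] by (simp_all add: add.commute)
  show ?thesis
    using cluster_meets_translation[of "{{0} \<times> {g..}, {0} \<times> {..- g}, {2 * n} \<times> {g..}, {2 * n} \<times> {..- g}}" "(s, t)"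
        "rect 0 (2 * n) (- 2 * n) (2 * n)"]
    by (simp add: Arch_def translation_rect translation_column 2 add.commute)
qed

lemma Arm_mono: "I \<subseteq> I' \<Longrightarrow> J \<subseteq> J' \<Longrightarrow> c' \<le> c \<Longrightarrow> d \<le> d' \<Longrightarrow> Arm a b c d I J \<subseteq> Arm a b c' d' I' J'"
  unfolding Arm_def by (rule cluster_meets_mono) (auto simp: rect_def)

text \<open>The reflections make all four arms equally likely; the fifth factor is the vertical
  crossing that joins them.\<close>

lemma square_arch:
  assumes H: "u \<le> prob (hcross 0 (2 * n) (- n) n)" and arm: "u \<le> prob (Arm 0 (2 * n) (- n) n UNIV {g..})" and u: "0 \<le> u"
  shows "u ^ 5 \<le> prob (Arch 0 0 n g)"
proof -
  let ?A = "\<lambda>I J. Arm 0 (2 * n) (- n) n I J"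
  have um: "uminus ` {g..} = {..- g}" "uminus ` UNIV = (UNIV :: int set)" for g :: int
    by (simp_all add: surj_uminus)
  have 1: "prob (?A I J) = prob (?A J I)" for I J
    using Arm_negx[of "2 * n" 0 "- n" n J I] Arm_shift[of 0 "- (2 * n)" "2 * n" "2 * n" 0 "- n" "- n" 0 n n J J I I]
    by simp
  have 2: "prob (?A UNIV {..- g}) = prob (?A UNIV {g..})"
    using Arm_negy[of 0 "2 * n" n "- n" UNIV "{g..}"] by (simp add: um)
  have 3: "prob (vcross 0 (2 * n) (- n) n) = prob (hcross 0 (2 * n) (- n) n)"
    unfolding vcross_hcross by (rule hcross_eq) simp_all
  let ?Es = "[?A UNIV {g..}, ?A UNIV {..- g}, ?A {g..} UNIV, ?A {..- g} UNIV, vcross 0 (2 * n) (- n) n]"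
  have "u ^ length ?Es \<le> prob (Conj ?Es)"
    by (rule FKG_pow) (use H arm u 2 3 1 in auto)
  also have "prob (Conj ?Es) \<le> prob (Arch 0 0 n g)"
    by (rule prob_mono) (auto simp: Conj_def intro: arch_from_arms)
  finally have "u ^ length ?Es \<le> prob (Arch 0 0 n g)" .
  moreover have "length ?Es = 5" by simp
  ultimately show ?thesis by metis
qed

lemma window_hard:
  assumes arch: "u \<le> prob (Arch 0 0 n g)" and w: "v \<le> prob (Arm 0 m c d UNIV {z - g..z + g})"
    and uv: "0 \<le> u" "0 \<le> v" and n: "0 \<le> n" "2 * n \<le> m"
    and R: "c' \<le> c" "c' \<le> z - 2 * n" "d \<le> d'" "z + 2 * n \<le> d'"
  shows "u * v * v \<le> prob (hcross 0 (2 * m - 2 * n) c' d')"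
proof -
  let ?p = "Arm 0 m c d UNIV {z - g..z + g}"
  let ?q = "Arm (m - 2 * n) (2 * m - 2 * n) c d {z - g..z + g} UNIV"
  let ?Es = "[Arch (m - 2 * n) z n g, ?p, ?q]"
  have "prob ?q = prob (Arm (- m) 0 c d {z - g..z + g} UNIV)"
    by (rule Arm_shift[where s = "2 * m - 2 * n" and t = 0]) simp_all
  also have "\<dots> = prob ?p" using Arm_negx[of m 0 c d "{z - g..z + g}" UNIV] by simp
  finally have q: "prob ?q = prob ?p" .
  have "u * v * v \<le> prob (Arch (m - 2 * n) z n g) * (prob ?p * prob ?q)"
    unfolding q Arch_eq[of "m - 2 * n" z] mult.assoc using arch w uv by (intro mult_mono) simp_all
  also have "\<dots> = (\<Prod>E\<leftarrow>?Es. prob E)" by simp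
  also have "\<dots> \<le> prob (Conj ?Es)" by (rule FKG_prod) auto
  also have "\<dots> \<le> prob (hcross 0 (2 * m - 2 * n) c' d')"
    by (rule prob_mono) (auto simp: Conj_def intro: arms_and_arch_crossing[OF _ _ _ n R])
  finally show ?thesis .
qed

text \<open>A gap comparable with the scale lets boundedly many stacked arches form a long
  crossing.\<close>

lemma arch_hard:
  assumes arch: "u \<le> prob (Arch 0 0 n g)" and u: "0 \<le> u" and n: "n < 48 * (g + 1)" "96 \<le> n"
  shows "u ^ 217 \<le> prob (hcross 0 (6 * n) 0 (5 * n))"
proof -
  have g: "2 \<le> g" using n by presburger
  \<comment> \<open>Since \<open>g\<close> is at least 2, \<open>g + 1\<close> is at most
    \<open>3 * g / 2\<close>, which turns 48 into 72. Then 216 steps of length \<open>2 * g\<close>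
    cover the height \<open>6 * n\<close>, so 217 arches suffice.\<close>
  then have "n \<le> 72 * g" using n by presburger
  then have h: "6 * n \<le> 2 * g * int 216" by simp
  let ?Es = "map (\<lambda>i. Arch 0 (2 * g * int i) n g) [0..<217]"
  have "u ^ length ?Es \<le> prob (Conj ?Es)"
  proof (rule FKG_pow)
    fix E assume "E \<in> set ?Es"
    then obtain i where E: "E = Arch 0 (2 * g * int i) n g" by auto
    show "u \<le> prob E" unfolding E Arch_eq[of 0 "2 * g * int i"] by (rule arch)
  qed (use u in auto)
  also have "\<dots> \<le> prob (vcross 0 (2 * n) 0 (6 * n))"
  proof (rule prob_mono)
    show "Conj ?Es \<subseteq> vcross 0 (2 * n) 0 (6 * n)"
    proof
      fix \<omega> assume w: "\<omega> \<in> Conj ?Es"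
      have "\<omega> \<in> Arch 0 (2 * g * int i) n g" if "i \<le> 216" for i
        by (rule ConjD[OF w]) (use that in auto)
      then show "\<omega> \<in> vcross 0 (2 * n) 0 (6 * n)"
        by (rule arch_chain[of 216, OF _ _ _ _ h]) (use n g in auto)
    qed
  qed simp
  also have "\<dots> \<le> prob (vcross 0 (5 * n) 0 (6 * n))"
  proof (rule prob_mono)
    show "vcross 0 (2 * n) 0 (6 * n) \<subseteq> vcross 0 (5 * n) 0 (6 * n)"
      unfolding vcross_def by (rule cluster_meets_mono) (use n in \<open>auto simp: rect_def\<close>)
  qed simp
  also have "\<dots> = prob (hcross 0 (6 * n) 0 (5 * n))" by (rule vcross_hcross)
  finally show ?thesis by simp
qed

end

lemma hcross_shrink:
  assumes "\<omega> \<in> Arm a b c d I J" "a \<le> a'" "a' \<le> b" shows "\<omega> \<in> Arm a' b c d UNIV J"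
proof -
  let ?S = "rect a b c d" and ?T = "rect a' b c d"
  obtain x y z where x: "\<omega> \<in> space config_space" "x \<in> ?S" "(a, y) \<in> clus \<omega> ?S x" "y \<in> I"
    "(b, z) \<in> clus \<omega> ?S x" "z \<in> J" "clus \<omega> ?S x \<subseteq> ?S" using assms(1) by (rule ArmE)
  have 1: "(a, y) \<in> clus \<omega> ?S (b, z)" unfolding clus_eq[OF x(5)] by (rule x(3))
  have 2: "(b, z) \<in> ?S" using x by auto
  obtain v where v: "fst v = a'" "v \<in> clus \<omega> (?S \<inter> {w. fst w \<ge> a'}) (b, z)"
    by (rule clus_shrink_down[OF 1 2 lattice_lipschitz_fst, of a']) (use assms in auto)
  have "?S \<inter> {w. fst w \<ge> a'} \<subseteq> ?T" by (auto simp: rect_def)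
  from clus_monoD[OF v(2) this] have 3: "v \<in> clus \<omega> ?T (b, z)" .
  have "(b, z) \<in> ?T" using 2 assms by simp
  then show ?thesis using x v(1) 3 by (cases v) (intro ArmI[of \<omega> "(b, z)" a' b c d "snd v" _ z], auto)
qed

context perc
begin

lemma long_prob:
  assumes c: "c \<le> prob (hcross 0 (6 * n) 0 (5 * n))" "0 \<le> c" and n: "0 \<le> n"
  shows "c ^ (2 * Suc k) \<le> prob (hcross 0 ((6 + int k) * n) 0 (5 * n))"
proof -
  let ?H = "\<lambda>i. hcross (int i * n) (int i * n + 6 * n) 0 (5 * n)" and ?V = "\<lambda>i. vcross (int i * n) (int i * n + 5 * n) 0 (5 * n)"
  let ?Es = "map ?H [0..<Suc k] @ map ?V [0..<Suc k]"
  have H: "prob (?H i) = prob (hcross 0 (6 * n) 0 (5 * n))" for i by (rule hcross_eq) simp_all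
  have V: "prob (hcross 0 (6 * n) 0 (5 * n)) \<le> prob (?V i)" for i
  proof -
    have "prob (hcross 0 (6 * n) 0 (5 * n)) \<le> prob (hcross n (6 * n) 0 (5 * n))"
      by (rule prob_mono) (use n in \<open>auto intro: hcross_shrink\<close>)
    also have "\<dots> = prob (?V i)" unfolding vcross_hcross by (rule hcross_eq) simp_all
    finally show ?thesis .
  qed
  have "c ^ length ?Es \<le> prob (Conj ?Es)"
    by (rule FKG_pow) (use c H V in \<open>auto intro: order_trans\<close>)
  also have "prob (Conj ?Es) \<le> prob (hcross 0 ((6 + int k) * n) 0 (5 * n))"
  proof (rule prob_mono)
    show "Conj ?Es \<subseteq> hcross 0 ((6 + int k) * n) 0 (5 * n)"
    proof
      fix \<omega> assume w: "\<omega> \<in> Conj ?Es"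
      show "\<omega> \<in> hcross 0 ((6 + int k) * n) 0 (5 * n)"
      proof (rule long_crossing[OF _ _ n])
        fix i assume "i \<le> k"
        then have "?H i \<in> set ?Es" "?V i \<in> set ?Es"
          unfolding set_append set_map set_upt by (intro UnI1 imageI UnI2; simp)+
        then show "\<omega> \<in> ?H i" "\<omega> \<in> ?V i" using ConjD[OF w] by blast+
      qed
    qed
  qed simp
  finally have "c ^ length ?Es \<le> prob (hcross 0 ((6 + int k) * n) 0 (5 * n))" .
  moreover have "length ?Es = 2 * Suc k" by simp
  ultimately show ?thesis by metis
qed

end

section \<open>A Russo-Seymour-Welsh alternative\<close>

text \<open>If the two crossings are not joined, they remain separated after opening the parts of the vertical
  sides at height at least \<open>3 * g\<close> or at most \<open>- 3 * g\<close>; a dual crossing of the modified configuration can only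
  enter the right side in between.\<close>

lemma arch_or_dual_arm:
  assumes X: "\<omega> \<in> Arm 0 (2 * n) (- n + 2 * g) (n + 2 * g) {g<..<3 * g} {g<..<3 * g}"
    and Y: "\<omega> \<in> Arm 0 (2 * n) (- n - 2 * g) (n - 2 * g) {- 3 * g<..<- g} {- 3 * g<..<- g}"
    and g: "0 < g" "2 * g \<le> n"
  shows "\<omega> \<in> Arch 0 0 n g \<or> dual_config \<omega> \<in> Arm 0 (2 * n) (- n - 2 * g) (n + 2 * g - 1) UNIV {- 3 * g..3 * g}"
proof (rule disjCI)
  define m where "m = 2 * n"
  define c where "c = - n - 2 * g"
  define d where "d = n + 2 * g"
  define D where "D = rect 0 m c d"
  assume no: "dual_config \<omega> \<notin> Arm 0 (2 * n) (- n - 2 * g) (n + 2 * g - 1) UNIV {- 3 * g..3 * g}"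
  \<comment> \<open>The ends of both crossings lie strictly between \<open>- 3 * g\<close> and
    \<open>3 * g\<close>, so a path from \<open>Low\<close> to \<open>Up\<close> has to meet both
    crossings.\<close>
  define Low where "Low p \<longleftrightarrow> snd p \<le> c \<or> (fst p \<in> {0, m} \<and> snd p \<le> - 3 * g)" for p :: vertex
  define Up where "Up p \<longleftrightarrow> snd p \<ge> d \<or> (fst p \<in> {0, m} \<and> snd p \<ge> 3 * g)" for p :: vertex
  define \<omega>' where "\<omega>' e \<longleftrightarrow> \<omega> e \<or> (\<exists>x y. x \<in> {0, m} \<and> e = {(x, y), (x, y + 1)} \<and> (3 * g \<le> y \<or> y + 1 \<le> - 3 * g))" for e
  have LU: "\<not> (Low p \<and> Up p)" for p using g unfolding Low_def Up_def c_def d_def by auto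
  have good: "(s, t) \<in> openrel \<omega> D" if "(s, t) \<in> openrel \<omega>' D" "\<not> (Up s \<and> Up t)" "\<not> (Low s \<and> Low t)" for s t
  proof -
    have "\<omega> {s, t}"
    proof (rule ccontr)
      assume n: "\<not> \<omega> {s, t}"
      have "\<omega>' {s, t}" using that(1) by (simp add: openrel_def)
      with n have "\<exists>x y. x \<in> {0, m} \<and> {s, t} = {(x, y), (x, y + 1)} \<and> (3 * g \<le> y \<or> y + 1 \<le> - 3 * g)"
        by (simp only: \<omega>'_def simp_thms)
      then obtain x y where xy: "x \<in> {0, m}" "{s, t} = {(x, y), (x, y + 1)}" "3 * g \<le> y \<or> y + 1 \<le> - 3 * g"
        by (elim exE conjE) (rule that)
      have "s \<in> {s, t}" "t \<in> {s, t}" by simp_all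
      then have "fst s = x" "fst t = x" "snd s \<in> {y, y + 1}" "snd t \<in> {y, y + 1}" unfolding xy(2) by auto
      then have "(Up s \<and> Up t) \<or> (Low s \<and> Low t)"
        using xy(1,3) unfolding Up_def Low_def by auto
      with that(2,3) show False by blast
    qed
    with that(1) show ?thesis by (simp add: openrel_def)
  qed
  obtain x y1 y2 where x: "\<omega> \<in> space config_space" "x \<in> rect 0 (2 * n) (- n + 2 * g) (n + 2 * g)"
    "(0, y1) \<in> clus \<omega> (rect 0 (2 * n) (- n + 2 * g) (n + 2 * g)) x" "y1 \<in> {g<..<3 * g}"
    "(2 * n, y2) \<in> clus \<omega> (rect 0 (2 * n) (- n + 2 * g) (n + 2 * g)) x" "y2 \<in> {g<..<3 * g}"
    "clus \<omega> (rect 0 (2 * n) (- n + 2 * g) (n + 2 * g)) x \<subseteq> rect 0 (2 * n) (- n + 2 * g) (n + 2 * g)"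
    using X by (rule ArmE)
  obtain v z1 z2 where v: "v \<in> rect 0 (2 * n) (- n - 2 * g) (n - 2 * g)"
    "(0, z1) \<in> clus \<omega> (rect 0 (2 * n) (- n - 2 * g) (n - 2 * g)) v" "z1 \<in> {- 3 * g<..<- g}"
    "(2 * n, z2) \<in> clus \<omega> (rect 0 (2 * n) (- n - 2 * g) (n - 2 * g)) v" "z2 \<in> {- 3 * g<..<- g}"
    "clus \<omega> (rect 0 (2 * n) (- n - 2 * g) (n - 2 * g)) v \<subseteq> rect 0 (2 * n) (- n - 2 * g) (n - 2 * g)"
    using Y by (rule ArmE)
  define S where "S = rect 0 m (- n + 2 * g) (n + 2 * g)"
  define T where "T = rect 0 m (- n - 2 * g) (n - 2 * g)"
  note x = x[folded m_def, folded S_def] and v = v[folded m_def, folded T_def]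
  have ST: "S \<subseteq> D" "T \<subseteq> D" using g unfolding S_def T_def D_def c_def d_def rect_def by auto
  have "\<exists>p q. p \<in> D \<and> Low p \<and> Up q \<and> q \<in> clus \<omega> D p"
  proof (rule ccontr)
    assume none: "\<not> ?thesis"
    \<comment> \<open>A crossing of the modified configuration is cut at its first vertex in
      \<open>Up\<close> and, going backwards from there, at the first vertex in \<open>Low\<close>;
      the piece in between uses only edges that are open in \<open>\<omega>\<close>.\<close>
    have dis: "(x', d) \<notin> clus \<omega>' (rect 0 m c d) (x, c)" if "0 \<le> x" "x \<le> m" for x x'
    proof
      assume a: "(x', d) \<in> clus \<omega>' (rect 0 m c d) (x, c)"
      have cd: "c < d" using g by (simp add: c_def d_def)
      have uD: "(x, c) \<in> D" using that cd by (simp add: D_def)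
      have u: "Low (x, c)" "\<not> Up (x, c)" using LU[of "(x, c)"] by (auto simp: Low_def)
      have rt: "((x, c), (x', d)) \<in> (openrel \<omega>' D)\<^sup>*" using a by (simp add: clus_def D_def)
      have upd: "\<not> \<not> Up (x', d)" by (simp add: Up_def)
      obtain w w' where w: "((x, c), w) \<in> {(s, t) \<in> openrel \<omega>' D. \<not> Up s \<and> \<not> Up t}\<^sup>*" "\<not> Up w"
        "(w, w') \<in> openrel \<omega>' D" "\<not> \<not> Up w'"
        by (rule first_entry[where P = "\<lambda>p. \<not> Up p", OF rt u(2) upd])
      have ww: "(w, w') \<in> openrel \<omega> D" using w LU[of w'] by (intro good) auto
      then have wD: "w \<in> D" by (simp add: openrel_def)
      have w'c: "w' \<in> clus \<omega> D w" by (rule clus_step[OF clus_refl ww])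
      show False
      proof (cases "Low w")
        case True
        with none wD w'c w(4) show False by blast
      next
        case False
        have "sym {(s, t) \<in> openrel \<omega>' D. \<not> Up s \<and> \<not> Up t}"
          using sym_openrel[of \<omega>' D] by (auto simp: sym_def)
        then have rt': "(w, (x, c)) \<in> {(s, t) \<in> openrel \<omega>' D. \<not> Up s \<and> \<not> Up t}\<^sup>*"
          by (intro symD[OF sym_rtrancl w(1)])
        have lx: "\<not> \<not> Low (x, c)" using u by simp
        obtain z z' where z: "(w, z) \<in> {(s, t) \<in> {(s, t) \<in> openrel \<omega>' D. \<not> Up s \<and> \<not> Up t}. \<not> Low s \<and> \<not> Low t}\<^sup>*"
          "\<not> Low z" "(z, z') \<in> {(s, t) \<in> openrel \<omega>' D. \<not> Up s \<and> \<not> Up t}" "\<not> \<not> Low z'"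
          by (rule first_entry[where P = "\<lambda>p. \<not> Low p", OF rt' False lx])
        have "{(s, t) \<in> {(s, t) \<in> openrel \<omega>' D. \<not> Up s \<and> \<not> Up t}. \<not> Low s \<and> \<not> Low t} \<subseteq> openrel \<omega> D"
          by (rule subrelI) (rule good, simp_all)
        from rtrancl_mono[OF this] z(1) have 1: "z \<in> clus \<omega> D w" unfolding clus_def by (simp add: subsetD)
        have "(z, z') \<in> openrel \<omega> D" using z by (intro good) auto
        then have z'D: "z' \<in> D" and "z' \<in> clus \<omega> D w" using clus_step[OF 1] by (simp_all add: openrel_def)
        then have "clus \<omega> D z' = clus \<omega> D w" by (intro clus_eq)
        with w'c have "w' \<in> clus \<omega> D z'" by simp
        with none z'D z(4) w(4) show False by blast
      qed
    qed
    have m0: "0 \<le> m" "c \<le> d" using g by (simp_all add: m_def c_def d_def)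
    from dual_crossing_of_no_crossing[OF m0 dis] obtain y y' where y: "c \<le> y" "y < d" "(m, y') \<in> clus (dual_config \<omega>') (rect (0 - 1) m c (d - 1)) (0 - 1, y)"
      by blast
    let ?S = "rect (- 1) m c (d - 1)"
    have rt: "((- 1, y), (m, y')) \<in> (openrel (dual_config \<omega>') ?S)\<^sup>*" using y(3) by (simp add: clus_def)
    have fs: "fst (- 1 :: int, y) < m" "\<not> fst (m, y') < m" using m0 by simp_all
    obtain w w' where w: "((- 1, y), w) \<in> {(s, t) \<in> openrel (dual_config \<omega>') ?S. fst s < m \<and> fst t < m}\<^sup>*" "fst w < m"
        "(w, w') \<in> openrel (dual_config \<omega>') ?S" "\<not> fst w' < m"
      by (rule first_entry[where P = "\<lambda>p. fst p < m", OF rt fs])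
    have "{(s, t) \<in> openrel (dual_config \<omega>') ?S. fst s < m \<and> fst t < m} \<subseteq> openrel (dual_config \<omega>') ?S" by blast
    from rtrancl_mono[OF this] w(1) have 1: "w \<in> clus (dual_config \<omega>') ?S (- 1, y)" unfolding clus_def by (simp add: subsetD)
    have w': "w' \<in> clus (dual_config \<omega>') ?S (- 1, y)" by (rule clus_step[OF 1 w(3)])
    have ad: "adjacent w w'" and op: "dual_config \<omega>' {w, w'}" using w(3) by (simp_all add: openrel_def)
    obtain j where j: "w = (m - 1, j)" "w' = (m, j)"
    proof -
      obtain p q p' q' where pq: "w = (p, q)" "w' = (p', q')" by (metis surj_pair)
      have "p < m" "\<not> p' < m" "\<bar>p - p'\<bar> + \<bar>q - q'\<bar> = 1" using w(2,4) ad by (simp_all add: pq adjacent_def)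
      then have "p = m - 1" "p' = m" "q = q'" by linarith+
      with pq that show thesis by simp
    qed
    have "dedge {w, w'} = {(m, j), (m, j + 1)}" using dedge_h[of "m - 1" j] by (simp add: j)
    then have ncl: "\<not> \<omega>' {(m, j), (m, j + 1)}" using op ad by (simp add: dual_config_adjacent)
    \<comment> \<open>The dual edge entering column \<open>m\<close> crosses a side edge that is
      closed in \<open>\<omega>'\<close>, and only side edges between the heights
      \<open>- 3 * g\<close> and \<open>3 * g\<close> can be closed.\<close>
    have jw: "- 3 * g \<le> j" "j \<le> 3 * g"
    proof -
      have "\<not> (3 * g \<le> j \<or> j + 1 \<le> - 3 * g)" using ncl unfolding \<omega>'_def by blast
      then show "- 3 * g \<le> j" "j \<le> 3 * g" by linarith+
    qed
    have "clus (dual_config \<omega>') ?S (- 1, y) \<subseteq> clus (dual_config \<omega>) ?S (- 1, y)"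
    proof (rule clus_mono_config)
      fix e assume "e \<in> lattice_edges" "dual_config \<omega>' e"
      then show "dual_config \<omega> e" by (simp add: dual_config_def \<omega>'_def)
    qed
    then have "(m, j) \<in> clus (dual_config \<omega>) ?S (- 1, y)" using w' j by auto
    then have "dual_config \<omega> \<in> Arm (- 1) m c (d - 1) UNIV {- 3 * g..3 * g}"
      using jw y m0 by (intro ArmI[of _ "(- 1, y)" _ _ _ _ y _ j]) auto
    then have "dual_config \<omega> \<in> Arm 0 m c (d - 1) UNIV {- 3 * g..3 * g}" by (rule hcross_shrink) (use m0 in auto)
    with no show False by (simp add: m_def c_def d_def)
  qed
  then obtain p q where pq: "p \<in> D" "Low p" "Up q" "q \<in> clus \<omega> D p" by blast
  have sub: "clus \<omega> D p \<subseteq> D" by (rule clus_sub[OF pq(1)])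
  have col: "0 \<le> fst s \<and> fst s \<le> m" if "s \<in> clus \<omega> D p" for s using subsetD[OF sub that] by (simp add: D_def rect_iff')
  have SD: "clus \<omega> S x \<subseteq> rect 0 m c d" "clus \<omega> T v \<subseteq> rect 0 m c d" using x(7) v(6) ST unfolding D_def by blast+
  have "clus \<omega> S x \<inter> clus \<omega> D p \<noteq> {}"
    by (rule separating_path_cross[OF lattice_connected_clus SD(1) x(3,5) lattice_connected_clus col clus_refl _ pq(4)])
      (use pq(2,3) x(4,6) g in \<open>auto simp: Low_def Up_def\<close>)
  then have 1: "clus \<omega> S x \<subseteq> clus \<omega> D p" using clus_meet[of \<omega> D p S x D] ST by auto
  have "clus \<omega> T v \<inter> clus \<omega> D p \<noteq> {}"
    by (rule separating_path_cross[OF lattice_connected_clus SD(2) v(2,4) lattice_connected_clus col clus_refl _ pq(4)])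
      (use pq(2,3) v(3,5) g in \<open>auto simp: Low_def Up_def\<close>)
  then have 2: "clus \<omega> T v \<subseteq> clus \<omega> D p" using clus_meet[of \<omega> D p T v D] ST by auto
  \<comment> \<open>Here \<open>2 * g \<le> n\<close> enters: the box of an arch has half height
    \<open>2 * n\<close> rather than \<open>n\<close> to leave room for the vertical shifts by
    \<open>2 * g\<close>.\<close>
  have DS: "D \<subseteq> rect 0 (0 + 2 * n) (0 - 2 * n) (0 + 2 * n)"
    using g unfolding D_def m_def c_def d_def rect_def by auto
  show "\<omega> \<in> Arch 0 0 n g"
    by (rule ArchI[OF x(1) DS pq(1), of y1 g z1 y2 z2]) (use 1 2 x v in \<open>auto simp: m_def\<close>)
qed

context perc
begin

text \<open>Every crossing ends in the upper or in the lower half of the right side, and a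
  reflection exchanges the two.\<close>

lemma base_arm:
  assumes "d \<le> 1 - prob (Arm 0 (2 * n) (- n) n UNIV {0..})" "0 \<le> d"
  shows "d ^ 2 \<le> 1 - prob (hcross 0 (2 * n) (- n) n)"
proof -
  let ?A = "\<lambda>J. Arm 0 (2 * n) (- n) n UNIV J"
  have um: "uminus ` {0..} = {..0 :: int}" "uminus ` UNIV = (UNIV :: int set)" by (simp_all add: surj_uminus)
  have 2: "prob (?A {..0}) = prob (?A {0..})"
    using Arm_negy[of 0 "2 * n" n "- n" UNIV "{0..}"] by (simp add: um)
  have "d ^ length [?A {0..}, ?A {..0}] \<le> 1 - prob (hcross 0 (2 * n) (- n) n)"
  proof (rule FKG_cover_pow)
    show "hcross 0 (2 * n) (- n) n \<subseteq> \<Union>(set [?A {0..}, ?A {..0}])"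
    proof
      fix \<omega> assume "\<omega> \<in> hcross 0 (2 * n) (- n) n"
      then show "\<omega> \<in> \<Union>(set [?A {0..}, ?A {..0}])"
      proof (rule ArmE)
        fix x y z assume a: "\<omega> \<in> space config_space" "x \<in> rect 0 (2 * n) (- n) n"
          "(0, y) \<in> clus \<omega> (rect 0 (2 * n) (- n) n) x" "(2 * n, z) \<in> clus \<omega> (rect 0 (2 * n) (- n) n) x"
        have "\<omega> \<in> ?A J" if "z \<in> J" for J using a that by (intro ArmI[OF a(1,2,3) _ a(4)]) auto
        then show ?thesis by (cases "0 \<le> z") auto
      qed
    qed
  qed (use assms 2 in auto)
  then show ?thesis by (simp add: power2_eq_square)
qed

text \<open>Either one end of the crossing has height at least \<open>g\<close> or at most
  \<open>- g\<close>, which gives four equally likely events, or both ends are in the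
  middle.\<close>

lemma cover_mid:
  assumes "d \<le> 1 - prob (Arm 0 (2 * n) (- n) n UNIV {g..})" "0 \<le> d"
  shows "d ^ 4 * (1 - prob (Arm 0 (2 * n) (- n) n {- g<..<g} {- g<..<g})) \<le> 1 - prob (hcross 0 (2 * n) (- n) n)"
proof -
  let ?A = "\<lambda>I J. Arm 0 (2 * n) (- n) n I J"
  have um: "uminus ` {g..} = {..- g}" "uminus ` UNIV = (UNIV :: int set)" by (simp_all add: surj_uminus)
  have 1: "prob (?A I J) = prob (?A J I)" for I J
    using Arm_negx[of "2 * n" 0 "- n" n J I] Arm_shift[of 0 "- (2 * n)" "2 * n" "2 * n" 0 "- n" "- n" 0 n n J J I I]
    by simp
  have 2: "prob (?A UNIV {..- g}) = prob (?A UNIV {g..})"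
    using Arm_negy[of 0 "2 * n" n "- n" UNIV "{g..}"] by (simp add: um)
  have 3: "prob (?A {g..} UNIV) = prob (?A UNIV {g..})" "prob (?A {..- g} UNIV) = prob (?A UNIV {g..})"
    using 2 1[of "{g..}" UNIV] 1[of "{..- g}" UNIV] by simp_all
  let ?M = "?A {- g<..<g} {- g<..<g}"
  let ?Es = "[?A UNIV {g..}, ?A UNIV {..- g}, ?A {g..} UNIV, ?A {..- g} UNIV, ?M]"
  have "d ^ 4 * (1 - prob ?M) \<le> (1 - prob (?A UNIV {g..})) ^ 4 * (1 - prob ?M)"
    using assms by (intro mult_right_mono power_mono) simp_all
  also have "\<dots> = (\<Prod>E\<leftarrow>?Es. 1 - prob E)"
    by (simp add: 2 3 power4_eq_xxxx)
  also have "\<dots> \<le> 1 - prob (hcross 0 (2 * n) (- n) n)"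
  proof (rule FKG_cover)
    show "hcross 0 (2 * n) (- n) n \<subseteq> \<Union>(set ?Es)"
    proof
      fix \<omega> assume "\<omega> \<in> hcross 0 (2 * n) (- n) n"
      then show "\<omega> \<in> \<Union>(set ?Es)"
      proof (rule ArmE)
        fix x y z assume a: "\<omega> \<in> space config_space" "x \<in> rect 0 (2 * n) (- n) n"
          "(0, y) \<in> clus \<omega> (rect 0 (2 * n) (- n) n) x" "(2 * n, z) \<in> clus \<omega> (rect 0 (2 * n) (- n) n) x"
        have A: "\<omega> \<in> ?A I J" if "y \<in> I" "z \<in> J" for I J using a that by (intro ArmI[OF a(1,2,3) _ a(4)]) auto
        consider "z \<ge> g" | "z \<le> - g" | "y \<ge> g" | "y \<le> - g" | "y \<in> {- g<..<g}" "z \<in> {- g<..<g}" by fastforce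
        then show ?thesis by cases (use A in auto)
      qed
    qed
  qed auto
  finally show ?thesis .
qed

text \<open>The heights \<open>- L..L\<close> on the right side are covered by \<open>k\<close>
  windows of \<open>2 * g + 1\<close> heights each. If an arm ending there is likely enough,
  \<open>FKG_cover_pow\<close> finds a single window reached with probability above
  \<open>1 - \<delta>\<close>; an arm into it, its mirror image and an arch form a crossing of
  length \<open>2 * (4 * n) - 2 * n = 6 * n\<close>.\<close>

lemma step_hard:
  assumes arch: "u \<le> prob (Arch 0 0 n g)" and u: "0 \<le> u" "0 \<le> \<delta>" and L: "0 \<le> L" "4 * L \<le> n" and g: "0 \<le> g"
    and k: "2 * L + 1 \<le> int k * (2 * g + 1)" and cd: "- 2 * n - L \<le> c" "d \<le> 2 * n + L"
    and arm: "1 - prob (Arm 0 (4 * n) c d UNIV {- L..L}) < \<delta> ^ k"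
  shows "\<delta> \<ge> 1 \<or> u * (1 - \<delta>) * (1 - \<delta>) \<le> prob (hcross 0 (6 * n) 0 (5 * n))"
proof (rule disjCI)
  \<comment> \<open>The last centre is pulled back to \<open>L\<close>, so that every arch around a
    centre stays inside the band of height \<open>5 * n\<close>.\<close>
  define z where "z i = min L (- L + g + int i * (2 * g + 1))" for i
  let ?W = "\<lambda>i. Arm 0 (4 * n) c d UNIV {z i - g..z i + g}"
  have zL: "- L \<le> z i" "z i \<le> L" for i using g L by (auto simp: z_def)
  assume no: "\<not> u * (1 - \<delta>) * (1 - \<delta>) \<le> prob (hcross 0 (6 * n) 0 (5 * n))"
  show "1 \<le> \<delta>"
  proof (rule ccontr)
    assume d1: "\<not> 1 \<le> \<delta>"
    have small: "\<delta> \<le> 1 - prob (?W i)" for i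
    proof (rule ccontr)
      assume "\<not> ?thesis"
      then have w: "1 - \<delta> \<le> prob (?W i)" by simp
      \<comment> \<open>The band from \<open>- 2 * n - h\<close> to \<open>3 * n - h\<close> has
        height \<open>5 * n\<close> and contains all arms and arches because \<open>L\<close> is at
        most \<open>n / 4\<close>.\<close>
      define h where "h = n div 2"
      have h: "n - 1 \<le> 2 * h" "2 * h \<le> n" by (auto simp: h_def)
      have "u * (1 - \<delta>) * (1 - \<delta>) \<le> prob (hcross 0 (2 * (4 * n) - 2 * n) (- 2 * n - h) (3 * n - h))"
        by (rule window_hard[OF arch w u(1)]) (use d1 zL[of i] L h cd in linarith)+
      also have "\<dots> = prob (hcross 0 (6 * n) 0 (5 * n))" by (rule hcross_eq) simp_all
      finally show False using no by simp
    qed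
    let ?Es = "map ?W [0..<k]"
    have "\<delta> ^ length ?Es \<le> 1 - prob (Arm 0 (4 * n) c d UNIV {- L..L})"
    proof (rule FKG_cover_pow)
      show "Arm 0 (4 * n) c d UNIV {- L..L} \<subseteq> \<Union>(set ?Es)"
      proof
        fix \<omega> assume "\<omega> \<in> Arm 0 (4 * n) c d UNIV {- L..L}"
        then show "\<omega> \<in> \<Union>(set ?Es)"
        proof (rule ArmE)
          fix x y y' assume a: "\<omega> \<in> space config_space" "x \<in> rect 0 (4 * n) c d"
            "(0, y) \<in> clus \<omega> (rect 0 (4 * n) c d) x" "(4 * n, y') \<in> clus \<omega> (rect 0 (4 * n) c d) x" "y' \<in> {- L..L}"
          define q where "q = (y' + L) div (2 * g + 1)"
          have g1: "0 < 2 * g + 1" using g by simp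
          have q0: "0 \<le> q" unfolding q_def using a(5) g1 by (intro pos_imp_zdiv_nonneg_iff[THEN iffD2]) auto
          have "y' + L = q * (2 * g + 1) + (y' + L) mod (2 * g + 1)"
            unfolding q_def by (rule div_mult_mod_eq[symmetric])
          moreover have "0 \<le> (y' + L) mod (2 * g + 1)" "(y' + L) mod (2 * g + 1) < 2 * g + 1"
            by (rule pos_mod_sign[OF g1], rule pos_mod_bound[OF g1])
          ultimately have y': "q * (2 * g + 1) - L \<le> y'" "y' \<le> q * (2 * g + 1) - L + 2 * g" by linarith+
          have qk: "q < int k"
          proof (rule ccontr)
            assume "\<not> q < int k"
            then have "int k * (2 * g + 1) \<le> q * (2 * g + 1)" using g1 by (intro mult_right_mono) auto
            moreover have "y' \<le> L" using a(5) by simp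
            ultimately show False using k y'(1) by linarith
          qed
          have zq: "z (nat q) = min L (- L + g + q * (2 * g + 1))" using q0 by (simp add: z_def)
          have "y' \<in> {z (nat q) - g..z (nat q) + g}" using y' a(5) unfolding zq min_def by auto
          then have "\<omega> \<in> ?W (nat q)" by (intro ArmI[OF a(1,2,3) _ a(4)]) auto
          moreover have "?W (nat q) \<in> set ?Es" unfolding set_map set_upt using qk q0 by (intro imageI) auto
          ultimately show ?thesis by blast
        qed
      qed
    qed (use small u in auto)
    with arm show False by simp
  qed
qed

text \<open>For \<open>L = 4 * (g + 1)\<close> nine windows suffice, since
  \<open>2 * L + 1 = 8 * g + 9\<close> is at most \<open>9 * (2 * g + 1)\<close>. Either crossings
  of the doubled square reach beyond \<open>L\<close>, so that the gap goes on growing, or they end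
  in the middle and a window yields a hard-way crossing.\<close>

lemma step_single:
  assumes arch: "u \<le> prob (Arch 0 0 n g)" and u: "0 \<le> u" "0 \<le> \<delta>" "\<delta> < 1" "0 < d" and g: "0 \<le> g" "16 * (g + 1) \<le> n"
    and H: "1 - prob (hcross 0 (4 * n) (- 2 * n) (2 * n)) < \<delta> ^ 9 * d ^ 4"
  shows "1 - d \<le> prob (Arm 0 (4 * n) (- 2 * n) (2 * n) UNIV {4 * (g + 1)..}) \<or>
    u * (1 - \<delta>) * (1 - \<delta>) \<le> prob (hcross 0 (6 * n) 0 (5 * n))"
proof -
  let ?g = "4 * (g + 1)"
  let ?M = "Arm 0 (4 * n) (- 2 * n) (2 * n) {- ?g<..<?g} {- ?g<..<?g}"
  have "u * (1 - \<delta>) * (1 - \<delta>) \<le> prob (hcross 0 (6 * n) 0 (5 * n))"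
    if "\<not> 1 - d \<le> prob (Arm 0 (4 * n) (- 2 * n) (2 * n) UNIV {?g..})"
  proof -
    from that have "d ^ 4 * (1 - prob ?M) \<le> 1 - prob (hcross 0 (4 * n) (- 2 * n) (2 * n))"
      using cover_mid[of d "2 * n" ?g] u by simp
    with H have "d ^ 4 * (1 - prob ?M) < d ^ 4 * \<delta> ^ 9" by (simp add: mult.commute)
    then have "1 - prob ?M < \<delta> ^ 9" using u by (simp add: mult_less_cancel_left_pos)
    moreover have "prob ?M \<le> prob (Arm 0 (4 * n) (- 2 * n) (2 * n) UNIV {- ?g..?g})"
      by (rule prob_mono[OF Arm_mono]) auto
    ultimately have "1 - prob (Arm 0 (4 * n) (- 2 * n) (2 * n) UNIV {- ?g..?g}) < \<delta> ^ 9" by simp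
    from step_hard[OF arch u(1,2) _ _ g(1) _ _ _ this] g u
    show ?thesis by auto
  qed
  then show ?thesis by blast
qed

text \<open>The middle crossing shifted up and shifted down by \<open>2 * g\<close> supplies the two
  crossings of \<open>arch_or_dual_arm\<close>; FKG makes them occur together, whence the
  square.\<close>

lemma mid_split:
  assumes g: "0 < g" "2 * g \<le> n"
  shows "(prob (Arm 0 (2 * n) (- n) n {- g<..<g} {- g<..<g}))\<^sup>2 \<le> prob (Arch 0 0 n g) +
    measure (dual M) (Arm 0 (2 * n) (- n - 2 * g) (n + 2 * g - 1) UNIV {- 3 * g..3 * g})"
proof -
  let ?X = "Arm 0 (2 * n) (- n + 2 * g) (n + 2 * g) {g<..<3 * g} {g<..<3 * g}"
  let ?Y = "Arm 0 (2 * n) (- n - 2 * g) (n - 2 * g) {- 3 * g<..<- g} {- 3 * g<..<- g}"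
  let ?M = "Arm 0 (2 * n) (- n) n {- g<..<g} {- g<..<g}"
  let ?Z = "Arm 0 (2 * n) (- n - 2 * g) (n + 2 * g - 1) UNIV {- 3 * g..3 * g}"
  have im: "(\<lambda>y. y + t) ` {a<..<b} = {a + t<..<b + t}" for t a b :: int
  proof (intro equalityI subsetI)
    fix y assume "y \<in> {a + t<..<b + t}"
    then show "y \<in> (\<lambda>y. y + t) ` {a<..<b}" by (intro image_eqI[of _ _ "y - t"]) auto
  qed auto
  have X: "prob ?X = prob ?M" by (rule Arm_shift[where s = 0 and t = "2 * g"]) (simp_all add: im)
  have Y: "prob ?Y = prob ?M" by (rule Arm_shift[where s = 0 and t = "- 2 * g"]; ((subst im)?, simp))
  have "(prob ?M)\<^sup>2 = prob ?X * prob ?Y" by (simp only: X Y power2_eq_square)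
  also have "\<dots> \<le> prob (?X \<inter> ?Y)" by (rule FKG) simp_all
  also have "\<dots> \<le> prob (Arch 0 0 n g \<union> dual_preimage ?Z)"
  proof (rule prob_mono)
    show "?X \<inter> ?Y \<subseteq> Arch 0 0 n g \<union> dual_preimage ?Z"
    proof
      fix \<omega> assume w: "\<omega> \<in> ?X \<inter> ?Y"
      then have "\<omega> \<in> space config_space" using increasing_space[OF _ increasing_Arm] by blast
      with w arch_or_dual_arm[OF _ _ g, of \<omega>] show "\<omega> \<in> Arch 0 0 n g \<union> dual_preimage ?Z" by (auto simp: dual_preimage_iff)
    qed
  qed (simp add: sets_dual_preimage sets.Un)
  also have "\<dots> \<le> prob (Arch 0 0 n g) + prob (dual_preimage ?Z)"
    by (rule measure_Un_le) (simp_all add: events_eq sets_dual_preimage)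
  finally show ?thesis by (simp add: measure_dual)
qed

end

lemma Arch_mono:
  assumes "g' \<le> g" shows "Arch s t n g \<subseteq> Arch s t n g'"
  unfolding Arch_def
proof (rule cluster_meets_mono)
  fix V assume "V \<in> {{s} \<times> {t + g'..}, {s} \<times> {..t - g'}, {s + 2 * n} \<times> {t + g'..}, {s + 2 * n} \<times> {..t - g'}}"
  then consider "V = {s} \<times> {t + g'..}" | "V = {s} \<times> {..t - g'}" | "V = {s + 2 * n} \<times> {t + g'..}"
    | "V = {s + 2 * n} \<times> {..t - g'}" by auto
  then show "\<exists>U\<in>{{s} \<times> {t + g..}, {s} \<times> {..t - g}, {s + 2 * n} \<times> {t + g..}, {s + 2 * n} \<times> {..t - g}}. U \<subseteq> V"
  proof cases
    case 1 show ?thesis by (rule bexI[of _ "{s} \<times> {t + g..}"]) (use assms 1 in auto)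
  next
    case 2 show ?thesis by (rule bexI[of _ "{s} \<times> {..t - g}"]) (use assms 2 in auto)
  next
    case 3 show ?thesis by (rule bexI[of _ "{s + 2 * n} \<times> {t + g..}"]) (use assms 3 in auto)
  next
    case 4 show ?thesis by (rule bexI[of _ "{s + 2 * n} \<times> {..t - g}"]) (use assms 4 in auto)
  qed
qed simp

text \<open>\<open>(1 / 40) ^ 5\<close> is the arch probability maintained in the induction,
  \<open>1 / 40\<close> being a lower bound for each of the five events in
  \<open>square_arch\<close>. The power 217 counts the arches of \<open>arch_hard\<close>; the
  result is also below what a window gives, so one constant serves both ways of obtaining a hard-way
  crossing.\<close>

definition rsw_const :: real where "rsw_const = ((1 / 40) ^ 5) ^ 217"

lemma rsw_const: "0 < rsw_const" "rsw_const \<le> (1 / 40) ^ 5 * (1 - 995 / 1000) * (1 - 995 / 1000)"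
proof -
  have "rsw_const \<le> ((1 / 40 :: real) ^ 5) ^ 2"
    unfolding rsw_const_def by (rule power_decreasing) (simp_all add: power_le_one)
  also have "\<dots> \<le> (1 / 40) ^ 5 * (1 - 995 / 1000) * (1 - 995 / 1000)" by (simp add: eval_nat_numeral)
  finally show "rsw_const \<le> (1 / 40) ^ 5 * (1 - 995 / 1000) * (1 - 995 / 1000)" .
qed (simp add: rsw_const_def)

context perc
begin

text \<open>A square without vertical crossing has a dual horizontal crossing, of a rectangle that
  is at least as long and at most as high as the square.\<close>

lemma square_sum:
  assumes n: "0 \<le> n"
  shows "1 \<le> prob (hcross 0 (2 * n) (- n) n) + measure (dual M) (hcross 0 (2 * n) (- n) n)"
proof -
  interpret d: perc "dual M" by (rule perc_dual)
  let ?Z = "hcross (- 1) (2 * n) (- n) (n - 1)"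
  have "space config_space \<subseteq> vcross 0 (2 * n) (- n) n \<union> dual_preimage ?Z"
  proof
    fix \<omega> assume w: "\<omega> \<in> space config_space"
    show "\<omega> \<in> vcross 0 (2 * n) (- n) n \<union> dual_preimage ?Z"
    proof (cases "\<exists>x x'. 0 \<le> x \<and> x \<le> 2 * n \<and> (x', n) \<in> clus \<omega> (rect 0 (2 * n) (- n) n) (x, - n)")
      case True
      then obtain x x' where x: "0 \<le> x" "x \<le> 2 * n" "(x', n) \<in> clus \<omega> (rect 0 (2 * n) (- n) n) (x, - n)" by blast
      have "\<omega> \<in> vcross 0 (2 * n) (- n) n" unfolding vcross_def using w
      proof (rule cluster_meetsI)
        show "(x, - n) \<in> rect 0 (2 * n) (- n) n" using x n by simp
        fix U :: "vertex set" assume "U \<in> {UNIV \<times> {- n}, UNIV \<times> {n}}"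
        then consider "U = (UNIV :: int set) \<times> {- n}" | "U = (UNIV :: int set) \<times> {n}" by auto
        then show "\<exists>u\<in>U. u \<in> clus \<omega> (rect 0 (2 * n) (- n) n) (x, - n)"
        proof cases
          case 1 then show ?thesis by (intro bexI[of _ "(x, - n)"]) auto
        next
          case 2 with x(3) show ?thesis by (intro bexI[of _ "(x', n)"]) auto
        qed
      qed
      then show ?thesis by simp
    next
      case False
      have "\<exists>y y'. - n \<le> y \<and> y < n \<and> (2 * n, y') \<in> clus (dual_config \<omega>) (rect (0 - 1) (2 * n) (- n) (n - 1)) (0 - 1, y)"
        by (rule dual_crossing_of_no_crossing) (use False n in auto)
      then obtain y y' where y: "- n \<le> y" "y < n" "(2 * n, y') \<in> clus (dual_config \<omega>) (rect (- 1) (2 * n) (- n) (n - 1)) (- 1, y)"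
        by auto
      have "dual_config \<omega> \<in> ?Z" using y n by (intro ArmI[of _ "(- 1, y)" _ _ _ _ y _ y']) auto
      then show ?thesis using w by (simp add: dual_preimage_iff)
    qed
  qed
  then have "prob (space config_space) \<le> prob (vcross 0 (2 * n) (- n) n \<union> dual_preimage ?Z)"
    by (rule prob_mono) (simp add: sets_dual_preimage sets.Un)
  also have "\<dots> \<le> prob (vcross 0 (2 * n) (- n) n) + prob (dual_preimage ?Z)"
    by (rule measure_Un_le) (simp_all add: events_eq sets_dual_preimage)
  also have "prob (vcross 0 (2 * n) (- n) n) = prob (hcross 0 (2 * n) (- n) n)"
    unfolding vcross_hcross by (rule hcross_eq) simp_all
  also have "prob (dual_preimage ?Z) = measure (dual M) ?Z" by (simp add: measure_dual)
  also have "measure (dual M) ?Z \<le> measure (dual M) (hcross 0 (2 * n) (- n) n)"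
  proof (rule d.prob_mono)
    have "?Z \<subseteq> hcross 0 (2 * n) (- n) (n - 1)" using n by (auto intro: hcross_shrink)
    also have "\<dots> \<subseteq> hcross 0 (2 * n) (- n) n" by (rule Arm_mono) auto
    finally show "?Z \<subseteq> hcross 0 (2 * n) (- n) n" .
  qed simp
  finally show ?thesis using prob_space by (simp add: space_M[symmetric])
qed

text \<open>Otherwise arches with gap \<open>4 ^ j - 1\<close> exist at scale \<open>2 ^ j * m\<close> for the model or its dual, for every \<open>j\<close>, and
  the gap outgrows the scale.\<close>

lemma hard_crossing_self_or_dual:
  "\<exists>n\<ge>n0. rsw_const \<le> prob (hcross 0 (6 * n) 0 (5 * n)) \<or> rsw_const \<le> measure (dual M) (hcross 0 (6 * n) 0 (5 * n))"
proof (rule ccontr)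
  assume no: "\<not> ?thesis"
  \<comment> \<open>\<open>T\<close> selects the model or its dual, so that the induction may change
    between the two from one scale to the next.\<close>
  define T where "T b = (if b then M else dual M)" for b
  have pT: "perc (T b)" for b using perc_dual perc_axioms by (simp add: T_def)
  have dT: "measure (dual (T b)) A = measure (T (\<not> b)) A" if "A \<in> sets config_space" for b A
    using that measure_dual_dual by (simp add: T_def)
  define m where "m = max n0 96"
  have m0: "0 \<le> m" "96 \<le> m" by (simp_all add: m_def)
  have small: "measure (T b) (hcross 0 (6 * n) 0 (5 * n)) < rsw_const" if "m \<le> n" for b n
  proof -
    have "n0 \<le> n" using that by (simp add: m_def)
    with no have "\<not> (rsw_const \<le> prob (hcross 0 (6 * n) 0 (5 * n)) \<or>
        rsw_const \<le> measure (dual M) (hcross 0 (6 * n) 0 (5 * n)))" by blast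
    then show ?thesis by (cases b) (simp_all add: T_def)
  qed
  have half: "\<exists>b. 1 / 2 \<le> measure (T b) (hcross 0 (2 * n) (- n) n)" if "0 \<le> n" for n
    using square_sum[OF that] by (cases "1 / 2 \<le> prob (hcross 0 (2 * n) (- n) n)") (force simp: T_def)+
  let ?c0 = "(1 / 40 :: real) ^ 5"
  have arch: "\<exists>b. ?c0 \<le> measure (T b) (Arch 0 0 (2 ^ j * m) (4 ^ j - 1)) \<and> 48 * 4 ^ j \<le> 2 ^ j * m" for j
  proof -
    \<comment> \<open>The gap plus one is \<open>4 ^ j\<close>. Below 48 times this value
      \<open>arch_hard\<close> would apply to the scale; above it the windows fit, since
      \<open>L = 12 * (g + 1)\<close> in the case of a change of model needs
      \<open>4 * L = 48 * (g + 1) \<le> n\<close>.\<close>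
    have big: "48 * 4 ^ j \<le> 2 ^ j * m" if "?c0 \<le> measure (T b) (Arch 0 0 (2 ^ j * m) (4 ^ j - 1))" for b j
    proof (rule ccontr)
      assume "\<not> ?thesis"
      then have 1: "2 ^ j * m < 48 * (4 ^ j - 1 + 1)" by simp
      have "1 * m \<le> 2 ^ j * m" by (rule mult_right_mono) (use m0 in simp_all)
      then have 2: "m \<le> 2 ^ j * m" "96 \<le> 2 ^ j * m" using m0 by linarith+
      have "?c0 ^ 217 \<le> measure (T b) (hcross 0 (6 * (2 ^ j * m)) 0 (5 * (2 ^ j * m)))"
        by (rule perc.arch_hard[OF pT that _ 1 2(2)]) simp
      with small[OF 2(1), of b] show False by (simp add: rsw_const_def)
    qed
    have "\<exists>b. ?c0 \<le> measure (T b) (Arch 0 0 (2 ^ j * m) (4 ^ j - 1))"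
    proof (induction j)
      case 0
      obtain b where b: "1 / 2 \<le> measure (T b) (hcross 0 (2 * m) (- m) m)" using half[OF m0(1)] by blast
      interpret t: perc "T b" by (rule pT)
      have a40: "1 / 40 \<le> t.prob (Arm 0 (2 * m) (- m) m UNIV {0..})"
      proof (rule ccontr)
        assume "\<not> ?thesis"
        then have "(39 / 40 :: real) ^ 2 \<le> 1 - t.prob (hcross 0 (2 * m) (- m) m)"
          by (intro t.base_arm) simp_all
        also have "\<dots> \<le> 1 / 2" using b by simp
        finally show False by (simp add: eval_nat_numeral)
      qed
      have "?c0 \<le> t.prob (Arch 0 0 m 0)" by (rule t.square_arch[OF _ a40]) (use b in simp_all)
      then show ?case by (intro exI[of _ b]) simp
    next
      case (Suc j)
      then obtain b where b: "?c0 \<le> measure (T b) (Arch 0 0 (2 ^ j * m) (4 ^ j - 1))" by blast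
      define n where "n = 2 ^ j * m"
      define g where "g = (4 ^ j - 1 :: int)"
      have g: "0 \<le> g" "48 * (g + 1) \<le> n" using big[OF b] by (simp_all add: g_def n_def)
      have "1 * m \<le> 2 ^ j * m" by (rule mult_right_mono) (use m0 in simp_all)
      then have n: "m \<le> n" "0 \<le> n" using m0 unfolding n_def by linarith+
      note b = b[folded n_def g_def]
      obtain b' where b': "1 / 2 \<le> measure (T b') (hcross 0 (2 * (2 * n)) (- (2 * n)) (2 * n))"
        using half[of "2 * n"] n(2) by fastforce
      interpret t: perc "T b" by (rule pT)
      interpret t': perc "T b'" by (rule pT)
      let ?g = "4 * (g + 1)"
      let ?arm = "Arm 0 (2 * (2 * n)) (- (2 * n)) (2 * n) UNIV {?g..}"
      have "?c0 \<le> measure (T b') (Arch 0 0 (2 * n) ?g)"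
      proof (rule ccontr)
        assume noarch: "\<not> ?thesis"
        have armless: "\<not> 1 / 40 \<le> t'.prob ?arm" using t'.square_arch[of "1 / 40" "2 * n" ?g] b' noarch by auto
        \<comment> \<open>If the model with the old arch is also the one that crosses the doubled
          square, nine windows do, because \<open>(94 / 100) ^ 9 * (39 / 40) ^ 4\<close> exceeds
          \<open>1 / 2\<close>. Otherwise \<open>mid_split\<close> is applied to the crossing model:
          it has no new arch, so the dual arm, which belongs to the model with the old arch, has
          probability above \<open>(44 / 100) ^ 2 - ?c0\<close>, and 25 windows cover the range
          \<open>3 * ?g\<close>.\<close>
        have rs: "rsw_const \<le> t.prob (hcross 0 (6 * n) 0 (5 * n))"
        proof (cases "b' = b")
          case True
          have 1: "1 - t.prob (hcross 0 (4 * n) (- 2 * n) (2 * n)) < (94 / 100) ^ 9 * (39 / 40) ^ 4"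
          proof -
            have "1 - t.prob (hcross 0 (4 * n) (- 2 * n) (2 * n)) \<le> 1 / 2" using b' True by simp
            also have "\<dots> < (94 / 100) ^ 9 * (39 / 40) ^ 4" by (simp add: eval_nat_numeral)
            finally show ?thesis .
          qed
          have "1 - 39 / 40 \<le> t.prob (Arm 0 (4 * n) (- 2 * n) (2 * n) UNIV {4 * (g + 1)..}) \<or>
            ?c0 * (1 - 94 / 100) * (1 - 94 / 100) \<le> t.prob (hcross 0 (6 * n) 0 (5 * n))"
            by (rule t.step_single[OF b _ _ _ _ g(1) _ 1]) (use g in simp_all)
          then have "?c0 * (1 - 94 / 100) * (1 - 94 / 100) \<le> t.prob (hcross 0 (6 * n) 0 (5 * n))"
            using armless True by simp
          moreover have "?c0 * (1 - 995 / 1000) * (1 - 995 / 1000) \<le> ?c0 * (1 - 94 / 100) * (1 - 94 / 100)"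
            by (simp add: eval_nat_numeral)
          ultimately show ?thesis using rsw_const(2) by linarith
        next
          case False
          let ?M = "Arm 0 (2 * (2 * n)) (- (2 * n)) (2 * n) {- ?g<..<?g} {- ?g<..<?g}"
          let ?Z = "Arm 0 (2 * (2 * n)) (- (2 * n) - 2 * ?g) (2 * n + 2 * ?g - 1) UNIV {- 3 * ?g..3 * ?g}"
          have "(39 / 40) ^ 4 * (1 - t'.prob ?M) \<le> 1 - t'.prob (hcross 0 (2 * (2 * n)) (- (2 * n)) (2 * n))"
            by (rule t'.cover_mid) (use armless in simp_all)
          also have "\<dots> \<le> 1 / 2" using b' by simp
          finally have "44 / 100 \<le> t'.prob ?M" by (simp add: eval_nat_numeral)
          then have "(44 / 100) ^ 2 \<le> (t'.prob ?M) ^ 2" by (intro power_mono) simp_all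
          also have "\<dots> \<le> t'.prob (Arch 0 0 (2 * n) ?g) + measure (dual (T b')) ?Z"
            by (rule t'.mid_split) (use g in simp_all)
          also have "measure (dual (T b')) ?Z = t.prob ?Z" using dT[of ?Z b'] False by (cases b; cases b') simp_all
          finally have z: "(44 / 100) ^ 2 - ?c0 < t.prob ?Z" using noarch by simp
          have ze: "?Z = Arm 0 (4 * n) (- 2 * n - 2 * ?g) (2 * n + 2 * ?g - 1) UNIV {- (3 * ?g)..3 * ?g}" by simp
          have "1 - t.prob ?Z < 1 - ((44 / 100) ^ 2 - ?c0)" using z by simp
          also have "\<dots> < (995 / 1000) ^ 25" by (simp add: eval_nat_numeral)
          finally have 1: "1 - t.prob (Arm 0 (4 * n) (- 2 * n - 2 * ?g) (2 * n + 2 * ?g - 1) UNIV {- (3 * ?g)..3 * ?g}) < (995 / 1000) ^ 25"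
            unfolding ze .
          have "995 / 1000 \<ge> (1::real) \<or> ?c0 * (1 - 995 / 1000) * (1 - 995 / 1000) \<le> t.prob (hcross 0 (6 * n) 0 (5 * n))"
            by (rule t.step_hard[OF b _ _ _ _ g(1) _ _ _ 1]) (use g in simp_all)
          then show ?thesis using rsw_const(2) by simp
        qed
        with small[OF n(1), of b] show False by simp
      qed
      also have "\<dots> \<le> measure (T b') (Arch 0 0 (2 * n) (4 ^ Suc j - 1))"
        by (rule t'.prob_mono[OF Arch_mono]) (simp_all add: g_def)
      finally show ?case by (intro exI[of _ b']) (simp add: n_def mult.assoc)
    qed
    then show ?thesis using big by blast
  qed
  \<comment> \<open>At \<open>j = m\<close> the bound \<open>m < 2 ^ j\<close> makes the scale
    \<open>2 ^ j * m\<close> smaller than \<open>4 ^ j\<close>.\<close>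
  have 1: "48 * 4 ^ nat m \<le> 2 ^ nat m * m" using arch[of "nat m"] by blast
  have "nat m < 2 ^ nat m" by (rule less_exp)
  then have "int (nat m) < int (2 ^ nat m)" by linarith
  then have "m < 2 ^ nat m" using m0 by simp
  then have "2 ^ nat m * m \<le> 2 ^ nat m * 2 ^ nat m" by (intro mult_left_mono) simp_all
  also have "\<dots> = (4 :: int) ^ nat m" by (simp add: power_mult_distrib[symmetric])
  finally have "48 * 4 ^ nat m \<le> (4 :: int) ^ nat m" using 1 by linarith
  moreover have "(0 :: int) < 4 ^ nat m" by simp
  ultimately show False by linarith
qed

end

lemma cluster_meets2I:
  assumes "\<omega> \<in> space config_space" "u \<in> U" "u \<in> S" "v \<in> V" "v \<in> clus \<omega> S u"
  shows "\<omega> \<in> cluster_meets S {U, V}"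
  using assms(1,3)
proof (rule cluster_meetsI)
  fix W assume "W \<in> {U, V}"
  then consider "W = U" | "W = V" by auto
  then show "\<exists>w\<in>W. w \<in> clus \<omega> S u"
  proof cases
    case 1 then show ?thesis by (intro bexI[of _ u]) (simp_all add: assms)
  next
    case 2 then show ?thesis by (intro bexI[of _ v]) (simp_all add: assms)
  qed
qed

lemma cluster_meets2E:
  assumes "\<omega> \<in> cluster_meets S {U, V}"
  obtains u v where "\<omega> \<in> space config_space" "u \<in> U" "u \<in> S" "v \<in> V" "v \<in> clus \<omega> S u"
proof -
  obtain x where x: "x \<in> S" "\<forall>W\<in>{U, V}. \<exists>u\<in>W. u \<in> clus \<omega> S x" using assms by (rule cluster_meetsE)
  have "(\<exists>u\<in>U. u \<in> clus \<omega> S x) \<and> (\<exists>u\<in>V. u \<in> clus \<omega> S x)" using x(2) by simp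
  then obtain u v where uv: "u \<in> U" "u \<in> clus \<omega> S x" "v \<in> V" "v \<in> clus \<omega> S x" by (elim conjE bexE) (rule that)
  have "u \<in> S" by (rule subsetD[OF clus_sub[OF x(1)] uv(2)])
  moreover have "v \<in> clus \<omega> S u" unfolding clus_eq[OF uv(2)] by (rule uv(4))
  moreover have "\<omega> \<in> space config_space" by (rule subsetD[OF cluster_meets_sub_space assms])
  ultimately show thesis using that uv by blast
qed

section \<open>Connections to distance\<close>

definition far :: "int \<Rightarrow> int \<Rightarrow> config set" where
  "far m N = cluster_meets (lattice_box N) {lattice_box m, {p. supn p = N}}"

lemma increasing_far [simp]: "increasing_event (far m N)"
  unfolding far_def by (rule increasing_cluster_meets) simp

lemma sets_far [simp]: "far m N \<in> sets config_space"
  by (rule increasing_sets) simp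

lemma supported_far: "event_supported_in (far m N) (lattice_box N)"
  unfolding far_def by (rule supported_cluster_meets) simp

lemma lattice_box_rect: "lattice_box n = rect (- n) n (- n) n"
  by (simp add: lattice_box_def rect_def)

lemma far_mono_right:
  assumes "m \<le> N" "N \<le> N'" shows "far m N' \<subseteq> far m N"
proof
  fix \<omega> assume "\<omega> \<in> far m N'"
  then obtain u v where uv: "\<omega> \<in> space config_space" "u \<in> lattice_box m" "u \<in> lattice_box N'"
    "v \<in> {p. supn p = N'}" "v \<in> clus \<omega> (lattice_box N') u" unfolding far_def by (rule cluster_meets2E)
  obtain v' where v': "supn v' = N" "v' \<in> clus \<omega> (lattice_box N' \<inter> {w. supn w \<le> N}) u"
    by (rule clus_shrink_up[OF uv(5,3) lattice_lipschitz_supn, of N]) (use uv assms in \<open>simp_all add: supn_box\<close>)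
  have "lattice_box N' \<inter> {w. supn w \<le> N} \<subseteq> lattice_box N" by (simp add: subset_iff supn_box)
  from clus_monoD[OF v'(2) this] v'(1) uv assms show "\<omega> \<in> far m N" unfolding far_def
    by (intro cluster_meets2I[of \<omega> u _ _ v']) (simp_all add: supn_box)
qed

text \<open>The inner box is removed from the region, so that the event is supported away from it
  and mixing applies.\<close>

definition annulus_crossing :: "int \<Rightarrow> int \<Rightarrow> config set" where
  "annulus_crossing m N = cluster_meets (lattice_box N - lattice_box (m - 1)) {{p. supn p = m}, {p. supn p = N}}"

lemma sets_annulus [simp]: "annulus_crossing m N \<in> sets config_space"
  unfolding annulus_crossing_def by (rule sets_cluster_meets) simp

lemma supported_annulus: "event_supported_in (annulus_crossing m N) (UNIV - lattice_box (m - 1))"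
  unfolding annulus_crossing_def by (rule supported_mono[OF supported_cluster_meets]) auto

lemma far_annulus:
  assumes "m \<le> m'" "m' \<le> N" shows "far m N \<subseteq> annulus_crossing m' N"
proof
  fix \<omega> assume "\<omega> \<in> far m N"
  then obtain u v where uv: "\<omega> \<in> space config_space" "u \<in> lattice_box m" "u \<in> lattice_box N"
    "v \<in> {p. supn p = N}" "v \<in> clus \<omega> (lattice_box N) u" unfolding far_def by (rule cluster_meets2E)
  obtain u' v' where w: "u' \<in> lattice_box N" "supn u' = m'" "supn v' = N"
    "v' \<in> clus \<omega> (lattice_box N \<inter> {w. m' \<le> supn w \<and> supn w \<le> N}) u'"
    by (rule clus_shrink[OF uv(5,3) lattice_lipschitz_supn, of m' N]) (use uv assms in \<open>simp_all add: supn_box\<close>)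
  have "lattice_box N \<inter> {w. m' \<le> supn w \<and> supn w \<le> N} \<subseteq> lattice_box N - lattice_box (m' - 1)"
    by (simp add: subset_iff supn_box)
  from clus_monoD[OF w(4) this] w uv show "\<omega> \<in> annulus_crossing m' N" unfolding annulus_crossing_def
    by (intro cluster_meets2I[of \<omega> u' _ _ v']) (simp_all add: supn_box)
qed

lemma annulus_far:
  assumes "m \<le> N" shows "annulus_crossing m N \<subseteq> far m N"
  unfolding annulus_crossing_def far_def by (rule cluster_meets_mono) (auto simp: supn_box)

context perc
begin

lemma side_probs:
  "prob (cluster_meets (lattice_box N) {lattice_box m, {- N} \<times> UNIV}) = prob (cluster_meets (lattice_box N) {lattice_box m, {N} \<times> UNIV})"
  "prob (cluster_meets (lattice_box N) {lattice_box m, UNIV \<times> {N}}) = prob (cluster_meets (lattice_box N) {lattice_box m, {N} \<times> UNIV})"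
  "prob (cluster_meets (lattice_box N) {lattice_box m, UNIV \<times> {- N}}) = prob (cluster_meets (lattice_box N) {lattice_box m, {N} \<times> UNIV})"
proof -
  have bx: "negx ` lattice_box k = lattice_box k" "prod.swap ` lattice_box k = lattice_box k" for k
    unfolding lattice_box_rect by (simp_all add: negx_rect swap_rect)
  have "negx ` ({N} \<times> UNIV) = {- N} \<times> UNIV" by (force simp: negx_def)
  then show 1: "prob (cluster_meets (lattice_box N) {lattice_box m, {- N} \<times> UNIV}) = prob (cluster_meets (lattice_box N) {lattice_box m, {N} \<times> UNIV})"
    using cluster_meets_negx[of "{lattice_box m, {N} \<times> UNIV}" "lattice_box N"] by (simp add: bx)
  have 2: "prod.swap ` ({k} \<times> (UNIV :: int set)) = UNIV \<times> {k}" for k :: int by auto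
  then show "prob (cluster_meets (lattice_box N) {lattice_box m, UNIV \<times> {N}}) = prob (cluster_meets (lattice_box N) {lattice_box m, {N} \<times> UNIV})"
    using cluster_meets_swap[of "{lattice_box m, {N} \<times> UNIV}" "lattice_box N"] by (simp add: bx)
  show "prob (cluster_meets (lattice_box N) {lattice_box m, UNIV \<times> {- N}}) = prob (cluster_meets (lattice_box N) {lattice_box m, {N} \<times> UNIV})"
    using cluster_meets_swap[of "{lattice_box m, {- N} \<times> UNIV}" "lattice_box N"] 1 by (simp add: bx 2)
qed

text \<open>The connection ends on one of four sides that are equivalent under the symmetries, so
  the square-root trick applies.\<close>

lemma far_side_pow:
  assumes "d \<le> 1 - prob (cluster_meets (lattice_box N) {lattice_box m, {N} \<times> UNIV})" "0 \<le> d"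
  shows "d ^ 4 \<le> 1 - prob (far m N)"
proof -
  define E where "E V = cluster_meets (lattice_box N) {lattice_box m, V}" for V
  let ?Es = "[E ({N} \<times> UNIV), E ({- N} \<times> UNIV), E (UNIV \<times> {N}), E (UNIV \<times> {- N})]"
  have inc: "increasing_event (E V)" for V unfolding E_def by (rule increasing_cluster_meets) simp
  have "d ^ length ?Es \<le> 1 - prob (far m N)"
  proof (rule FKG_cover_pow)
    show "far m N \<subseteq> \<Union>(set ?Es)"
    proof
      fix \<omega> assume "\<omega> \<in> far m N"
      then obtain u v where uv: "\<omega> \<in> space config_space" "u \<in> lattice_box m" "u \<in> lattice_box N"
        "v \<in> {p. supn p = N}" "v \<in> clus \<omega> (lattice_box N) u" unfolding far_def by (rule cluster_meets2E)
      have C: "\<omega> \<in> E V" if "v \<in> V" for V unfolding E_def by (rule cluster_meets2I[OF uv(1-3) that uv(5)])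
      have "max \<bar>fst v\<bar> \<bar>snd v\<bar> = N" using uv(4) by (simp add: supn_def)
      then have "\<bar>fst v\<bar> = N \<or> \<bar>snd v\<bar> = N" by (simp add: max_def split: if_splits)
      then consider "v \<in> {N} \<times> UNIV" | "v \<in> {- N} \<times> UNIV" | "v \<in> UNIV \<times> {N}" | "v \<in> UNIV \<times> {- N}"
        unfolding mem_Times_iff by fastforce
      then show "\<omega> \<in> \<Union>(set ?Es)" by cases (drule C, simp)+
    qed
  qed (use inc assms side_probs in \<open>auto simp: E_def\<close>)
  moreover have "length ?Es = 4" by simp
  ultimately show ?thesis by metis
qed

text \<open>Four long dual crossings around the box separate it from the boundary of the larger box; they are glued
  by the FKG inequality for the (decreasing) complements of the four one-sided connection events.\<close>

lemma dual_block:
  assumes c: "c \<le> measure (dual M) (hcross 0 (6 * n) 0 (5 * n))" "0 \<le> c" and n: "1 \<le> n" and m: "m \<le> 3 * n"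
  shows "c ^ 112 \<le> 1 - prob (far m (9 * n))"
proof -
  interpret d: perc "dual M" by (rule perc_dual)
  define N where "N = 9 * n"
  define S where "S = lattice_box N"
  define R where "R = cluster_meets S {lattice_box m, {N} \<times> UNIV}"
  have inc: "increasing_event R" unfolding R_def by (rule increasing_cluster_meets) simp
  let ?Z = "vcross (3 * n) (8 * n) (- N - 1) N"
  have Z: "c ^ 28 \<le> measure (dual M) ?Z"
  proof -
    \<comment> \<open>The separating path needs the length \<open>2 * N + 1 = 18 * n + 1\<close>, at
      most \<open>19 * n\<close>, which 14 rectangles and 14 squares provide; hence the exponent 28,
      and 112 for the four sides.\<close>
    have "c ^ (2 * Suc 13) \<le> d.prob (hcross 0 ((6 + int 13) * n) 0 (5 * n))"
      by (rule d.long_prob[OF c]) (use n in simp)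
    also have "\<dots> = d.prob (hcross 0 (19 * n) 0 (5 * n))" by simp
    also have "\<dots> \<le> d.prob (hcross (n - 1) (19 * n) 0 (5 * n))"
      by (rule d.prob_mono) (use n in \<open>auto intro: hcross_shrink\<close>)
    also have "\<dots> = d.prob (hcross (- N - 1) N (3 * n) (8 * n))" by (rule d.hcross_eq) (simp_all add: N_def)
    also have "\<dots> = d.prob ?Z" by (rule d.vcross_hcross[symmetric])
    finally show ?thesis by simp
  qed
  have "R \<inter> dual_preimage ?Z = {}"
  proof (rule ccontr)
    assume "R \<inter> dual_preimage ?Z \<noteq> {}"
    then obtain \<omega> where w: "\<omega> \<in> R" "dual_config \<omega> \<in> ?Z" by (auto simp: dual_preimage_iff)
    obtain u v where uv: "u \<in> lattice_box m" "u \<in> S" "v \<in> {N} \<times> UNIV" "v \<in> clus \<omega> S u"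
      using w(1) unfolding R_def by (rule cluster_meets2E)
    obtain x y z where q: "x \<in> rect (3 * n) (8 * n) (- N - 1) N"
      "(y, - N - 1) \<in> clus (dual_config \<omega>) (rect (3 * n) (8 * n) (- N - 1) N) x"
      "(z, N) \<in> clus (dual_config \<omega>) (rect (3 * n) (8 * n) (- N - 1) N) x" using w(2) by (rule vcrossE)
    have SB: "S = rect (- N) N (- N) N" by (simp add: S_def lattice_box_rect)
    have p1: "(fst u, snd u) \<in> clus \<omega> (rect (- N) N (- N) N) u" by simp
    have p2: "(fst v, snd v) \<in> clus \<omega> (rect (- N) N (- N) N) u" using uv(4) SB by simp
    have "fst u \<le> 3 * n" using uv(1) m by (auto simp: lattice_box_def)
    moreover have "8 * n + 1 \<le> fst v" using uv(3) n by (auto simp: N_def)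
    ultimately show False
      by (rule dual_cross_excl[OF p1 p2 _ _ q(2,3,1)]) (auto simp: rect_iff')
  qed
  then have "R \<union> dual_preimage ?Z \<subseteq> space config_space" "R \<inter> dual_preimage ?Z = {}"
    using increasing_sub_space[OF inc] by (auto simp: dual_preimage_iff)
  moreover have "prob R + prob (dual_preimage ?Z) = prob (R \<union> dual_preimage ?Z)"
    by (rule finite_measure_Union[symmetric]) (use calculation increasing_sets[OF inc] in \<open>simp_all add: events_eq sets_dual_preimage\<close>)
  ultimately have "prob R + prob (dual_preimage ?Z) \<le> 1" by simp
  then have R: "prob R \<le> 1 - c ^ 28" using Z by (simp add: measure_dual)
  have "(c ^ 28) ^ 4 \<le> 1 - prob (far m N)"
    by (rule far_side_pow) (use R c in \<open>simp_all add: R_def S_def\<close>)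
  then show ?thesis by (simp add: N_def power_mult[symmetric])
qed

text \<open>Since \<open>mixing\<close> comes without a rate, blocking at successive scales is
  replaced by an argument with the infimum \<open>q\<close>: it is almost attained at some
  \<open>n\<close>, and a distant annulus, crossed with probability at most
  \<open>1 - c ^ 112\<close>, is nearly independent of the box of radius \<open>n\<close> and would
  push the probability below \<open>q\<close>.\<close>

lemma far_tendsto_0:
  assumes io: "\<And>n0. \<exists>n\<ge>n0. c \<le> measure (dual M) (hcross 0 (6 * n) 0 (5 * n))" and c: "0 < c" and e: "0 < \<epsilon>"
  shows "\<exists>N\<ge>m. prob (far m N) \<le> \<epsilon>"
proof (rule ccontr)
  assume no: "\<not> ?thesis"
  define f where "f N = prob (far m N)" for N
  have fe: "\<epsilon> < f N" if "m \<le> N" for N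
  proof -
    have "\<not> prob (far m N) \<le> \<epsilon>" using no that by blast
    then show ?thesis by (simp add: f_def)
  qed
  define q where "q = Inf (f ` {m..})"
  have bdd: "bdd_below (f ` {m..})" by (rule bdd_belowI[of _ 0]) (auto simp: f_def)
  have qle: "q \<le> f N" if "m \<le> N" for N unfolding q_def using that bdd by (intro cInf_lower) auto
  have "\<epsilon> \<le> q" unfolding q_def using fe by (intro cInf_greatest) (auto intro: less_imp_le)
  then have q0: "0 < q" using e by simp
  have q1: "q \<le> 1" using qle[of m] by (simp add: f_def order_trans[OF _ prob_le_1])
  \<comment> \<open>\<open>q * c ^ 112 = 4 * \<delta>\<close> outweighs the two errors of size
    \<open>\<delta>\<close>, one from the almost minimal \<open>n\<close> and one from
    mixing.\<close>
  define \<delta> where "\<delta> = q * c ^ 112 / 4"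
  have d0: "0 < \<delta>" using q0 c by (simp add: \<delta>_def)
  have "Inf (f ` {m..}) < q + \<delta>" using d0 by (simp add: q_def)
  then obtain n where n: "m \<le> n" "f n < q + \<delta>" using cInf_lessD[of "f ` {m..}"] by force
  obtain N0 where N0: "\<forall>A B. event_supported_in A (lattice_box n) \<longrightarrow>
    event_supported_in B (UNIV - lattice_box N0) \<longrightarrow> prob (A \<inter> B) \<le> prob A * prob B + \<delta>"
    using mixing[OF d0, of n] by blast
  obtain h where h: "max 1 (max \<bar>N0\<bar> (max \<bar>n\<bar> \<bar>m\<bar>)) \<le> h" "c \<le> measure (dual M) (hcross 0 (6 * h) 0 (5 * h))"
    using io by blast
  then have h': "1 \<le> h" "N0 \<le> 3 * h - 1" "n \<le> 3 * h" "m \<le> 3 * h" "m \<le> 9 * h" "n \<le> 9 * h" by auto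
  let ?out = "annulus_crossing (3 * h) (9 * h)"
  have "event_supported_in ?out (UNIV - lattice_box N0)"
    by (rule supported_mono[OF supported_annulus]) (use h' in \<open>auto simp: lattice_box_def\<close>)
  then have mix: "prob (far m n \<inter> ?out) \<le> prob (far m n) * prob ?out + \<delta>"
    using N0 supported_far by blast
  have "far m (9 * h) \<subseteq> far m n \<inter> ?out"
    using far_mono_right[OF n(1) h'(6)] far_annulus[of m "3 * h" "9 * h"] h' by auto
  then have "prob (far m (9 * h)) \<le> prob (far m n \<inter> ?out)"
    by (rule prob_mono) (intro sets.Int sets_far sets_annulus)
  moreover have "prob ?out \<le> 1 - c ^ 112"
  proof -
    have "prob ?out \<le> prob (far (3 * h) (9 * h))" by (rule prob_mono[OF annulus_far]) (use h' in simp_all)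
    then show ?thesis using dual_block[OF h(2) _ h'(1), of "3 * h"] c by simp
  qed
  moreover have "q \<le> prob (far m (9 * h))" using qle[OF h'(5)] by (simp add: f_def)
  ultimately have "q \<le> prob (far m n) * prob ?out + \<delta>" "prob ?out \<le> 1 - c ^ 112" using mix by auto
  moreover have "prob (far m n) * prob ?out \<le> (q + \<delta>) * (1 - c ^ 112)"
    using n(2) \<open>prob ?out \<le> 1 - c ^ 112\<close> q0 d0 by (intro mult_mono) (simp_all add: f_def)
  ultimately have "q \<le> (q + \<delta>) * (1 - c ^ 112) + \<delta>" by linarith
  also have "\<dots> = q - q * c ^ 112 + 2 * \<delta> - \<delta> * c ^ 112" by (simp add: algebra_simps)
  also have "\<dots> < q"
  proof -
    have "q * c ^ 112 = 4 * \<delta>" by (simp add: \<delta>_def)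
    moreover have "0 < \<delta> * c ^ 112" using d0 c by simp
    ultimately show ?thesis using d0 by linarith
  qed
  finally show False by simp
qed

end

section \<open>Infinite clusters and likely square crossings\<close>

lemma cluster_clus: "cluster \<omega> x = clus \<omega> UNIV x"
  by (simp add: cluster_def clus_def openrel_def)

lemma infinite_cluster_far:
  assumes "\<omega> \<in> space config_space" "x \<in> lattice_box m" "infinite (clus \<omega> UNIV x)" "m \<le> N"
  shows "\<omega> \<in> far m N"
proof -
  have "\<not> clus \<omega> UNIV x \<subseteq> lattice_box N"
  proof
    assume "clus \<omega> UNIV x \<subseteq> lattice_box N"
    moreover have "finite (lattice_box N)" by (simp add: lattice_box_rect)
    ultimately have "finite (clus \<omega> UNIV x)" by (rule finite_subset)
    with assms(3) show False by simp
  qed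
  then obtain v where v: "v \<in> clus \<omega> UNIV x" "v \<notin> lattice_box N" by blast
  obtain v' where v': "supn v' = N" "v' \<in> clus \<omega> (UNIV \<inter> {w. supn w \<le> N}) x"
    by (rule clus_shrink_up[OF v(1) _ lattice_lipschitz_supn, of N]) (use v assms in \<open>simp_all add: supn_box\<close>)
  have "UNIV \<inter> {w. supn w \<le> N} \<subseteq> lattice_box N" by (simp add: subset_iff supn_box)
  from clus_monoD[OF v'(2) this] show ?thesis unfolding far_def
    using assms v' by (intro cluster_meets2I[of \<omega> x _ _ v']) (simp_all add: supn_box)
qed

definition inf_at :: "vertex \<Rightarrow> config set" where
  "inf_at x = {\<omega> \<in> space config_space. infinite (clus \<omega> UNIV x)}"

lemma pullback_inf_at:
  "pullback (translation v) -` inf_at x \<inter> space config_space = inf_at (x + v)"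
proof (rule set_eqI)
  fix \<omega>
  have s: "translation v ` UNIV = UNIV"
    unfolding translation_def by (rule surj_plus_right)
  have i: "inj_on (translation v) A" for A by (simp add: translation_def inj_on_def)
  have "clus \<omega> UNIV (translation v x) = translation v ` clus (pullback (translation v) \<omega>) UNIV x"
    using clus_pullback[OF auto_translation[of v], of \<omega> UNIV x] by (simp add: s)
  then have "infinite (clus \<omega> UNIV (x + v)) \<longleftrightarrow> infinite (clus (pullback (translation v) \<omega>) UNIV x)"
    using i by (simp add: translation_def finite_image_iff)
  then show "\<omega> \<in> pullback (translation v) -` inf_at x \<inter> space config_space \<longleftrightarrow> \<omega> \<in> inf_at (x + v)"
    by (auto simp: inf_at_def)
qed

lemma inf_at_0: "inf_at (0, 0) = connected_to_infinity"
  by (simp add: inf_at_def connected_to_infinity_def cluster_clus)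

lemma sets_inf_at: "inf_at x \<in> sets config_space"
proof -
  have "inf_at x = pullback (translation x) -` inf_at (0, 0) \<inter> space config_space"
    using pullback_inf_at[of x "(0, 0)"] by (simp add: zero_prod_def[symmetric])
  then show ?thesis
    using measurable_sets[OF measurable_pullback'[OF auto_translation]] connected_to_infinity_event
    by (simp add: inf_at_0)
qed

lemma lattice_connected_rect: "lattice_connected (rect a b c d)"
  unfolding lattice_connected_def
proof (intro ballI)
  fix u v assume uv: "u \<in> rect a b c d" "v \<in> rect a b c d"
  obtain x y x' y' where xy: "u = (x, y)" "v = (x', y')" by (metis surj_pair)
  let ?R = "\<lambda>C. {(s, t). adjacent s t \<and> s \<in> C \<and> t \<in> C}"
  have "((x, y), (x', y)) \<in> (?R ({a..b} \<times> {y}))\<^sup>*" using lattice_connected_row[of a b y] uv xy unfolding lattice_connected_def by simp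
  moreover have "?R ({a..b} \<times> {y}) \<subseteq> ?R (rect a b c d)" using uv xy by (auto simp: rect_def)
  ultimately have 1: "((x, y), (x', y)) \<in> (?R (rect a b c d))\<^sup>*" using rtrancl_mono by blast
  have "((x', y), (x', y')) \<in> (?R ({x'} \<times> {c..d}))\<^sup>*" using lattice_connected_column[of x' c d] uv xy unfolding lattice_connected_def by simp
  moreover have "?R ({x'} \<times> {c..d}) \<subseteq> ?R (rect a b c d)" using uv xy by (auto simp: rect_def)
  ultimately have "((x', y), (x', y')) \<in> (?R (rect a b c d))\<^sup>*" using rtrancl_mono by blast
  with 1 show "(u, v) \<in> (?R (rect a b c d))\<^sup>*" unfolding xy by (rule rtrancl_trans)
qed

lemma dual_cross_excl_vertical:
  assumes p: "(y1, x1) \<in> clus \<omega> (rect c d a' b') z" "(y2, x2) \<in> clus \<omega> (rect c d a' b') z" "x1 \<le> a" "b \<le> x2"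
    and q: "(t1, s1) \<in> clus (dual_config \<omega>) S w" "(t2, s2) \<in> clus (dual_config \<omega>) S w" "w \<in> S" "t1 < c" "d \<le> t2"
    and S: "\<And>s. s \<in> S \<Longrightarrow> a \<le> snd s \<and> snd s < b"
  shows False
proof -
  let ?s = "prod.swap :: vertex \<Rightarrow> vertex"
  have sw: "?s ` ?s ` A = A" for A by (simp add: image_comp)
  have m: "(j, i) \<in> clus (pullback ?s \<omega>) (?s ` A) (?s x)" if "(i, j) \<in> clus \<omega> A x" for i j A x \<omega>
  proof -
    have "clus \<omega> A x = ?s ` clus (pullback ?s \<omega>) (?s ` A) (?s x)"
      using clus_pullback[OF auto_swap, of \<omega> "?s ` A" "?s x"] by (simp add: sw)
    with that show ?thesis by auto
  qed
  have dm: "pullback ?s (dual_config \<omega>) = dual_config (pullback ?s \<omega>)"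
    by (rule pullback_dual_config[OF auto_swap auto_swap dedge_swap])
  have S': "a \<le> fst s \<and> fst s < b" if "s \<in> ?s ` S" for s
  proof -
    obtain r where "r \<in> S" "s = ?s r" using \<open>s \<in> ?s ` S\<close> by (rule imageE)
    then show ?thesis using S[of r] by simp
  qed
  show False
    by (rule dual_cross_excl[OF m[OF p(1), unfolded swap_rect] m[OF p(2), unfolded swap_rect] p(3,4)
          m[OF q(1), unfolded dm] m[OF q(2), unfolded dm] _ q(4,5) S']) (use q(3) in auto)
qed

text \<open>If the central box is joined to the top and to the bottom, a dual left-right crossing has to
  come close to the central box, since it would survive the opening of all edges of that box otherwise.\<close>

lemma square_trichotomy:
  assumes A: "\<omega> \<in> cluster_meets (lattice_box n) {lattice_box m, UNIV \<times> {n}}"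
    and B: "\<omega> \<in> cluster_meets (lattice_box n) {lattice_box m, UNIV \<times> {- n}}"
    and no: "\<omega> \<notin> vcross (- n) n (- n) n" and mn: "0 \<le> m" "m < n"
  shows "dual_config \<omega> \<in> far (m + 1) n"
proof (rule ccontr)
  assume nfar: "dual_config \<omega> \<notin> far (m + 1) n"
  let ?D = "rect (- n) n (- n) n" and ?S = "rect (- n - 1) n (- n) (n - 1)"
  obtain u v where u: "\<omega> \<in> space config_space" "u \<in> lattice_box m" "u \<in> lattice_box n"
    "v \<in> UNIV \<times> {n}" "v \<in> clus \<omega> (lattice_box n) u" using A by (rule cluster_meets2E)
  obtain u' v' where u': "u' \<in> lattice_box m" "u' \<in> lattice_box n"
    "v' \<in> UNIV \<times> {- n}" "v' \<in> clus \<omega> (lattice_box n) u'" using B by (rule cluster_meets2E)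
  have "\<exists>y y'. - n \<le> y \<and> y < n \<and> (n, y') \<in> clus (dual_config \<omega>) ?S (- n - 1, y)"
  proof (rule dual_crossing_of_no_crossing)
    show "- n \<le> n" "- n \<le> n" using mn by simp_all
    fix x x' assume x: "- n \<le> x" "x \<le> n"
    show "(x', n) \<notin> clus \<omega> ?D (x, - n)"
    proof
      assume c: "(x', n) \<in> clus \<omega> ?D (x, - n)"
      have "\<omega> \<in> vcross (- n) n (- n) n" unfolding vcross_def
        by (rule cluster_meets2I[of \<omega> "(x, - n)" _ _ "(x', n)"]) (use u x c mn in auto)
      with no show False by simp
    qed
  qed
  then obtain y y' where y: "- n \<le> y" "y < n" "(n, y') \<in> clus (dual_config \<omega>) ?S (- n - 1, y)" by blast
  have sS: "(- n - 1, y) \<in> ?S" using y mn by simp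
  \<comment> \<open>A dual crossing that touches the box of radius \<open>m + 1\<close> leads from
    there to distance \<open>n\<close>, which \<open>nfar\<close> forbids.\<close>
  have avoid: "w \<notin> lattice_box (m + 1)" if w: "w \<in> clus (dual_config \<omega>) ?S (- n - 1, y)" for w
  proof
    assume wm: "w \<in> lattice_box (m + 1)"
    have wS: "w \<in> ?S" by (rule subsetD[OF clus_sub[OF sS] w])
    have c: "(n, y') \<in> clus (dual_config \<omega>) ?S w" unfolding clus_eq[OF w] by (rule y(3))
    have "supn w \<le> n" "n \<le> supn (n, y')" using wm mn by (auto simp: supn_box supn_def)
    then obtain q where q: "supn q = n" "q \<in> clus (dual_config \<omega>) (?S \<inter> {w. supn w \<le> n}) w"
      by (rule clus_shrink_up[OF c wS lattice_lipschitz_supn])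
    have "?S \<inter> {w. supn w \<le> n} \<subseteq> lattice_box n" by (simp add: subset_iff supn_box)
    from clus_monoD[OF q(2) this] have "dual_config \<omega> \<in> far (m + 1) n" unfolding far_def
      by (intro cluster_meets2I[of _ w _ _ q]) (use q wm \<open>supn w \<le> n\<close> in \<open>simp_all add: supn_box\<close>)
    with nfar show False by simp
  qed
  \<comment> \<open>Opening all edges of the central box keeps the dual crossing, which stays away
    from it, but joins the top to the bottom.\<close>
  define \<omega>' where "\<omega>' e \<longleftrightarrow> \<omega> e \<or> e \<subseteq> lattice_box m" for e
  have "((- n - 1, y), (n, y')) \<in> {(s, t). (s, t) \<in> openrel (dual_config \<omega>) ?S \<and>
      s \<in> clus (dual_config \<omega>) ?S (- n - 1, y) \<and> t \<in> clus (dual_config \<omega>) ?S (- n - 1, y)}\<^sup>*"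
    using y(3) by (rule clus_path)
  moreover have "{(s, t). (s, t) \<in> openrel (dual_config \<omega>) ?S \<and>
      s \<in> clus (dual_config \<omega>) ?S (- n - 1, y) \<and> t \<in> clus (dual_config \<omega>) ?S (- n - 1, y)} \<subseteq> openrel (dual_config \<omega>') ?S"
  proof (rule subrelI)
    fix s t assume "(s, t) \<in> {(s, t). (s, t) \<in> openrel (dual_config \<omega>) ?S \<and>
      s \<in> clus (dual_config \<omega>) ?S (- n - 1, y) \<and> t \<in> clus (dual_config \<omega>) ?S (- n - 1, y)}"
    then have st: "s \<in> ?S" "t \<in> ?S" "adjacent s t" "dual_config \<omega> {s, t}" "s \<notin> lattice_box (m + 1)" "t \<notin> lattice_box (m + 1)"
      using avoid by (simp_all add: openrel_def)
    have "s \<in> dedge {s, t} \<or> t \<in> dedge {s, t}" by (rule dedge_meets[OF st(3)])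
    moreover have "s \<notin> lattice_box m" "t \<notin> lattice_box m" using st(5,6) by (simp_all add: supn_box)
    ultimately have "\<not> dedge {s, t} \<subseteq> lattice_box m" by blast
    then have "dual_config \<omega>' {s, t}" using st(3,4) by (simp add: dual_config_adjacent \<omega>'_def)
    then show "(s, t) \<in> openrel (dual_config \<omega>') ?S" using st by (simp add: openrel_def)
  qed
  ultimately have d: "(n, y') \<in> clus (dual_config \<omega>') ?S (- n - 1, y)" unfolding clus_def
    using rtrancl_mono by blast
  have bn: "lattice_box n = ?D" by (rule lattice_box_rect)
  have mon: "clus \<omega> ?D z \<subseteq> clus \<omega>' ?D z" for z by (rule clus_mono_config) (simp add: \<omega>'_def)
  have "(u, u') \<in> {(s, t). adjacent s t \<and> s \<in> lattice_box m \<and> t \<in> lattice_box m}\<^sup>*"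
    using lattice_connected_rect[of "- m" m "- m" m] u(2) u'(1) unfolding lattice_connected_def lattice_box_rect by blast
  moreover have "{(s, t). adjacent s t \<and> s \<in> lattice_box m \<and> t \<in> lattice_box m} \<subseteq> openrel \<omega>' ?D"
    unfolding openrel_def bn[symmetric] using mn
    by (intro subrelI) (simp add: \<omega>'_def supn_box)
  ultimately have "(u, u') \<in> (openrel \<omega>' ?D)\<^sup>*" using rtrancl_mono by blast
  then have uu: "u' \<in> clus \<omega>' ?D u" by (simp add: clus_def)
  have v: "v \<in> clus \<omega>' ?D u" by (rule subsetD[OF mon u(5)[unfolded bn]])
  have "v' \<in> clus \<omega>' ?D u'" by (rule subsetD[OF mon u'(4)[unfolded bn]])
  then have v': "v' \<in> clus \<omega>' ?D u" by (rule clus_trans[OF uu])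
  have "(fst v', - n) = v'" "(fst v, n) = v" using u(4) u'(3) by (simp_all add: mem_Times_iff prod_eq_iff)
  then have pv: "(fst v', - n) \<in> clus \<omega>' ?D u" "(fst v, n) \<in> clus \<omega>' ?D u" using v v' by simp_all
  show False
    by (rule dual_cross_excl_vertical[where a = "- n" and b = n, OF pv _ _ clus_refl d sS]) (use mn in \<open>auto simp: rect_iff'\<close>)
qed

context perc
begin

text \<open>The union of all \<open>inf_at x\<close> is shift invariant and of positive probability,
  hence certain by ergodicity. By continuity from below, a finite box already meets an infinite
  cluster with probability above \<open>1 - \<epsilon>\<close>, and this bounds all \<open>N\<close>
  at once.\<close>

lemma infinite_far:
  assumes erg: "shift_ergodic M" and pos: "0 < prob connected_to_infinity" and e: "0 < \<epsilon>"
  shows "\<exists>m. \<forall>N\<ge>int m. 1 - \<epsilon> < prob (far (int m) N)"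
proof -
  define U where "U = (\<Union>x. inf_at x)"
  have sU: "U \<in> sets config_space" unfolding U_def using sets_inf_at by (intro sets.countable_UN') auto
  have "pullback (translation v) -` U \<inter> space M = U" for v
  proof -
    have "pullback (translation v) -` U \<inter> space config_space = (\<Union>x. pullback (translation v) -` inf_at x \<inter> space config_space)"
      by (auto simp: U_def)
    also have "\<dots> = (\<Union>x. inf_at (x + v))" by (simp only: pullback_inf_at)
    also have "\<dots> = U"
    proof -
      have r: "range (\<lambda>x. x + v) = UNIV" by (rule surj_plus_right)
      have "(\<Union>x. inf_at (x + v)) = (\<Union>y\<in>range (\<lambda>x. x + v). inf_at y)" by (simp only: image_image)
      then show ?thesis unfolding U_def r .
    qed
    finally show ?thesis by (simp add: space_M)
  qed
  then have "prob U = 0 \<or> prob U = 1" using erg sU sets_M unfolding shift_ergodic_def by blast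
  moreover have "prob connected_to_infinity \<le> prob U"
    by (rule prob_mono[OF _ sU]) (auto simp: U_def inf_at_0[symmetric])
  ultimately have U1: "prob U = 1" using pos by auto
  define I where "I m = (\<Union>x\<in>lattice_box (int m). inf_at x)" for m :: nat
  have "range I \<subseteq> events"
    unfolding I_def events_eq using sets_inf_at by (auto intro!: sets.finite_UN simp: lattice_box_rect)
  moreover have "incseq I"
    unfolding incseq_def I_def by (intro allI impI UN_mono) (auto simp: lattice_box_def)
  ultimately have "(\<lambda>m. prob (I m)) \<longlonglongrightarrow> prob (\<Union>m. I m)" by (rule finite_Lim_measure_incseq)
  moreover have "(\<Union>m. I m) = U"
  proof -
    have "(\<Union>m. lattice_box (int m)) = UNIV"
    proof (intro equalityI subsetI)
      fix p :: vertex
      have "p \<in> lattice_box (int (nat (supn p)))" by (simp add: supn_box)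
      then show "p \<in> (\<Union>m. lattice_box (int m))" by blast
    qed simp
    moreover have "(\<Union>m. I m) = (\<Union>x\<in>(\<Union>m. lattice_box (int m)). inf_at x)" unfolding I_def by blast
    ultimately show ?thesis by (simp add: U_def)
  qed
  ultimately have "(\<lambda>m. prob (I m)) \<longlonglongrightarrow> 1" by (simp add: U1)
  then have "eventually (\<lambda>m. 1 - \<epsilon> < prob (I m)) sequentially" by (rule order_tendstoD) (use e in simp)
  then obtain m where m: "1 - \<epsilon> < prob (I m)" by (auto simp: eventually_sequentially)
  have "1 - \<epsilon> < prob (far (int m) N)" if "int m \<le> N" for N
  proof -
    have "I m \<subseteq> far (int m) N"
    proof
      fix \<omega> assume "\<omega> \<in> I m"
      then obtain x where x: "x \<in> lattice_box (int m)" "\<omega> \<in> inf_at x" unfolding I_def by blast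
      then show "\<omega> \<in> far (int m) N" using infinite_cluster_far[OF _ x(1) _ that, of \<omega>] by (simp add: inf_at_def)
    qed
    then have "prob (I m) \<le> prob (far (int m) N)" by (rule prob_mono) simp
    with m show ?thesis by simp
  qed
  then show ?thesis by blast
qed

lemma square_tendsto_1:
  assumes erg: "shift_ergodic M" and pos: "0 < prob connected_to_infinity"
    and dual_far: "\<And>m \<epsilon>. 0 < \<epsilon> \<Longrightarrow> \<exists>N\<ge>m. measure (dual M) (far m N) \<le> \<epsilon>" and e: "0 < \<epsilon>"
  shows "\<exists>n0. \<forall>n\<ge>n0. 1 - prob (hcross 0 (2 * n) (- n) n) \<le> \<epsilon>"
proof -
  interpret d: perc "dual M" by (rule perc_dual)
  \<comment> \<open>Three things can go wrong: the connections to the top and to the bottom may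
    fail, and a dual connection may occur. The fourth power of \<open>h\<close> pays for the
    square-root trick over four sides.\<close>
  define h where "h = \<epsilon> / 3"
  have h: "0 < h" using e by (simp add: h_def)
  obtain m where m: "\<forall>N\<ge>int m. 1 - h ^ 4 < prob (far (int m) N)" using infinite_far[OF erg pos, of "h ^ 4"] h by auto
  obtain N where N: "int m + 1 \<le> N" "d.prob (far (int m + 1) N) \<le> h" using dual_far[OF h, of "int m + 1"] by blast
  have "1 - prob (hcross 0 (2 * n) (- n) n) \<le> \<epsilon>" if n: "N \<le> n" for n
  proof -
    let ?E = "\<lambda>V. cluster_meets (lattice_box n) {lattice_box (int m), V}"
    have "\<not> h \<le> 1 - prob (?E ({n} \<times> UNIV))"
    proof
      assume "h \<le> 1 - prob (?E ({n} \<times> UNIV))"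
      from far_side_pow[OF this] h have "h ^ 4 \<le> 1 - prob (far (int m) n)" by simp
      moreover have "1 - h ^ 4 < prob (far (int m) n)" using m n N by simp
      ultimately show False by simp
    qed
    then have s: "1 - h < prob (?E (UNIV \<times> {n}))" "1 - h < prob (?E (UNIV \<times> {- n}))" by (simp_all add: side_probs)
    let ?A = "?E (UNIV \<times> {n})" and ?B = "?E (UNIV \<times> {- n})" and ?V = "vcross (- n) n (- n) n" and ?F = "dual_preimage (far (int m + 1) n)"
    have sets: "?A \<in> events" "?B \<in> events" "?V \<in> events" "?F \<in> events"
      unfolding events_eq by (simp_all add: sets_cluster_meets sets_dual_preimage)
    have "?A \<inter> ?B \<subseteq> ?V \<union> ?F"
    proof
      fix \<omega> assume w: "\<omega> \<in> ?A \<inter> ?B"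
      then have "\<omega> \<in> space config_space" using cluster_meets_sub_space by blast
      with square_trichotomy[of \<omega> n "int m"] w n N show "\<omega> \<in> ?V \<union> ?F" by (auto simp: dual_preimage_iff)
    qed
    then have "prob (?A \<inter> ?B) \<le> prob (?V \<union> ?F)" using sets by (intro finite_measure_mono) auto
    also have "\<dots> \<le> prob ?V + prob ?F" by (rule measure_Un_le) (use sets in auto)
    also have "prob ?F = d.prob (far (int m + 1) n)" by (simp add: measure_dual)
    also have "\<dots> \<le> d.prob (far (int m + 1) N)" by (rule d.prob_mono[OF far_mono_right]) (use n N in simp_all)
    finally have 1: "prob (?A \<inter> ?B) \<le> prob ?V + h" using N by simp
    have "prob (?A \<union> ?B) = prob ?A + prob ?B - prob (?A \<inter> ?B)"
      using finite_measure_Union'[OF sets(1,2)] finite_measure_Diff'[OF sets(2,1)] by (simp add: Int_commute)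
    moreover have "prob (?A \<union> ?B) \<le> 1" by simp
    ultimately have "1 - 3 * h \<le> prob ?V" using 1 s by linarith
    moreover have "prob ?V = prob (hcross 0 (2 * n) (- n) n)" unfolding vcross_hcross by (rule hcross_eq) simp_all
    ultimately show ?thesis by (simp add: h_def)
  qed
  then show ?thesis by blast
qed

end

section \<open>Hard-way crossings of probability close to 1\<close>

context perc
begin

text \<open>The induction on arches is repeated. Squares are now crossed with probability close to 1
  at all large scales, so every step stays within the model and all constants can be taken close to
  1.\<close>

lemma hard_tendsto_1:
  assumes H: "\<And>\<epsilon>. 0 < \<epsilon> \<Longrightarrow> \<exists>n0. \<forall>n\<ge>n0. 1 - prob (hcross 0 (2 * n) (- n) n) \<le> \<epsilon>" and e: "0 < \<eta>" "\<eta> < 1"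
  shows "\<exists>n\<ge>n0. 1 - prob (hcross 0 (6 * n) 0 (5 * n)) \<le> \<eta>"
proof (rule ccontr)
  assume no: "\<not> ?thesis"
  \<comment> \<open>By Bernoulli's inequality, \<open>5 * 217 = 1085 < 2000\<close> keeps the
    stacked arches above \<open>1 - \<eta>\<close>, and the loss \<open>5 * d + 2 * \<delta>\<close>
    of the window argument is below \<open>\<eta>\<close>. The factor 1/2 in
    \<open>\<epsilon>\<close> provides the strict inequality that \<open>step_single\<close> asks
    for.\<close>
  define d where "d = \<eta> / 2000"
  define \<delta> where "\<delta> = \<eta> / 8"
  define u where "u = 1 - d"
  have d: "0 < d" "d < 1" and \<delta>: "0 < \<delta>" "\<delta> < 1" and u: "0 < u" "u < 1"
    using e by (simp_all add: d_def \<delta>_def u_def)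
  have bern: "1 - real k * d \<le> u ^ k" for k
    using Bernoulli_inequality[of "- d" k] d by (simp add: u_def)
  define \<epsilon> where "\<epsilon> = \<delta> ^ 9 * d ^ 4 / 2"
  have ep: "0 < \<epsilon>" using d \<delta> by (simp add: \<epsilon>_def)
  have "\<delta> ^ 9 \<le> 1" "d ^ 2 \<le> 1" using d \<delta> by (simp_all add: power_le_one)
  then have "\<delta> ^ 9 * d ^ 4 \<le> 1 * d ^ 4" by (intro mult_right_mono) (use d in simp_all)
  also have "\<dots> \<le> d ^ 2" using d by (simp add: power_decreasing)
  finally have ed2: "\<epsilon> < d ^ 2" using ep by (simp add: \<epsilon>_def)
  have "d ^ 2 \<le> d ^ 1" using d by (intro power_decreasing) simp_all
  with ed2 have ed: "\<epsilon> < d" by simp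
  obtain n1 where n1: "\<forall>n\<ge>n1. 1 - prob (hcross 0 (2 * n) (- n) n) \<le> \<epsilon>" using H[OF ep] by blast
  define m where "m = max n0 (max n1 96)"
  have m0: "96 \<le> m" "n0 \<le> m" "n1 \<le> m" by (simp_all add: m_def)
  have small: "prob (hcross 0 (6 * n) 0 (5 * n)) < 1 - \<eta>" if "m \<le> n" for n
  proof -
    have "n0 \<le> n" using that m0 by simp
    with no have "\<not> 1 - prob (hcross 0 (6 * n) 0 (5 * n)) \<le> \<eta>" by blast
    then show ?thesis by simp
  qed
  have sq: "1 - prob (hcross 0 (2 * n) (- n) n) \<le> \<epsilon>" if "m \<le> n" for n using n1 that m0 by simp
  have squ: "u \<le> prob (hcross 0 (2 * n) (- n) n)" if "m \<le> n" for n using sq[OF that] ed by (simp add: u_def)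
  have arch: "u ^ 5 \<le> prob (Arch 0 0 (2 ^ j * m) (4 ^ j - 1)) \<and> 48 * 4 ^ j \<le> 2 ^ j * m" for j
  proof -
    have big: "48 * 4 ^ j \<le> 2 ^ j * m" if "u ^ 5 \<le> prob (Arch 0 0 (2 ^ j * m) (4 ^ j - 1))" for j
    proof (rule ccontr)
      assume "\<not> ?thesis"
      then have 1: "2 ^ j * m < 48 * (4 ^ j - 1 + 1)" by simp
      have "1 * m \<le> 2 ^ j * m" by (rule mult_right_mono) (use m0 in simp_all)
      then have 2: "m \<le> 2 ^ j * m" "96 \<le> 2 ^ j * m" using m0 by linarith+
      have "(u ^ 5) ^ 217 \<le> prob (hcross 0 (6 * (2 ^ j * m)) 0 (5 * (2 ^ j * m)))"
        by (rule arch_hard[OF that _ 1 2(2)]) (use u in simp)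
      moreover have "1 - \<eta> \<le> (u ^ 5) ^ 217"
        using bern[of "5 * 217"] e by (simp add: power_mult[symmetric] d_def)
      ultimately show False using small[OF 2(1)] by simp
    qed
    have "u ^ 5 \<le> prob (Arch 0 0 (2 ^ j * m) (4 ^ j - 1))"
    proof (induction j)
      case 0
      have "u \<le> prob (Arm 0 (2 * m) (- m) m UNIV {0..})"
      proof (rule ccontr)
        assume "\<not> ?thesis"
        then have "d ^ 2 \<le> 1 - prob (hcross 0 (2 * m) (- m) m)" by (intro base_arm) (use d in \<open>simp_all add: u_def\<close>)
        with sq[of m] ed2 show False by simp
      qed
      from square_arch[OF squ this] u show ?case by simp
    next
      case (Suc j)
      define n where "n = 2 ^ j * m"
      define g where "g = (4 ^ j - 1 :: int)"
      have g: "0 \<le> g" "48 * (g + 1) \<le> n" using big[OF Suc] by (simp_all add: g_def n_def)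
      have "1 * m \<le> 2 ^ j * m" by (rule mult_right_mono) (use m0 in simp_all)
      then have n: "m \<le> n" "0 \<le> n" using m0 unfolding n_def by linarith+
      note IH = Suc[folded n_def g_def]
      have n2: "m \<le> 2 * n" using n by simp
      have "1 - prob (hcross 0 (4 * n) (- 2 * n) (2 * n)) \<le> \<epsilon>" using sq[OF n2] by simp
      also have "\<dots> < \<delta> ^ 9 * d ^ 4"
      proof -
        have "\<delta> ^ 9 * d ^ 4 = 2 * \<epsilon>" by (simp add: \<epsilon>_def)
        then show ?thesis using ep by linarith
      qed
      finally have 1: "1 - prob (hcross 0 (4 * n) (- 2 * n) (2 * n)) < \<delta> ^ 9 * d ^ 4" .
      have "1 - d \<le> prob (Arm 0 (4 * n) (- 2 * n) (2 * n) UNIV {4 * (g + 1)..}) \<or>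
        u ^ 5 * (1 - \<delta>) * (1 - \<delta>) \<le> prob (hcross 0 (6 * n) 0 (5 * n))"
        by (rule step_single[OF IH _ _ _ _ g(1) _ 1]) (use g u d \<delta> in simp_all)
      then show ?case
      proof
        assume "1 - d \<le> prob (Arm 0 (4 * n) (- 2 * n) (2 * n) UNIV {4 * (g + 1)..})"
        then have "u \<le> prob (Arm 0 (2 * (2 * n)) (- (2 * n)) (2 * n) UNIV {4 * (g + 1)..})" by (simp add: u_def)
        from square_arch[OF squ[OF n2] this] u have "u ^ 5 \<le> prob (Arch 0 0 (2 * n) (4 * (g + 1)))" by simp
        also have "\<dots> \<le> prob (Arch 0 0 (2 * n) (4 ^ Suc j - 1))" by (rule prob_mono[OF Arch_mono]) (simp_all add: g_def)
        finally show ?case by (simp add: n_def mult.assoc)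
      next
        assume a: "u ^ 5 * (1 - \<delta>) * (1 - \<delta>) \<le> prob (hcross 0 (6 * n) 0 (5 * n))"
        have "(1 - 5 * d) * (1 - 2 * \<delta>) \<le> u ^ 5 * (1 - 2 * \<delta>)"
          using bern[of 5] e by (intro mult_right_mono) (simp_all add: \<delta>_def)
        also have "\<dots> \<le> u ^ 5 * ((1 - \<delta>) * (1 - \<delta>))" using u by (intro mult_left_mono) (simp_all add: algebra_simps)
        finally have "(1 - 5 * d) * (1 - 2 * \<delta>) \<le> prob (hcross 0 (6 * n) 0 (5 * n))" using a by (simp add: mult.assoc)
        moreover have "1 - \<eta> \<le> (1 - 5 * d) * (1 - 2 * \<delta>)"
        proof -
          have "(1 - 5 * d) * (1 - 2 * \<delta>) = 1 - 5 * d - 2 * \<delta> + 10 * (d * \<delta>)" by (simp add: algebra_simps)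
          moreover have "0 \<le> d * \<delta>" using d \<delta> by simp
          ultimately show ?thesis using e unfolding d_def \<delta>_def by linarith
        qed
        ultimately show ?case using small[OF n(1)] by simp
      qed
    qed
    then show ?thesis using big by blast
  qed
  have 1: "48 * 4 ^ nat m \<le> 2 ^ nat m * m" using arch[of "nat m"] by blast
  have "nat m < 2 ^ nat m" by (rule less_exp)
  then have "int (nat m) < int (2 ^ nat m)" by linarith
  then have "m < 2 ^ nat m" using m0 by simp
  then have "2 ^ nat m * m \<le> 2 ^ nat m * 2 ^ nat m" by (intro mult_left_mono) simp_all
  also have "\<dots> = (4 :: int) ^ nat m" by (simp add: power_mult_distrib[symmetric])
  finally have "48 * 4 ^ nat m \<le> (4 :: int) ^ nat m" using 1 by linarith
  moreover have "(0 :: int) < 4 ^ nat m" by simp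
  ultimately show False by linarith
qed

lemma Conj_union_bound:
  assumes "\<And>E. E \<in> set Es \<Longrightarrow> E \<in> sets config_space" "\<And>E. E \<in> set Es \<Longrightarrow> 1 - prob E \<le> \<beta>"
  shows "1 - prob (Conj Es) \<le> real (length Es) * \<beta>"
  using assms
proof (induction Es)
  case Nil
  then show ?case using prob_space by (simp add: Conj_Nil space_M[symmetric])
next
  case (Cons E Es)
  have s: "E \<in> events" "Conj Es \<in> events"
    using Cons.prems(1) sets_Conj[of Es] unfolding events_eq by auto
  have "E \<subseteq> space config_space" using s(1) sets.sets_into_space space_M by blast
  then have c: "Conj (E # Es) = E \<inter> Conj Es" by (rule Conj_simps)
  have "prob (E \<union> Conj Es) = prob E + prob (Conj Es) - prob (E \<inter> Conj Es)"
    using finite_measure_Union'[OF s] finite_measure_Diff'[OF s(2,1)] by (simp add: Int_commute)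
  moreover have "prob (E \<union> Conj Es) \<le> 1" by simp
  moreover have "1 - prob (Conj Es) \<le> real (length Es) * \<beta>" using Cons by simp
  moreover have "1 - prob E \<le> \<beta>" using Cons.prems by simp
  moreover have "real (length (E # Es)) * \<beta> = real (length Es) * \<beta> + \<beta>" by (simp add: algebra_simps)
  ultimately show ?case unfolding c by linarith
qed

lemma square_of_hard:
  assumes n: "0 \<le> n"
  shows "prob (hcross 0 (6 * n) 0 (5 * n)) \<le> prob (vcross (a * n) (a * n + 5 * n) t (t + 5 * n))"
proof -
  have "prob (hcross 0 (6 * n) 0 (5 * n)) \<le> prob (hcross n (6 * n) 0 (5 * n))"
    by (rule prob_mono) (use n in \<open>auto intro: hcross_shrink\<close>)
  also have "\<dots> = prob (vcross (a * n) (a * n + 5 * n) t (t + 5 * n))" unfolding vcross_hcross by (rule hcross_eq) simp_all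
  finally show ?thesis .
qed

lemma long_union_bound:
  assumes n: "0 \<le> n"
  shows "1 - prob (hcross 0 ((6 + int k) * n) 0 (5 * n)) \<le> real (2 * Suc k) * (1 - prob (hcross 0 (6 * n) 0 (5 * n)))"
proof -
  let ?H = "\<lambda>i. hcross (int i * n) (int i * n + 6 * n) 0 (5 * n)" and ?V = "\<lambda>i. vcross (int i * n) (int i * n + 5 * n) 0 (5 * n)"
  let ?Es = "map ?H [0..<Suc k] @ map ?V [0..<Suc k]"
  have H: "prob (?H i) = prob (hcross 0 (6 * n) 0 (5 * n))" for i by (rule hcross_eq) simp_all
  have V: "prob (hcross 0 (6 * n) 0 (5 * n)) \<le> prob (?V i)" for i using square_of_hard[OF n, of "int i" 0] by simp
  have l: "length ?Es = 2 * Suc k" by simp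
  have "1 - prob (Conj ?Es) \<le> real (length ?Es) * (1 - prob (hcross 0 (6 * n) 0 (5 * n)))"
  proof (rule Conj_union_bound)
    fix E assume "E \<in> set ?Es"
    then obtain i where "E = ?H i \<or> E = ?V i" by auto
    then show "E \<in> sets config_space" "1 - prob E \<le> 1 - prob (hcross 0 (6 * n) 0 (5 * n))"
      using H[of i] V[of i] by auto
  qed
  moreover have "prob (Conj ?Es) \<le> prob (hcross 0 ((6 + int k) * n) 0 (5 * n))"
  proof (rule prob_mono)
    show "Conj ?Es \<subseteq> hcross 0 ((6 + int k) * n) 0 (5 * n)"
    proof
      fix \<omega> assume w: "\<omega> \<in> Conj ?Es"
      show "\<omega> \<in> hcross 0 ((6 + int k) * n) 0 (5 * n)"
      proof (rule long_crossing[OF _ _ n])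
        fix i assume "i \<le> k"
        then have "?H i \<in> set ?Es" "?V i \<in> set ?Es"
          unfolding set_append set_map set_upt by (intro UnI1 imageI UnI2; simp)+
        then show "\<omega> \<in> ?H i" "\<omega> \<in> ?V i" using ConjD[OF w] by blast+
      qed
    qed
  qed simp
  ultimately show ?thesis unfolding l by linarith
qed

end

lemma supported_pullback:
  assumes A: "event_supported_in A S" and g: "lattice_auto g"
  shows "event_supported_in (pullback g -` A \<inter> space config_space) (g ` S)"
proof (rule supportedI)
  show "pullback g -` A \<inter> space config_space \<in> sets config_space"
    using measurable_pullback'[OF g] supported_sets[OF A] by (rule measurable_sets)
  fix \<omega> \<omega>' assume a: "\<omega> \<in> space config_space" "\<omega>' \<in> space config_space"
    "\<And>e. e \<in> edges_within (g ` S) \<Longrightarrow> \<omega> e = \<omega>' e"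
  have "(pullback g \<omega> \<in> A) = (pullback g \<omega>' \<in> A)"
  proof (rule supportedD[OF A])
    fix e assume e: "e \<in> edges_within S"
    then have "e \<in> lattice_edges" "g ` e \<subseteq> g ` S" by (auto simp: edges_within_def)
    then show "pullback g \<omega> e = pullback g \<omega>' e"
      using a(3)[of "g ` e"] auto_edge[OF g] by (simp add: pullback_def edges_within_def)
  qed simp_all
  then show "(\<omega> \<in> pullback g -` A \<inter> space config_space) = (\<omega>' \<in> pullback g -` A \<inter> space config_space)"
    using a(1,2) by simp
qed

text \<open>Below \<open>1 / (2 * K)\<close> the quadratic term is at most \<open>x j / 2\<close>,
  so the recursion becomes \<open>x (Suc j) \<le> x j / 2 + K * \<rho> j\<close>, and the bound on
  \<open>\<kappa>\<close> keeps the sequence below that threshold. Carrying the extra term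
  \<open>2 * x J\<close> makes the sum telescope.\<close>

lemma renormalisation_sum:
  fixes x \<rho> :: "nat \<Rightarrow> real"
  assumes nn: "\<And>j. 0 \<le> x j" "\<And>j. 0 \<le> \<rho> j" and K: "0 < K"
    and step: "\<And>j. x (Suc j) \<le> K * ((x j)\<^sup>2 + \<rho> j)" and x0: "x 0 \<le> 1 / (2 * K)"
    and sum: "\<And>J. (\<Sum>j<J. \<rho> j) \<le> \<kappa>" and kap: "\<kappa> \<le> 1 / (4 * K\<^sup>2)"
  shows "(\<Sum>j<J. x j) \<le> 2 * x 0 + 2 * K * \<kappa>"
proof -
  have rk: "\<rho> j \<le> \<kappa>" for j
  proof -
    have "\<rho> j \<le> (\<Sum>j<Suc j. \<rho> j)" using sum_nonneg[of "{..<j}" \<rho>] nn by simp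
    with sum[of "Suc j"] show ?thesis by simp
  qed
  have small: "x j \<le> 1 / (2 * K)" and half: "x (Suc j) \<le> x j / 2 + K * \<rho> j" for j
  proof -
    have *: "x (Suc j) \<le> x j / 2 + K * \<rho> j" if "x j \<le> 1 / (2 * K)" for j
    proof -
      have "K * (x j)\<^sup>2 = (K * x j) * x j" by (simp add: power2_eq_square)
      also have "\<dots> \<le> (1 / 2) * x j" using that K nn(1)[of j] by (intro mult_right_mono) (simp_all add: field_simps)
      finally show ?thesis using step[of j] by (simp add: algebra_simps)
    qed
    have s: "x j \<le> 1 / (2 * K)" for j
    proof (induction j)
      case (Suc j)
      have "K * \<rho> j \<le> K * (1 / (4 * K\<^sup>2))" using rk[of j] kap K by (intro mult_left_mono) simp_all
      also have "\<dots> = 1 / (4 * K)" using K by (simp add: power2_eq_square)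
      finally have "K * \<rho> j \<le> 1 / (4 * K)" .
      moreover have "x j / 2 \<le> 1 / (4 * K)" using Suc K by (simp add: field_simps)
      ultimately have "x (Suc j) \<le> 1 / (4 * K) + 1 / (4 * K)" using *[OF Suc] by linarith
      then show ?case using K by (simp add: field_simps)
    qed (rule x0)
    show "x j \<le> 1 / (2 * K)" by (rule s)
    show "x (Suc j) \<le> x j / 2 + K * \<rho> j" by (rule *[OF s])
  qed
  have "(\<Sum>j<J. x j) + 2 * x J \<le> 2 * x 0 + 2 * K * (\<Sum>j<J. \<rho> j)"
  proof (induction J)
    case (Suc J)
    have "2 * x (Suc J) \<le> x J + 2 * K * \<rho> J" using half[of J] by simp
    moreover have "2 * K * (\<Sum>j<Suc J. \<rho> j) = 2 * K * (\<Sum>j<J. \<rho> j) + 2 * K * \<rho> J" by (simp add: algebra_simps)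
    ultimately show ?case using Suc by simp
  qed simp
  moreover have "2 * K * (\<Sum>j<J. \<rho> j) \<le> 2 * K * \<kappa>" using sum K by (intro mult_left_mono) simp_all
  ultimately show ?thesis using nn(1)[of J] by linarith
qed

text \<open>Condensation: as \<open>r\<close> does not increase and \<open>b\<close> is at least 2,
  the terms of the series between \<open>b ^ J * m\<close> and \<open>b ^ Suc J * m\<close> add up
  to at least \<open>r (b ^ Suc J * m) / 2\<close>. Summability of \<open>r n / n\<close> enters the
  proof only through this bound.\<close>

lemma geometric_scales_sum:
  fixes r :: "nat \<Rightarrow> real"
  assumes nn: "\<And>n. 1 \<le> n \<Longrightarrow> 0 \<le> r n" and anti: "\<And>m n. 1 \<le> m \<Longrightarrow> m \<le> n \<Longrightarrow> r n \<le> r m"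
    and summ: "summable (\<lambda>n. r (Suc n) / real (Suc n))" and b: "2 \<le> b" and e: "0 < \<kappa>"
  shows "\<exists>n1\<ge>1. \<forall>n\<ge>n1. \<forall>J. (\<Sum>j<J. r (b ^ j * n)) \<le> \<kappa>"
proof -
  let ?s = "\<lambda>n. r (Suc n) / real (Suc n)"
  have aux1: "X \<le> 2 * (X - Y)" if "2 * Y \<le> Z" "X = Z" for X Y Z :: real using that by simp
  have aux2: "q / 2 \<le> C * (q / X)" if "q * X \<le> q * (2 * (X - Y))" "C = X - Y" "0 < X" for q X Y C :: real
  proof -
    have "q / 2 * X \<le> C * q" using that(1) unfolding that(2) by (simp add: algebra_simps)
    then show ?thesis using that(3) by (simp add: pos_le_divide_eq)
  qed
  obtain N where N: "\<forall>m\<ge>N. \<forall>n. norm (sum ?s {m..<n}) < \<kappa> / 2"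
    using summ e unfolding summable_Cauchy by (meson half_gt_zero)
  have "(\<Sum>j<J. r (b ^ j * n)) \<le> \<kappa>" if n: "b * (N + 1) \<le> n" for n J
  proof -
    \<comment> \<open>The blocks start one scale lower: \<open>b * m \<le> n\<close> puts
      \<open>b ^ J * n\<close> at or beyond the end of block \<open>J\<close>.\<close>
    define m where "m = n div b"
    have m: "N + 1 \<le> m" "b * m \<le> n" using n b by (simp_all add: m_def less_eq_div_iff_mult_less_eq mult.commute)
    have "(\<Sum>j<J. r (b ^ j * n)) \<le> 2 * sum ?s {m..<b ^ J * m}"
    proof (induction J)
      case (Suc J)
      let ?M = "b ^ J * m"
      have M: "1 \<le> ?M" using m b by simp
      have bM: "b ^ Suc J * m = b * ?M" by simp
      have Mb: "m \<le> ?M" "?M \<le> b * ?M" using b by simp_all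
      have "r (b ^ J * n) \<le> r (b * ?M)" using m(2) M b by (intro anti) (simp_all add: mult.left_commute)
      also have "\<dots> \<le> 2 * sum ?s {?M..<b * ?M}"
      proof -
        have "of_nat (card {?M..<b * ?M}) * (r (b * ?M) / real (b * ?M)) \<le> sum ?s {?M..<b * ?M}"
        proof (rule sum_bounded_below)
          fix i assume i: "i \<in> {?M..<b * ?M}"
          have "r (b * ?M) / real (b * ?M) \<le> r (b * ?M) / real (Suc i)"
          proof (rule divide_left_mono)
            have "Suc i \<le> b * ?M" using i by simp
            then show "real (Suc i) \<le> real (b * ?M)" by (simp only: of_nat_le_iff)
            show "0 \<le> r (b * ?M)" by (rule nn) (use M b in simp)
            have "0 < real (b * ?M)" using M b by simp
            then show "0 < real (b * ?M) * real (Suc i)" by (rule mult_pos_pos) simp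
          qed
          also have "\<dots> \<le> ?s i" using i by (intro divide_right_mono anti) auto
          finally show "r (b * ?M) / real (b * ?M) \<le> ?s i" .
        qed
        moreover have "r (b * ?M) / 2 \<le> of_nat (card {?M..<b * ?M}) * (r (b * ?M) / real (b * ?M))"
        proof -
          have "real (b * ?M) \<le> 2 * (real (b * ?M) - real ?M)"
          proof -
            have "2 * real ?M \<le> real b * real ?M" using b by (intro mult_right_mono) simp_all
            moreover have "real (b * ?M) = real b * real ?M" by (rule of_nat_mult)
            ultimately show ?thesis by (rule aux1)
          qed
          then have "r (b * ?M) * real (b * ?M) \<le> r (b * ?M) * (2 * (real (b * ?M) - real ?M))"
            using nn[of "b * ?M"] M b by (intro mult_left_mono) simp_all
          moreover have "of_nat (card {?M..<b * ?M}) = real (b * ?M) - real ?M" using Mb by (simp add: of_nat_diff)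
          moreover have "0 < real (b * ?M)" using M b by simp
          ultimately show ?thesis by (rule aux2)
        qed
        ultimately show ?thesis by linarith
      qed
      finally have "r (b ^ J * n) \<le> 2 * sum ?s {?M..<b * ?M}" .
      moreover have "sum ?s {m..<b * ?M} = sum ?s {m..<?M} + sum ?s {?M..<b * ?M}"
        using Mb by (simp add: sum.atLeastLessThan_concat)
      ultimately show ?case using Suc unfolding bM by simp
    qed simp
    moreover have "norm (sum ?s {m..<b ^ J * m}) < \<kappa> / 2" using N m by simp
    ultimately show ?thesis by (simp add: abs_less_iff)
  qed
  then show ?thesis using b by (intro exI[of _ "b * (N + 1)"]) auto
qed

lemma le_supn: "\<bar>fst p\<bar> \<le> supn p" "\<bar>snd p\<bar> \<le> supn p"
  by (simp_all add: supn_def)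

lemma supn_triangle: "supn p \<le> supn (p - q) + supn q"
proof -
  have "\<bar>fst p\<bar> \<le> \<bar>fst (p - q)\<bar> + \<bar>fst q\<bar>" "\<bar>snd p\<bar> \<le> \<bar>snd (p - q)\<bar> + \<bar>snd q\<bar>" by simp_all
  then have "\<bar>fst p\<bar> \<le> supn (p - q) + supn q" "\<bar>snd p\<bar> \<le> supn (p - q) + supn q"
    using le_supn[of "p - q"] le_supn[of q] by linarith+
  then show ?thesis by (simp add: supn_def[of p])
qed

lemma supn_minus: "supn (p - q) = supn (q - p)"
  by (simp add: supn_def abs_minus_commute)

lemma translation_iff: "p \<in> translation c ` S \<longleftrightarrow> p - c \<in> S"
proof
  assume "p - c \<in> S" then show "p \<in> translation c ` S"
    by (intro image_eqI[of _ _ "p - c"]) (simp_all add: translation_def)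
qed (auto simp: translation_def)

text \<open>The factor 3 makes the widths agree: the vertical crossing of scale \<open>Suc j\<close>
  lives in a strip of width \<open>5 * 3 ^ Suc j * n = 15 * 3 ^ j * n\<close>, so it meets the
  horizontal crossings of scales \<open>j\<close> and \<open>Suc j\<close>. All horizontal crossings
  thus belong to one cluster, which meets the left side of the smallest rectangle.\<close>

lemma nested_crossings_infinite:
  assumes n: "1 \<le> n" and HL: "\<And>j. \<omega> \<in> hcross 0 (15 * (3 ^ j * n)) 0 (5 * (3 ^ j * n))"
    and VL: "\<And>j. \<omega> \<in> vcross 0 (5 * (3 ^ j * n)) 0 (15 * (3 ^ j * n))"
  shows "\<exists>y\<in>{0..5 * n}. \<omega> \<in> inf_at (0, y)"
proof -
  define N where "N j = 3 ^ j * n" for j :: nat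
  have N0: "1 \<le> N j" "N (Suc j) = 3 * N j" for j
  proof -
    have "1 * 1 \<le> 3 ^ j * n" by (rule mult_mono) (use n in simp_all)
    then show "1 \<le> N j" by (simp add: N_def)
  qed (simp add: N_def)
  define S where "S j = rect 0 (15 * N j) 0 (5 * N j)" for j
  have "\<forall>j. \<exists>x. x \<in> S j \<and> (\<exists>y z. (0, y) \<in> clus \<omega> (S j) x \<and> (15 * N j, z) \<in> clus \<omega> (S j) x)"
  proof
    fix j show "\<exists>x. x \<in> S j \<and> (\<exists>y z. (0, y) \<in> clus \<omega> (S j) x \<and> (15 * N j, z) \<in> clus \<omega> (S j) x)"
      by (rule ArmE[OF HL[of j]]) (simp add: S_def N_def, blast)
  qed
  then obtain x where x: "\<forall>j. x j \<in> S j \<and> (\<exists>y z. (0, y) \<in> clus \<omega> (S j) (x j) \<and> (15 * N j, z) \<in> clus \<omega> (S j) (x j))"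
    unfolding choice_iff by (rule exE)
  have step: "clus \<omega> UNIV (x (Suc j)) = clus \<omega> UNIV (x j)" for j
  proof -
    define T where "T = rect 0 (5 * N (Suc j)) 0 (15 * N (Suc j))"
    have "\<omega> \<in> vcross 0 (5 * N (Suc j)) 0 (15 * N (Suc j))" unfolding N_def by (rule VL)
    then obtain v y z where v: "v \<in> T" "(y, 0) \<in> clus \<omega> T v" "(z, 15 * N (Suc j)) \<in> clus \<omega> T v" "clus \<omega> T v \<subseteq> T"
      unfolding T_def by (rule vcrossE)
    have col: "0 \<le> fst s \<and> fst s \<le> 15 * N i" if "s \<in> clus \<omega> T v" "i = j \<or> i = Suc j" for s i
      using subsetD[OF v(4) that(1)] that(2) N0[of j] by (auto simp: T_def rect_iff')
    have m: "clus \<omega> (S i) (x i) \<inter> clus \<omega> T v \<noteq> {}" if i: "i = j \<or> i = Suc j" for i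
    proof -
      obtain a b where ab: "(0, a) \<in> clus \<omega> (S i) (x i)" "(15 * N i, b) \<in> clus \<omega> (S i) (x i)" using x by blast
      have s: "clus \<omega> (S i) (x i) \<subseteq> rect 0 (15 * N i) 0 (5 * N i)"
        using clus_sub[of "x i" "S i" \<omega>] x by (simp add: S_def)
      have le: "5 * N i \<le> 15 * N (Suc j)" using i N0[of j] by auto
      show ?thesis by (rule HV_cross[OF lattice_connected_clus s ab lattice_connected_clus col[OF _ i] v(2) _ v(3) le]) simp_all
    qed
    have "clus \<omega> UNIV v = clus \<omega> UNIV (x i)" if i: "i = j \<or> i = Suc j" for i
    proof -
      have "clus \<omega> T v \<subseteq> clus \<omega> UNIV (x i)" by (rule clus_meet[OF m[OF i]]) simp_all
      then have "v \<in> clus \<omega> UNIV (x i)" using clus_refl by (rule subsetD)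
      then show ?thesis by (rule clus_eq)
    qed
    from this[of j] this[of "Suc j"] show ?thesis by simp
  qed
  have eq: "clus \<omega> UNIV (x j) = clus \<omega> UNIV (x 0)" for j
    by (induction j) (simp_all add: step)
  obtain y where y: "(0, y) \<in> clus \<omega> (S 0) (x 0)" using x by blast
  have yS: "(0, y) \<in> S 0" using subsetD[OF clus_sub y] x by blast
  have e0: "clus \<omega> UNIV (0, y) = clus \<omega> UNIV (x 0)" by (rule clus_eq[OF clus_monoD[OF y subset_UNIV]])
  have "infinite (clus \<omega> UNIV (0, y))"
  proof
    assume "finite (clus \<omega> UNIV (0, y))"
    then have f: "finite (fst ` clus \<omega> UNIV (0, y))" by (rule finite_imageI)
    have "15 * N j \<in> fst ` clus \<omega> UNIV (0, y)" for j
    proof -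
      obtain z where "(15 * N j, z) \<in> clus \<omega> (S j) (x j)" using x by blast
      from clus_monoD[OF this subset_UNIV] have "(15 * N j, z) \<in> clus \<omega> UNIV (0, y)" unfolding e0 eq[of j, symmetric] .
      then show ?thesis by (intro image_eqI[of _ _ "(15 * N j, z)"]) simp
    qed
    then have "range (\<lambda>j. 15 * N j) \<subseteq> fst ` clus \<omega> UNIV (0, y)" by (rule image_subsetI)
    then have "finite (range (\<lambda>j. 15 * N j))" using f by (rule finite_subset)
    moreover have "inj (\<lambda>j. 15 * N j)"
      by (rule injI) (use n in \<open>simp add: N_def\<close>)
    ultimately show False by (simp add: finite_image_iff)
  qed
  moreover have "\<omega> \<in> space config_space" by (rule increasing_space[OF HL[of 0] increasing_Arm])
  ultimately have "\<omega> \<in> inf_at (0, y)" by (simp add: inf_at_def)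
  then show ?thesis using yS by (intro bexI[of _ y]) (simp_all add: S_def N_def)
qed

section \<open>Renormalisation\<close>

locale perc_dec = perc +
  fixes r :: "nat \<Rightarrow> real"
  assumes r_nonneg: "1 \<le> n \<Longrightarrow> 0 \<le> r n"
    and dec: "1 \<le> n \<Longrightarrow> event_supported_in A (lattice_box (3 * int n)) \<Longrightarrow>
      event_supported_in B (UNIV - lattice_box (4 * int n)) \<Longrightarrow> prob (A \<inter> B) \<le> prob A * prob B + r n"
begin

lemma dec_at:
  assumes n: "1 \<le> n" and A: "event_supported_in A (translation c ` lattice_box (3 * int n))"
    and B: "event_supported_in B (UNIV - translation c ` lattice_box (4 * int n))"
  shows "prob (A \<inter> B) \<le> prob A * prob B + r n"
proof -
  let ?p = "\<lambda>A. pullback (translation (- c)) -` A \<inter> space config_space"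
  have s: "A \<in> sets config_space" "B \<in> sets config_space" using A B supported_sets by auto
  have i: "translation (- c) ` translation c ` S = S" for S
    by (simp add: image_image translation_def)
  have "translation (- c) ` (UNIV - translation c ` lattice_box (4 * int n)) = UNIV - lattice_box (4 * int n)"
  proof (rule set_eqI)
    fix p show "p \<in> translation (- c) ` (UNIV - translation c ` lattice_box (4 * int n)) \<longleftrightarrow> p \<in> UNIV - lattice_box (4 * int n)"
      by (simp add: translation_iff)
  qed
  then have "event_supported_in (?p B) (UNIV - lattice_box (4 * int n))"
    using supported_pullback[OF B auto_translation, of "- c"] by simp
  moreover have "event_supported_in (?p A) (lattice_box (3 * int n))"
    using supported_pullback[OF A auto_translation, of "- c"] by (simp add: i)
  ultimately have "prob (?p A \<inter> ?p B) \<le> prob (?p A) * prob (?p B) + r n" using dec[OF n] by blast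
  moreover have "?p A \<inter> ?p B = ?p (A \<inter> B)" by auto
  moreover have "prob (?p (A \<inter> B)) = prob (A \<inter> B)" by (rule inv_translation) (use s in auto)
  moreover have "prob (?p A) = prob A" "prob (?p B) = prob B" by (rule inv_translation; rule s)+
  ultimately show ?thesis by (simp only:)
qed

abbreviation bd :: "nat \<Rightarrow> real" where
  "bd n \<equiv> 1 - prob (hcross 0 (6 * int n) 0 (5 * int n))"

text \<open>Both strips at heights \<open>0\<close> and \<open>10 * n\<close> must fail to be crossed, and each is crossed as soon as 26 pieces
  of size \<open>n\<close> are; whence the constant \<open>26\<^sup>2 = 676\<close>.\<close>

lemma hard_renorm:
  assumes n: "1 \<le> n"
  shows "bd (3 * n) \<le> 676 * ((bd n)\<^sup>2 + r n)"
proof -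
  define P where "P t z = (if snd z then hcross (int (fst z) * int n) (int (fst z) * int n + 6 * int n) t (t + 5 * int n)
    else vcross (int (fst z) * int n) (int (fst z) * int n + 5 * int n) t (t + 5 * int n))" for t :: int and z :: "nat \<times> bool"
  define I where "I = {..12 :: nat} \<times> (UNIV :: bool set)"
  define C where "C t z = space config_space - P t z" for t z
  have sP: "P t z \<in> sets config_space" for t z by (simp add: P_def)
  then have sC: "C t z \<in> sets config_space" for t z by (auto simp: C_def)
  have pC: "prob (C t z) \<le> bd n" for t z
  proof -
    have "prob (hcross 0 (6 * int n) 0 (5 * int n)) \<le> prob (P t z)"
    proof (cases "snd z")
      case True
      have "prob (P t z) = prob (hcross 0 (6 * int n) 0 (5 * int n))" unfolding P_def using True by (simp, intro hcross_eq) simp_all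
      then show ?thesis by simp
    next
      case False
      then show ?thesis using square_of_hard[of "int n" "int (fst z)" t] by (simp add: P_def)
    qed
    moreover have "prob (C t z) = 1 - prob (P t z)"
      unfolding C_def using prob_compl[of "P t z"] sP by (simp add: events_eq space_M)
    ultimately show ?thesis by simp
  qed
  have supp: "event_supported_in (C t z) (rect (int (fst z) * int n) (int (fst z) * int n + 6 * int n) t (t + 5 * int n))" for t z
  proof -
    let ?B = "rect (int (fst z) * int n) (int (fst z) * int n + 6 * int n) t (t + 5 * int n)"
    have "event_supported_in (P t z) ?B"
    proof (cases "snd z")
      case True
      then show ?thesis using supported_cluster_meets by (simp add: P_def Arm_def)
    next
      case False
      have "rect (int (fst z) * int n) (int (fst z) * int n + 5 * int n) t (t + 5 * int n) \<subseteq> ?B" unfolding rect_def by auto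
      then show ?thesis using False supported_mono[OF supported_cluster_meets] by (simp add: P_def vcross_def)
    qed
    then show ?thesis unfolding C_def by (rule supported_compl)
  qed
  \<comment> \<open>13 rectangles and 13 squares at the offsets \<open>0\<close> to
    \<open>12 * n\<close> give the length \<open>18 * n\<close>, the long side at scale
    \<open>3 * n\<close>; both strips lie within its height \<open>15 * n\<close>.\<close>
  have cross: "\<omega> \<in> hcross 0 (6 * int (3 * n)) 0 (5 * int (3 * n))"
    if a: "\<And>z. z \<in> I \<Longrightarrow> \<omega> \<in> P t z" and t: "t = 0 \<or> t = 10 * int n" for \<omega> t
  proof -
    have "\<omega> \<in> hcross 0 ((6 + int 12) * int n) t (t + 5 * int n)"
    proof (rule long_crossing_at)
      fix i :: nat assume "i \<le> 12"
      then have "(i, True) \<in> I" "(i, False) \<in> I" by (simp_all add: I_def)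
      from a[OF this(1)] a[OF this(2)] show "\<omega> \<in> hcross (int i * int n) (int i * int n + 6 * int n) t (t + 5 * int n)"
        "\<omega> \<in> vcross (int i * int n) (int i * int n + 5 * int n) t (t + 5 * int n)" by (simp_all add: P_def)
    qed simp
    moreover have "hcross 0 (18 * int n) t (t + 5 * int n) \<subseteq> hcross 0 (18 * int n) 0 (15 * int n)"
      by (rule Arm_mono) (use t in auto)
    ultimately show ?thesis by auto
  qed
  let ?X = "hcross 0 (6 * int (3 * n)) 0 (5 * int (3 * n))"
  let ?D = "\<lambda>w. C 0 (fst w) \<inter> C (10 * int n) (snd w)"
  have cover: "space config_space - ?X \<subseteq> (\<Union>w\<in>I \<times> I. ?D w)"
  proof
    fix \<omega> assume w: "\<omega> \<in> space config_space - ?X"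
    obtain z where z: "z \<in> I" "\<omega> \<notin> P 0 z" using cross[of \<omega> 0] w by blast
    obtain z' where z': "z' \<in> I" "\<omega> \<notin> P (10 * int n) z'" using cross[of \<omega> "10 * int n"] w by blast
    show "\<omega> \<in> (\<Union>w\<in>I \<times> I. ?D w)"
      by (rule UN_I[of "(z, z')"]) (use z z' w in \<open>simp_all add: C_def\<close>)
  qed
  have pair: "prob (?D w) \<le> (bd n)\<^sup>2 + r n" for w
  proof -
    \<comment> \<open>The box of radius \<open>3 * n\<close> about this point contains the lower
      piece, and the box of radius \<open>4 * n\<close> ends at height \<open>6 * n\<close>, below
      the upper strip.\<close>
    let ?c = "(int (fst (fst w)) * int n + 3 * int n, 2 * int n)"
    have "prob (?D w) \<le> prob (C 0 (fst w)) * prob (C (10 * int n) (snd w)) + r n"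
    proof (rule dec_at[OF n])
      show "event_supported_in (C 0 (fst w)) (translation ?c ` lattice_box (3 * int n))"
        by (rule supported_mono[OF supp], unfold lattice_box_rect translation_rect, unfold rect_def) auto
      show "event_supported_in (C (10 * int n) (snd w)) (UNIV - translation ?c ` lattice_box (4 * int n))"
        by (rule supported_mono[OF supp], unfold lattice_box_rect translation_rect, unfold rect_def) (use n in auto)
    qed
    also have "prob (C 0 (fst w)) * prob (C (10 * int n) (snd w)) \<le> bd n * bd n"
      by (rule mult_mono) (simp_all add: pC)
    finally show ?thesis by (simp add: power2_eq_square)
  qed
  have fI: "finite (I \<times> I)" "card (I \<times> I) = 676" by (simp_all add: I_def card_cartesian_product)
  have "bd (3 * n) = prob (space config_space - ?X)" using prob_compl[of ?X] by (simp add: events_eq space_M)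
  also have "\<dots> \<le> prob (\<Union>w\<in>I \<times> I. ?D w)"
    by (rule prob_mono[OF cover]) (use fI sC in \<open>auto intro!: sets.finite_UN\<close>)
  also have "\<dots> \<le> (\<Sum>w\<in>I \<times> I. prob (?D w))"
    by (rule measure_UNION_le[OF fI(1)]) (use sC in \<open>auto simp: events_eq\<close>)
  also have "\<dots> \<le> of_nat (card (I \<times> I)) * ((bd n)\<^sup>2 + r n)" by (rule sum_bounded_above) (rule pair)
  finally show ?thesis by (simp add: fI(2))
qed

lemma prob_inf_at: "prob (inf_at x) = prob connected_to_infinity"
proof -
  have "(0, 0) + x = x" by (simp add: zero_prod_def[symmetric])
  then show ?thesis
    using inv_translation[OF sets_inf_at, of x "(0, 0)"] unfolding pullback_inf_at inf_at_0[symmetric] by simp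
qed

text \<open>The thresholds are \<open>1 / (2 * K)\<close> and \<open>1 / (4 * K\<^sup>2)\<close> for \<open>K = 676\<close>.\<close>

lemma percolation_of_hard_crossing:
  assumes n: "1 \<le> n" and small: "bd n \<le> 1 / 1352" and rs: "\<And>J. (\<Sum>j<J. r (3 ^ j * n)) \<le> 1 / 1827904"
  shows "0 < prob connected_to_infinity"
proof (rule ccontr)
  assume "\<not> ?thesis"
  then have th: "prob connected_to_infinity = 0" using measure_nonneg[of M connected_to_infinity] by linarith
  define x where "x j = bd (3 ^ j * n)" for j
  have p1: "1 \<le> 3 ^ j * n" for j using n by simp
  have x0: "0 \<le> x j" for j by (simp add: x_def)
  have bound: "(\<Sum>j<J. x j) \<le> 2 * x 0 + 2 * 676 * (1 / 1827904)" for J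
  proof (rule renormalisation_sum[where \<rho> = "\<lambda>j. r (3 ^ j * n)" and K = 676, OF x0 _ _ _ _ rs])
    show "x (Suc j) \<le> 676 * ((x j)\<^sup>2 + r (3 ^ j * n))" for j
      using hard_renorm[OF p1[of j]] by (simp add: x_def mult.assoc)
    show "x 0 \<le> 1 / (2 * 676)" using small by (simp add: x_def)
  qed (use r_nonneg[OF p1] in simp_all)
  \<comment> \<open>As \<open>1352\<^sup>2 = 1827904\<close>, the bound equals at most
    \<open>3 / 1352\<close>, well below \<open>1 / 80\<close>; multiplied by the 40 from
    \<open>pBad\<close> this leaves \<open>1 / 2\<close>.\<close>
  have "x 0 \<le> 1 / 1352" using small by (simp add: x_def)
  then have sx: "(\<Sum>j<J. x j) \<le> 1 / 80" for J using bound[of J] by simp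
  define H where "H j = hcross 0 (15 * (3 ^ j * int n)) 0 (5 * (3 ^ j * int n))" for j :: nat
  define V where "V j = vcross 0 (5 * (3 ^ j * int n)) 0 (15 * (3 ^ j * int n))" for j :: nat
  define Bad where "Bad j = space config_space - H j \<inter> V j" for j
  have sHV: "H j \<in> events" "V j \<in> events" for j by (simp_all add: H_def V_def events_eq)
  have sBad: "Bad j \<in> events" for j using sHV by (auto simp: Bad_def space_M[symmetric])
  have pBad: "prob (Bad j) \<le> 40 * x j" for j
  proof -
    \<comment> \<open>\<open>15 = 6 + 9\<close>, so \<open>H j\<close> needs ten rectangles and ten
      squares, and its image \<open>V j\<close> under the coordinate swap needs as many.\<close>
    have "1 - prob (H j) \<le> real (2 * Suc 9) * x j"
      using long_union_bound[of "3 ^ j * int n" 9] by (simp add: H_def x_def)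
    moreover have "prob (V j) = prob (H j)" unfolding V_def H_def by (rule vcross_hcross)
    moreover have "prob (Bad j) = 1 - prob (H j \<inter> V j)"
      using prob_compl[of "H j \<inter> V j"] sHV by (simp add: Bad_def space_M)
    moreover have "prob (H j \<union> V j) = prob (H j) + prob (V j) - prob (H j \<inter> V j)"
      using finite_measure_Union'[OF sHV] finite_measure_Diff'[OF sHV(2,1)] by (simp add: Int_commute)
    moreover have "prob (H j \<union> V j) \<le> 1" by simp
    ultimately show ?thesis by simp
  qed
  have part: "(\<Sum>j<J. prob (Bad j)) \<le> 1 / 2" for J
  proof -
    have "(\<Sum>j<J. prob (Bad j)) \<le> (\<Sum>j<J. 40 * x j)" by (rule sum_mono) (rule pBad)
    also have "\<dots> = 40 * (\<Sum>j<J. x j)" by (rule sum_distrib_left[symmetric])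
    finally show ?thesis using sx[of J] by simp
  qed
  have summ: "summable (\<lambda>j. prob (Bad j))" by (rule summableI_nonneg_bounded[OF _ part]) simp
  have "prob (\<Union>j. Bad j) \<le> (\<Sum>j. prob (Bad j))"
    by (rule finite_measure_subadditive_countably) (use sBad summ in auto)
  also have "\<dots> \<le> 1 / 2" by (rule suminf_le_const[OF summ part])
  finally have half: "prob (\<Union>j. Bad j) \<le> 1 / 2" .
  have cover: "space config_space \<subseteq> (\<Union>j. Bad j) \<union> (\<Union>y\<in>{0..5 * int n}. inf_at (0, y))"
  proof
    fix \<omega> assume w: "\<omega> \<in> space config_space"
    show "\<omega> \<in> (\<Union>j. Bad j) \<union> (\<Union>y\<in>{0..5 * int n}. inf_at (0, y))"
    proof (cases "\<exists>j. \<omega> \<in> Bad j")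
      case False
      then have "\<omega> \<in> H j" "\<omega> \<in> V j" for j using w by (auto simp: Bad_def)
      then have "\<exists>y\<in>{0..5 * int n}. \<omega> \<in> inf_at (0, y)"
        unfolding H_def V_def using n by (intro nested_crossings_infinite) simp_all
      then show ?thesis by blast
    qed blast
  qed
  have sI: "(\<Union>y\<in>{0..5 * int n}. inf_at (0, y)) \<in> events" using sets_inf_at by (auto simp: events_eq intro!: sets.finite_UN)
  have "prob (\<Union>y\<in>{0..5 * int n}. inf_at (0, y)) \<le> (\<Sum>y\<in>{0..5 * int n}. prob (inf_at (0, y)))"
    by (rule measure_UNION_le) (use sets_inf_at in \<open>auto simp: events_eq\<close>)
  then have zero: "prob (\<Union>y\<in>{0..5 * int n}. inf_at (0, y)) \<le> 0" by (simp add: prob_inf_at th)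
  have sB: "(\<Union>j. Bad j) \<in> events" using sBad by auto
  have "1 = prob (space config_space)" using prob_space by (simp add: space_M)
  also have "\<dots> \<le> prob ((\<Union>j. Bad j) \<union> (\<Union>y\<in>{0..5 * int n}. inf_at (0, y)))"
    by (rule finite_measure_mono[OF cover]) (use sB sI in auto)
  also have "\<dots> \<le> prob (\<Union>j. Bad j) + prob (\<Union>y\<in>{0..5 * int n}. inf_at (0, y))"
    by (rule measure_Un_le[OF sB sI])
  finally show False using half zero by simp
qed

text \<open>The constant is \<open>39 ^ 4\<close>, the number of pairs of small boxes with centres in a \<open>39 \<times> 39\<close> grid.\<close>

lemma far_renorm:
  assumes n: "1 \<le> n"
  shows "prob (far (9 * int n) (18 * int n)) \<le> 2313441 * ((prob (far (int n) (2 * int n)))\<^sup>2 + r n)"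
proof -
  define k where "k = int n"
  have k: "1 \<le> k" using n by (simp add: k_def)
  define Z where "Z = {-19..19 :: int} \<times> {-19..19 :: int}"
  define c where "c z = (k * fst z, k * snd z)" for z :: vertex
  define E where "E z = cluster_meets (translation (c z) ` lattice_box (2 * k))
    {translation (c z) ` lattice_box k, translation (c z) ` {p. supn p = 2 * k}}" for z
  have pE: "prob (E z) = prob (far k (2 * k))" for z
    using cluster_meets_translation[of "{lattice_box k, {p. supn p = 2 * k}}" "c z" "lattice_box (2 * k)"] by (simp add: E_def far_def)
  have sE: "event_supported_in (E z) (translation (c z) ` lattice_box (2 * k))" for z
    unfolding E_def by (rule supported_cluster_meets) simp
  \<comment> \<open>Rounding both coordinates down to multiples of \<open>k\<close> moves a point by
    less than \<open>k\<close> and stays in the index range.\<close>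
  have near: "\<exists>z\<in>Z. supn (w - c z) \<le> k" if "supn w \<le> 18 * k" for w
  proof -
    let ?z = "(fst w div k, snd w div k)"
    have b: "- 18 \<le> a div k \<and> a div k \<le> 18 \<and> \<bar>a - k * (a div k)\<bar> \<le> k" if "\<bar>a\<bar> \<le> 18 * k" for a
    proof -
      have k0: "0 < k" using k by simp
      have 1: "a - k * (a div k) = a mod k" by (simp add: minus_mult_div_eq_mod)
      have "(- 18 * k) div k \<le> a div k" "a div k \<le> (18 * k) div k"
        by (rule zdiv_mono1[OF _ k0]; use that in linarith)+
      moreover have "(- 18 * k) div k = - 18" "(18 * k) div k = 18"
        by (rule nonzero_mult_div_cancel_right; use k0 in simp)+
      ultimately have "- 18 \<le> a div k" "a div k \<le> 18" by (simp_all only:)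
      then show ?thesis unfolding 1 using pos_mod_sign[OF k0, of a] pos_mod_bound[OF k0, of a] by auto
    qed
    have "\<bar>fst w\<bar> \<le> 18 * k" "\<bar>snd w\<bar> \<le> 18 * k" using that by (simp_all add: supn_def)
    from b[OF this(1)] b[OF this(2)] show ?thesis
      by (intro bexI[of _ ?z]) (simp_all add: Z_def c_def supn_def)
  qed
  have arm: "\<omega> \<in> E z" if w: "\<omega> \<in> space config_space" "t \<in> clus \<omega> UNIV w" "supn (w - c z) \<le> k" "2 * k \<le> supn (t - c z)" for \<omega> w t z
  proof -
    let ?f = "\<lambda>p. supn (p - c z)"
    have lattice_lipschitz: "lattice_lipschitz ?f" unfolding lattice_lipschitz_def
    proof (intro allI impI)
      fix u v assume "adjacent u v"
      then have "adjacent (u - c z) (v - c z)" by (simp add: adjacent_def)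
      then show "\<bar>?f u - ?f v\<bar> \<le> 1" using lattice_lipschitz_supn unfolding lattice_lipschitz_def by blast
    qed
    obtain v' where v': "?f v' = 2 * k" "v' \<in> clus \<omega> (UNIV \<inter> {p. ?f p \<le> 2 * k}) w"
      by (rule clus_shrink_up[OF w(2) UNIV_I lattice_lipschitz, of "2 * k"]) (use w k in simp_all)
    have e: "UNIV \<inter> {p. ?f p \<le> 2 * k} = translation (c z) ` lattice_box (2 * k)"
    proof (rule set_eqI)
      fix p show "p \<in> UNIV \<inter> {p. ?f p \<le> 2 * k} \<longleftrightarrow> p \<in> translation (c z) ` lattice_box (2 * k)"
        by (simp add: translation_iff supn_box)
    qed
    show ?thesis unfolding E_def
      by (rule cluster_meets2I[OF w(1) _ _ _ v'(2)[unfolded e]]) (use w(3) v'(1) k in \<open>simp_all add: translation_iff supn_box\<close>)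
  qed
  define W where "W = {w \<in> Z \<times> Z. 7 * k \<le> supn (c (snd w) - c (fst w))}"
  let ?D = "\<lambda>w. E (fst w) \<inter> E (snd w)"
  have fW: "finite W" unfolding W_def by (simp add: Z_def)
  have "card W \<le> card (Z \<times> Z)" unfolding W_def by (rule card_mono) (auto simp: Z_def)
  also have "\<dots> = 2313441" by (simp add: Z_def card_cartesian_product)
  finally have cW: "card W \<le> 2313441" .
  have cover: "far (9 * k) (18 * k) \<subseteq> (\<Union>w\<in>W. ?D w)"
  proof
    fix \<omega> assume "\<omega> \<in> far (9 * k) (18 * k)"
    then obtain u v where uv: "\<omega> \<in> space config_space" "u \<in> lattice_box (9 * k)" "u \<in> lattice_box (18 * k)"
      "v \<in> {p. supn p = 18 * k}" "v \<in> clus \<omega> (lattice_box (18 * k)) u" unfolding far_def by (rule cluster_meets2E)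
    have vu: "v \<in> clus \<omega> UNIV u" by (rule clus_monoD[OF uv(5) subset_UNIV])
    then have uv': "u \<in> clus \<omega> UNIV v" using clus_sym[of u \<omega> UNIV v] by simp
    have su: "supn u \<le> 9 * k" "supn v = 18 * k" using uv by (simp_all add: supn_box)
    obtain z where z: "z \<in> Z" "supn (u - c z) \<le> k" using near[of u] su k by auto
    obtain z' where z': "z' \<in> Z" "supn (v - c z') \<le> k" using near[of v] su by auto
    \<comment> \<open>\<open>supn u\<close> and \<open>supn v\<close> differ by at least
      \<open>18 * k - 9 * k\<close>, and rounding to the grid costs at most \<open>k\<close> for
      each end.\<close>
    have tri: "supn (v - c z) \<ge> 8 * k" "supn (u - c z') \<ge> 8 * k" "supn (c z' - c z) \<ge> 7 * k"
    proof -
      have 1: "supn v \<le> supn (v - c z) + supn (c z)" "supn (c z) \<le> supn (c z - u) + supn u" by (rule supn_triangle)+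
      have 2: "supn v \<le> supn (v - c z') + supn (c z')" "supn (c z') \<le> supn (c z' - u) + supn u" by (rule supn_triangle)+
      have 3: "supn (c z') \<le> supn (c z' - c z) + supn (c z)" by (rule supn_triangle)
      show "supn (v - c z) \<ge> 8 * k" "supn (u - c z') \<ge> 8 * k" "supn (c z' - c z) \<ge> 7 * k"
        using 1 2 3 su z(2) z'(2) supn_minus[of "c z" u] supn_minus[of "c z'" u] by linarith+
    qed
    have "\<omega> \<in> E z" by (rule arm[OF uv(1) vu z(2)]) (use tri k in simp)
    moreover have "\<omega> \<in> E z'" by (rule arm[OF uv(1) uv' z'(2)]) (use tri k in simp)
    ultimately show "\<omega> \<in> (\<Union>w\<in>W. ?D w)"
      by (intro UN_I[of "(z, z')"]) (use z z' tri in \<open>simp_all add: W_def\<close>)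
  qed
  have pair: "prob (?D w) \<le> (prob (far k (2 * k)))\<^sup>2 + r n" if w: "w \<in> W" for w
  proof -
    have "prob (?D w) \<le> prob (E (fst w)) * prob (E (snd w)) + r n"
    proof (rule dec_at[OF n])
      show "event_supported_in (E (fst w)) (translation (c (fst w)) ` lattice_box (3 * int n))"
        by (rule supported_mono[OF sE]) (use k in \<open>auto simp: lattice_box_def k_def\<close>)
      \<comment> \<open>The centres are at distance at least \<open>7 * k\<close>, so the second box
        of radius \<open>2 * k\<close> keeps distance \<open>5 * k\<close> from the first centre and
        lies outside the box of radius \<open>4 * k\<close>.\<close>
      have "p \<notin> translation (c (fst w)) ` lattice_box (4 * k)" if "p \<in> translation (c (snd w)) ` lattice_box (2 * k)" for p
      proof -
        have 1: "supn (p - c (snd w)) \<le> 2 * k" using that by (simp add: translation_iff supn_box)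
        have "supn (c (snd w) - c (fst w)) \<le> supn (c (snd w) - c (fst w) - (p - c (fst w))) + supn (p - c (fst w))"
          by (rule supn_triangle)
        also have "c (snd w) - c (fst w) - (p - c (fst w)) = c (snd w) - p" by simp
        finally have "7 * k \<le> supn (p - c (snd w)) + supn (p - c (fst w))"
          using w supn_minus[of p "c (snd w)"] by (simp add: W_def)
        then show ?thesis using 1 k by (simp add: translation_iff supn_box)
      qed
      then show "event_supported_in (E (snd w)) (UNIV - translation (c (fst w)) ` lattice_box (4 * int n))"
        by (intro supported_mono[OF sE]) (simp add: subset_iff k_def)
    qed
    then show ?thesis by (simp add: pE power2_eq_square)
  qed
  have evE: "E z \<in> events" for z using supported_sets[OF sE] by (simp add: events_eq)
  have "prob (far (9 * k) (18 * k)) \<le> prob (\<Union>w\<in>W. ?D w)"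
    by (rule finite_measure_mono[OF cover]) (use evE fW in \<open>auto intro!: sets.finite_UN\<close>)
  also have "\<dots> \<le> (\<Sum>w\<in>W. prob (?D w))" by (rule measure_UNION_le[OF fW]) (use evE in auto)
  also have "\<dots> \<le> of_nat (card W) * ((prob (far k (2 * k)))\<^sup>2 + r n)" by (rule sum_bounded_above) (rule pair)
  also have "\<dots> \<le> 2313441 * ((prob (far k (2 * k)))\<^sup>2 + r n)"
    using cW r_nonneg[OF n] by (intro mult_right_mono) simp_all
  finally show ?thesis by (simp add: k_def)
qed

text \<open>The percolation probability is a lower bound for every \<open>x j\<close>, while the
  recursion bounds the partial sums of the \<open>x j\<close> uniformly.\<close>

lemma no_percolation_of_far:
  assumes n: "1 \<le> n" and small: "prob (far (int n) (2 * int n)) \<le> 1 / (2 * 2313441)"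
    and rs: "\<And>J. (\<Sum>j<J. r (9 ^ j * n)) \<le> 1 / (4 * 2313441\<^sup>2)"
  shows "prob connected_to_infinity = 0"
proof (rule ccontr)
  assume "\<not> ?thesis"
  then have th: "0 < prob connected_to_infinity" using measure_nonneg[of M connected_to_infinity] by linarith
  define x where "x j = prob (far (int (9 ^ j * n)) (2 * int (9 ^ j * n)))" for j
  have p1: "1 \<le> 9 ^ j * n" for j using n by simp
  have sum: "(\<Sum>j<J. x j) \<le> 2 * x 0 + 2 * 2313441 * (1 / (4 * 2313441\<^sup>2))" for J
  proof (rule renormalisation_sum[where \<rho> = "\<lambda>j. r (9 ^ j * n)" and K = 2313441, OF _ _ _ _ _ rs])
    show "x (Suc j) \<le> 2313441 * ((x j)\<^sup>2 + r (9 ^ j * n))" for j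
      using far_renorm[OF p1[of j]] by (simp add: x_def mult.assoc)
    show "x 0 \<le> 1 / (2 * 2313441)" using small by (simp add: x_def)
  qed (use r_nonneg[OF p1] in \<open>simp_all add: x_def\<close>)
  have le: "prob connected_to_infinity \<le> x j" for j
    unfolding x_def
  proof (rule prob_mono)
    show "connected_to_infinity \<subseteq> far (int (9 ^ j * n)) (2 * int (9 ^ j * n))"
    proof
      fix \<omega> assume "\<omega> \<in> connected_to_infinity"
      then have "\<omega> \<in> space config_space" "infinite (clus \<omega> UNIV (0, 0))"
        by (simp_all add: connected_to_infinity_def cluster_clus)
      then show "\<omega> \<in> far (int (9 ^ j * n)) (2 * int (9 ^ j * n))"
        by (intro infinite_cluster_far[of \<omega> "(0, 0)"]) (simp_all add: supn_box supn_def)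
    qed
  qed simp
  obtain J :: nat where J: "2 * x 0 + 2 * 2313441 * (1 / (4 * 2313441\<^sup>2)) < real J * prob connected_to_infinity"
    using reals_Archimedean3[OF th] by blast
  have "real J * prob connected_to_infinity \<le> (\<Sum>j<J. x j)"
    using sum_bounded_below[of "{..<J}" "prob connected_to_infinity" x] le by simp
  with sum[of J] J show False by linarith
qed

end

section \<open>The critical parameter\<close>

text \<open>\<open>far_tendsto_0\<close> is used twice. For the model, it contradicts a box that
  meets an infinite cluster, which rules out persistent dual crossings; for the dual, with the
  bidual in place of the model, it supplies the rarity of dual connections that
  \<open>square_tendsto_1\<close> requires.\<close>

lemma (in perc) hard_crossing_of_percolation:
  assumes erg: "shift_ergodic M" and pos: "0 < prob connected_to_infinity" and e: "0 < \<eta>" "\<eta> < 1"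
  shows "\<exists>n\<ge>n0. 1 - prob (hcross 0 (6 * n) 0 (5 * n)) \<le> \<eta>"
proof -
  interpret d: perc "dual M" by (rule perc_dual)
  have "\<not> (\<forall>n0. \<exists>n\<ge>n0. rsw_const \<le> d.prob (hcross 0 (6 * n) 0 (5 * n)))"
  proof
    assume io: "\<forall>n0. \<exists>n\<ge>n0. rsw_const \<le> d.prob (hcross 0 (6 * n) 0 (5 * n))"
    obtain m where m: "\<forall>N\<ge>int m. 1 - 1 / 2 < prob (far (int m) N)" using infinite_far[OF erg pos, of "1 / 2"] by auto
    obtain N where N: "int m \<le> N" "prob (far (int m) N) \<le> 1 / 4"
      using far_tendsto_0[of rsw_const "1 / 4" "int m"] io rsw_const(1) by auto
    from m N(1) have "1 - 1 / 2 < prob (far (int m) N)" by blast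
    with N(2) show False by simp
  qed
  then obtain n1 where n1: "\<And>n. n1 \<le> n \<Longrightarrow> \<not> rsw_const \<le> d.prob (hcross 0 (6 * n) 0 (5 * n))" by blast
  have io: "\<exists>n\<ge>n0. rsw_const \<le> measure (dual (dual M)) (hcross 0 (6 * n) 0 (5 * n))" for n0
  proof -
    obtain n where n: "max n0 n1 \<le> n" "rsw_const \<le> prob (hcross 0 (6 * n) 0 (5 * n)) \<or> rsw_const \<le> d.prob (hcross 0 (6 * n) 0 (5 * n))"
      using hard_crossing_self_or_dual[of "max n0 n1"] by blast
    then have "n0 \<le> n" "rsw_const \<le> prob (hcross 0 (6 * n) 0 (5 * n))" using n1[of n] by auto
    then show ?thesis by (intro exI[of _ n]) (simp add: measure_dual_dual)
  qed
  have "\<exists>N\<ge>m. d.prob (far m N) \<le> \<epsilon>" if "0 < \<epsilon>" for m \<epsilon>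
    by (rule d.far_tendsto_0[OF io rsw_const(1) that])
  then have "\<exists>n0. \<forall>n\<ge>n0. 1 - prob (hcross 0 (2 * n) (- n) n) \<le> \<epsilon>" if "0 < \<epsilon>" for \<epsilon>
    using square_tendsto_1[OF erg pos _ that] by blast
  then show ?thesis by (rule hard_tendsto_1[OF _ e])
qed

section \<open>From the hypotheses of the theorem to the locales\<close>

lemma covariance_indicator:
  assumes "prob_space M" "A \<in> sets M" "B \<in> sets M"
  shows "covariance M (indicator A) (indicator B) = measure M (A \<inter> B) - measure M A * measure M B"
proof -
  interpret prob_space M by (rule assms(1))
  define a b where "a = prob A" and "b = prob B"
  have i: "integrable M (indicator C :: _ \<Rightarrow> real)" "integral\<^sup>L M (indicator C) = prob C" if "C \<in> sets M" for C
    using that by (simp_all add: emeasure_eq_measure)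
  have e: "(indicator A \<omega> - a) * (indicator B \<omega> - b) =
      indicator (A \<inter> B) \<omega> - b * indicator A \<omega> - a * indicator B \<omega> + a * b" for \<omega>
    by (simp add: indicator_def algebra_simps)
  have "covariance M (indicator A) (indicator B) =
      (\<integral>\<omega>. (indicator A \<omega> - a) * (indicator B \<omega> - b) \<partial>M)"
    unfolding covariance_def i(2)[OF assms(2)] i(2)[OF assms(3)] a_def b_def ..
  also have "\<dots> = (\<integral>\<omega>. indicator (A \<inter> B) \<omega> - b * indicator A \<omega> - a * indicator B \<omega> + a * b \<partial>M)"
    unfolding e ..
  also have "\<dots> = prob (A \<inter> B) - b * a - a * b + a * b"
    using i[of A] i[of B] i[of "A \<inter> B"] assms by (simp add: prob_space a_def b_def)
  finally show ?thesis by (simp add: a_def b_def)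
qed

lemma swap_symmetry: "prod.swap \<in> lattice_symmetries"
proof -
  have "(\<lambda>(a, b). (- b, a)) \<circ> (\<lambda>(a, b). (a, - b)) \<in> lattice_symmetries"
    by (intro lattice_symmetries.intros)
  also have "(\<lambda>(a, b). (- b, a)) \<circ> (\<lambda>(a, b). (a, - b)) = (prod.swap :: vertex \<Rightarrow> vertex)" by auto
  finally show ?thesis .
qed

lemma negx_symmetry: "negx \<in> lattice_symmetries"
proof -
  have "prod.swap \<circ> ((\<lambda>(a, b). (a, - b)) \<circ> prod.swap) \<in> lattice_symmetries"
    by (intro lattice_symmetries.compose swap_symmetry lattice_symmetries.reflection)
  also have "prod.swap \<circ> ((\<lambda>(a, b). (a, - b)) \<circ> prod.swap) = negx" by (rule ext) (simp add: negx_def split: prod.splits)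
  finally show ?thesis .
qed

lemma perc_decI:
  assumes bond: "bond_percolation M" and inv: "symmetry_invariant M" and fkg: "satisfies_FKG M"
    and r: "\<And>n. 1 \<le> n \<Longrightarrow> 0 \<le> r n" "\<And>m n. 1 \<le> m \<Longrightarrow> m \<le> n \<Longrightarrow> r n \<le> r m"
      "summable (\<lambda>n. r (Suc n) / real (Suc n))"
    and dec: "\<And>n A B. 1 \<le> n \<Longrightarrow> event_supported_in A (lattice_box (3 * int n)) \<Longrightarrow>
      event_supported_in B (UNIV - lattice_box (4 * int n)) \<Longrightarrow> covariance M (indicator A) (indicator B) \<le> r n"
  shows "perc_dec M r"
proof -
  have P: "prob_space M" and sM: "sets M = sets config_space" using bond by (simp_all add: bond_percolation_def)
  interpret prob_space M by (rule P)
  have spM: "space M = space config_space" using sM by (rule sets_eq_imp_space_eq)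
  have sym: "prob (pullback g -` A \<inter> space config_space) = prob A"
    if "g \<in> lattice_symmetries" "A \<in> sets config_space" for g A
  proof -
    have "pullback g \<in> M \<rightarrow>\<^sub>M M" using measurable_pullback[OF that(1)] sM by (simp cong: measurable_cong_sets)
    then have "measure (distr M M (pullback g)) A = prob (pullback g -` A \<inter> space M)"
      using that(2) sM by (intro measure_distr) simp_all
    moreover have "distr M M (pullback g) = M" using inv that(1) by (simp add: symmetry_invariant_def)
    ultimately show ?thesis by (simp add: spM)
  qed
  have dc: "prob (A \<inter> B) \<le> prob A * prob B + r n"
    if "1 \<le> n" "event_supported_in A (lattice_box (3 * int n))" "event_supported_in B (UNIV - lattice_box (4 * int n))" for n A B
    using dec[OF that] covariance_indicator[OF P, of A B] supported_sets[OF that(2)] supported_sets[OF that(3)] sM by simp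
  show ?thesis
  proof unfold_locales
    show "sets M = sets config_space" by (rule sM)
  next
    fix A v assume "A \<in> sets config_space"
    then show "prob (pullback (translation v) -` A \<inter> space config_space) = prob A"
      by (rule sym[OF lattice_symmetries.translation])
  next
    fix A assume "A \<in> sets config_space"
    then show "prob (pullback prod.swap -` A \<inter> space config_space) = prob A" by (rule sym[OF swap_symmetry])
  next
    fix A assume "A \<in> sets config_space"
    then show "prob (pullback negx -` A \<inter> space config_space) = prob A" by (rule sym[OF negx_symmetry])
  next
    fix A B assume "increasing_event A" "increasing_event B"
    then show "prob A * prob B \<le> prob (A \<inter> B)" using fkg by (simp add: satisfies_FKG_def)
  next
    fix \<epsilon> :: real and n :: int assume e: "0 < \<epsilon>"
    \<comment> \<open>The case of a single summand says that \<open>r\<close> tends to 0.\<close>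
    obtain n1 where n1: "1 \<le> n1" "\<forall>k\<ge>n1. \<forall>J. (\<Sum>j<J. r (2 ^ j * k)) \<le> \<epsilon>"
      using geometric_scales_sum[OF r order_refl e] by blast
    define k where "k = max n1 (nat n)"
    have k: "1 \<le> k" "n1 \<le> k" "n \<le> 3 * int k" using n1 by (simp_all add: k_def)
    have "(\<Sum>j<1. r (2 ^ j * k)) \<le> \<epsilon>" using n1(2) k(2) by blast
    then have rk: "r k \<le> \<epsilon>" by simp
    show "\<exists>N. \<forall>A B. event_supported_in A (lattice_box n) \<longrightarrow>
        event_supported_in B (UNIV - lattice_box N) \<longrightarrow> prob (A \<inter> B) \<le> prob A * prob B + \<epsilon>"
    proof (intro exI[of _ "4 * int k"] allI impI)
      fix A B assume a: "event_supported_in A (lattice_box n)" "event_supported_in B (UNIV - lattice_box (4 * int k))"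
      have "lattice_box n \<subseteq> lattice_box (3 * int k)" using k(3) by (auto simp: lattice_box_def)
      from dc[OF k(1) supported_mono[OF a(1) this] a(2)] rk
      show "prob (A \<inter> B) \<le> prob A * prob B + \<epsilon>" by simp
    qed
  qed (use r dc in simp_all)
qed

text \<open>The all-open and, below, the all-closed configuration witness that the crossing events
  are non-trivial.\<close>

lemma open_config:
  defines "\<omega> \<equiv> (\<lambda>e\<in>lattice_edges. True)"
  shows "\<omega> \<in> space config_space" and "u \<in> rect a b c d \<Longrightarrow> v \<in> rect a b c d \<Longrightarrow> v \<in> clus \<omega> (rect a b c d) u"
proof -
  show "\<omega> \<in> space config_space" by (simp add: space_config \<omega>_def)
  assume uv: "u \<in> rect a b c d" "v \<in> rect a b c d"
  have "openrel \<omega> (rect a b c d) = {(s, t). adjacent s t \<and> s \<in> rect a b c d \<and> t \<in> rect a b c d}"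
    using adjacent_edge by (auto simp: openrel_def \<omega>_def)
  then show "v \<in> clus \<omega> (rect a b c d) u" using lattice_connected_rect[of a b c d] uv unfolding lattice_connected_def clus_def by simp
qed

lemma closed_config:
  defines "\<omega> \<equiv> (\<lambda>e\<in>lattice_edges. False)"
  shows "\<omega> \<in> space config_space" and "clus \<omega> S u = {u}"
proof -
  show "\<omega> \<in> space config_space" by (simp add: space_config \<omega>_def)
  have "openrel \<omega> S = {}" using adjacent_edge by (auto simp: openrel_def \<omega>_def)
  then show "clus \<omega> S u = {u}" by (auto simp: clus_def)
qed

lemma hcross_fin: "finitely_supported_event (hcross a b c d)"
  unfolding Arm_def by (rule finitely_supported_cluster_meets) simp_all

lemma far_fin: "finitely_supported_event (far m n)"
  unfolding far_def by (rule finitely_supported_cluster_meets) (simp_all add: lattice_box_rect)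

lemma hcross_nontrivial:
  assumes "a < b" "c \<le> d" shows "nontrivial_event (hcross a b c d)"
  unfolding nontrivial_event_def
proof
  have "(\<lambda>e\<in>lattice_edges. True) \<in> hcross a b c d"
    by (rule ArmI[OF open_config(1), of "(a, c)" _ _ _ _ c _ c]) (use assms open_config(2) in auto)
  then show "hcross a b c d \<noteq> {}" by blast
  have "(\<lambda>e\<in>lattice_edges. False) \<notin> hcross a b c d"
  proof
    assume "(\<lambda>e\<in>lattice_edges. False) \<in> hcross a b c d"
    then show False by (rule ArmE) (use assms in \<open>auto simp: closed_config(2)\<close>)
  qed
  then show "hcross a b c d \<noteq> space config_space" using closed_config(1) by blast
qed

lemma far_nontrivial:
  assumes "1 \<le> n" shows "nontrivial_event (far n (2 * n))"
  unfolding nontrivial_event_def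
proof
  have "(\<lambda>e\<in>lattice_edges. True) \<in> far n (2 * n)"
    unfolding far_def lattice_box_rect
    by (rule cluster_meets2I[OF open_config(1), of "(0, 0)" _ _ "(2 * n, 0)"]) (use assms open_config(2) in \<open>auto simp: supn_def\<close>)
  then show "far n (2 * n) \<noteq> {}" by blast
  have "(\<lambda>e\<in>lattice_edges. False) \<notin> far n (2 * n)"
  proof
    assume "(\<lambda>e\<in>lattice_edges. False) \<in> far n (2 * n)"
    then show False unfolding far_def
      by (rule cluster_meets2E) (use assms in \<open>simp add: closed_config(2) supn_box\<close>)
  qed
  then show "far n (2 * n) \<noteq> space config_space" using closed_config(1) by blast
qed

lemma increasing_connected: "increasing_event connected_to_infinity"
  unfolding increasing_event_def
proof (intro conjI ballI impI)
  show "connected_to_infinity \<in> sets config_space" by (rule connected_to_infinity_event)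
  fix \<omega> \<omega>' assume a: "\<omega> \<in> connected_to_infinity" "\<omega>' \<in> space config_space" "\<forall>e\<in>lattice_edges. \<omega> e \<le> \<omega>' e"
  have "clus \<omega> UNIV (0, 0) \<subseteq> clus \<omega>' UNIV (0, 0)"
  proof (rule clus_mono_config)
    fix e assume "e \<in> lattice_edges" "\<omega> e"
    with bspec[OF a(3) this(1)] show "\<omega>' e" by simp
  qed
  moreover have "infinite (clus \<omega> UNIV (0, 0))" using a(1) by (simp add: connected_to_infinity_def cluster_clus)
  ultimately have "infinite (clus \<omega>' UNIV (0, 0))" using finite_subset by blast
  then show "\<omega>' \<in> connected_to_infinity" using a(2) by (simp add: connected_to_infinity_def cluster_clus)
qed

theorem theorem1p3:
  fixes P :: "real \<Rightarrow> config measure"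
  assumes percolation: "\<And>l. l \<in> {0..1} \<Longrightarrow> bond_percolation (P l)"
    and monotone: "\<And>A. increasing_event A \<Longrightarrow> mono_on {0..1} (\<lambda>l. measure (P l) A)"
    and invariant: "\<And>l. l \<in> {0..1} \<Longrightarrow> symmetry_invariant (P l)"
    and ergodic: "\<And>l. l \<in> {0..1} \<Longrightarrow> shift_ergodic (P l)"
    and FKG: "\<And>l. l \<in> {0..1} \<Longrightarrow> satisfies_FKG (P l)"
    and decorrelation:
      "\<exists>r :: nat \<Rightarrow> real.
         (\<forall>n\<ge>1. 0 \<le> r n) \<and> (\<forall>m\<ge>1. \<forall>n\<ge>m. r n \<le> r m) \<and>
         summable (\<lambda>n. r (Suc n) / real (Suc n)) \<and>
         (\<forall>n\<ge>1. \<forall>l\<in>{0..1}. \<forall>A B.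
            event_supported_in A (lattice_box (3 * int n)) \<longrightarrow>
            event_supported_in B (UNIV - lattice_box (4 * int n)) \<longrightarrow>
            covariance (P l) (indicator A) (indicator B) \<le> r n)"
    and continuous:
      "\<And>A. finitely_supported_event A \<Longrightarrow> continuous_on {0..1} (\<lambda>l. measure (P l) A)"
    and limit_0:
      "\<And>A. finitely_supported_event A \<Longrightarrow> nontrivial_event A \<Longrightarrow> increasing_event A \<Longrightarrow>
         ((\<lambda>l. measure (P l) A) \<longlongrightarrow> 0) (at 0 within {0..1})"
    and limit_1:
      "\<And>A. finitely_supported_event A \<Longrightarrow> nontrivial_event A \<Longrightarrow> increasing_event A \<Longrightarrow>
         ((\<lambda>l. measure (P l) A) \<longlongrightarrow> 1) (at 1 within {0..1})"
  shows "critical_parameter P \<in> {0<..<1} \<and>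
         percolation_density P (critical_parameter P) = 0"
proof -
  obtain r :: "nat \<Rightarrow> real" where r: "\<forall>n\<ge>1. 0 \<le> r n" "\<forall>m\<ge>1. \<forall>n\<ge>m. r n \<le> r m"
    "summable (\<lambda>n. r (Suc n) / real (Suc n))"
    "\<forall>n\<ge>1. \<forall>l\<in>{0..1}. \<forall>A B. event_supported_in A (lattice_box (3 * int n)) \<longrightarrow>
       event_supported_in B (UNIV - lattice_box (4 * int n)) \<longrightarrow> covariance (P l) (indicator A) (indicator B) \<le> r n"
    using decorrelation by (elim exE conjE) (rule that)
  have r': "0 \<le> r n" if "1 \<le> n" for n using r(1) that by blast
  have r'': "r n \<le> r m" if "1 \<le> m" "m \<le> n" for m n using r(2) that by blast
  have pd: "perc_dec (P l) r" if l: "l \<in> {0..1}" for l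
  proof (rule perc_decI[OF percolation[OF l] invariant[OF l] FKG[OF l] r' r'' r(3)])
    fix n A B assume "(1::nat) \<le> n" "event_supported_in A (lattice_box (3 * int n))"
      "event_supported_in B (UNIV - lattice_box (4 * int n))"
    then show "covariance (P l) (indicator A) (indicator B) \<le> r n" using r(4) l by blast
  qed
  let ?\<theta> = "percolation_density P"
  define S where "S = {l \<in> {0..1}. ?\<theta> l > 0}"
  let ?h = "\<lambda>n. hcross 0 (6 * int n) 0 (5 * int n)"
  have "(0 :: real) < 1 / 1827904" "(0 :: real) < 1 / (4 * 2313441\<^sup>2)" by simp_all
  note kap = this
  obtain n1 where n1: "1 \<le> n1" "\<forall>n\<ge>n1. \<forall>J. (\<Sum>j<J. r (3 ^ j * n)) \<le> 1 / 1827904"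
    using geometric_scales_sum[OF r' r'' r(3) _ kap(1), of 3] by auto
  obtain n2 where n2: "1 \<le> n2" "\<forall>n\<ge>n2. \<forall>J. (\<Sum>j<J. r (9 ^ j * n)) \<le> 1 / (4 * 2313441\<^sup>2)"
    using geometric_scales_sum[OF r' r'' r(3) _ kap(2), of 9] by auto
  \<comment> \<open>A condition at the single scale \<open>n\<close> involves finitely many edges,
    so continuity in the parameter applies to it, while the bound on \<open>r\<close> is common to
    all parameters.\<close>
  have inS: "l \<in> S" if l: "l \<in> {0..1}" and n: "n1 \<le> n" and h: "1 - measure (P l) (?h n) \<le> 1 / 1352" for l n
  proof -
    have "0 < measure (P l) connected_to_infinity"
    proof (rule perc_dec.percolation_of_hard_crossing[OF pd[OF l] _ h])
      show "1 \<le> n" using n n1(1) by simp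
      show "(\<Sum>j<J. r (3 ^ j * n)) \<le> 1 / 1827904" for J using n1(2) n by blast
    qed
    then show ?thesis using l by (simp add: S_def percolation_density_def)
  qed
  obtain b where b: "b \<in> S" "b < 1"
  proof -
    have "((\<lambda>l. measure (P l) (?h n1)) \<longlongrightarrow> 1) (at 1 within {0..1})"
      by (rule limit_1[OF hcross_fin hcross_nontrivial increasing_Arm]) (use n1 in simp_all)
    then have "eventually (\<lambda>l. 1 - 1 / 1352 < measure (P l) (?h n1)) (at 1 within {0..1})"
      by (rule order_tendstoD) simp
    then obtain d where d: "0 < d" "\<forall>x\<in>{0..1}. x \<noteq> 1 \<and> dist x 1 < d \<longrightarrow> 1 - 1 / 1352 < measure (P x) (?h n1)"
      unfolding eventually_at by blast
    define x where "x = max 0 (1 - d / 2)"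
    have x: "x \<in> {0..1}" "x \<noteq> 1" "dist x 1 < d" "x < 1" using d(1) by (auto simp: x_def dist_real_def max_def)
    then have "1 - 1 / 1352 < measure (P x) (?h n1)" using d(2) by blast
    then have "x \<in> S" by (intro inS[OF x(1) order_refl]) simp
    with x(4) show thesis using that by blast
  qed
  obtain a where a: "0 < a" "\<And>l. l \<in> S \<Longrightarrow> a \<le> l"
  proof -
    let ?f = "far (int n2) (2 * int n2)"
    have "((\<lambda>l. measure (P l) ?f) \<longlongrightarrow> 0) (at 0 within {0..1})"
      by (rule limit_0[OF far_fin far_nontrivial increasing_far]) (use n2 in simp)
    then have "eventually (\<lambda>l. measure (P l) ?f < 1 / (2 * 2313441)) (at 0 within {0..1})"
      by (rule order_tendstoD) simp
    then obtain d where d: "0 < d" "\<forall>x\<in>{0..1}. x \<noteq> 0 \<and> dist x 0 < d \<longrightarrow> measure (P x) ?f < 1 / (2 * 2313441)"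
      unfolding eventually_at by blast
    have z: "?\<theta> x = 0" if x: "x \<in> {0..1}" "x \<noteq> 0" "x < d" for x
    proof -
      have "dist x 0 < d" using x by (simp add: dist_real_def)
      then have "measure (P x) ?f \<le> 1 / (2 * 2313441)" using d(2) x by (simp add: less_imp_le)
      then have "measure (P x) connected_to_infinity = 0"
        by (intro perc_dec.no_percolation_of_far[OF pd[OF x(1)] n2(1)]) (use n2(2) in simp_all)
      then show ?thesis by (simp add: percolation_density_def)
    qed
    define y where "y = min 1 (d / 2)"
    have y: "y \<in> {0..1}" "y \<noteq> 0" "y < d" using d(1) by (auto simp: y_def)
    \<comment> \<open>The limit at 0 says nothing about the parameter 0 itself; monotonicity covers
      it.\<close>
    have "?\<theta> 0 \<le> ?\<theta> y" unfolding percolation_density_def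
      using monotone[OF increasing_connected] y by (auto simp: mono_on_def)
    then have z0: "?\<theta> 0 \<le> 0" using z[OF y] by simp
    show thesis
    proof (rule that[OF d(1)])
      fix l assume l: "l \<in> S"
      show "d \<le> l"
      proof (rule ccontr)
        assume "\<not> d \<le> l"
        then have "?\<theta> l \<le> 0" using z[of l] z0 l by (cases "l = 0") (auto simp: S_def)
        with l show False by (simp add: S_def)
      qed
    qed
  qed
  define c where "c = critical_parameter P"
  \<comment> \<open>\<open>S\<close> contains \<open>b\<close>, so the default value 1 of
    \<open>critical_parameter\<close> does not occur.\<close>
  have cS: "c = Inf S" using b unfolding c_def critical_parameter_def S_def[symmetric] Let_def by auto
  have bdd: "bdd_below S" using a(2) by (rule bdd_belowI)
  have "c \<le> b" unfolding cS using b(1) bdd by (rule cInf_lower)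
  moreover have "a \<le> c" unfolding cS using b(1) a(2) by (intro cInf_greatest) auto
  ultimately have c: "0 < c" "c < 1" using a(1) b(2) by simp_all
  have "?\<theta> c = 0"
  proof (rule ccontr)
    assume "?\<theta> c \<noteq> 0"
    then have pos: "0 < measure (P c) connected_to_infinity"
      by (simp add: percolation_density_def zero_less_measure_iff)
    have cl: "c \<in> {0..1}" using c by simp
    interpret perc_dec "P c" r by (rule pd[OF cl])
    \<comment> \<open>Half of the threshold \<open>1 / 1352\<close>: the slack survives a small
      decrease of the parameter.\<close>
    obtain m where m: "int n1 \<le> m" "1 - prob (hcross 0 (6 * m) 0 (5 * m)) \<le> 1 / 2704"
      using hard_crossing_of_percolation[OF ergodic[OF cl] pos, of "1 / 2704" "int n1"] by auto
    define n where "n = nat m"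
    have n: "n1 \<le> n" "1 - prob (?h n) \<le> 1 / 2704" using m by (simp_all add: n_def)
    have "continuous_on {0..1} (\<lambda>l. measure (P l) (?h n))" by (rule continuous[OF hcross_fin])
    then have "((\<lambda>l. measure (P l) (?h n)) \<longlongrightarrow> prob (?h n)) (at c within {0..1})"
      using cl by (simp add: continuous_on)
    then have "eventually (\<lambda>l. 1 - 1 / 1352 < measure (P l) (?h n)) (at c within {0..1})"
      by (rule order_tendstoD) (use n(2) in simp)
    then obtain d where d: "0 < d" "\<forall>x\<in>{0..1}. x \<noteq> c \<and> dist x c < d \<longrightarrow> 1 - 1 / 1352 < measure (P x) (?h n)"
      unfolding eventually_at by blast
    \<comment> \<open>A point of \<open>[0,1]\<close> strictly below \<open>c\<close> and still in
      the neighbourhood; by \<open>inS\<close> it belongs to \<open>S\<close>, against the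
      infimum.\<close>
    define x where "x = max 0 (c - d / 2)"
    have x: "x \<in> {0..1}" "x < c" "dist x c < d" using d(1) c by (auto simp: x_def dist_real_def max_def)
    then have "1 - 1 / 1352 < measure (P x) (?h n)" using d(2) by auto
    then have "x \<in> S" by (intro inS[OF x(1) n(1)]) simp
    then have "c \<le> x" unfolding cS using bdd by (rule cInf_lower)
    with x(2) show False by simp
  qed
  with c show ?thesis by (simp add: c_def)
qed

end
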